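(* Let $\nu>0$. For $\psi\in L^{2,\nu}(\mathbb{C})$ and $(z,w)\in\mathbb{C}^2$ set $$\mathcal{T}^\nu(\psi)(z,w) := \left(\frac{\nu}{\pi}\right)^{3/2} \int_{\mathbb{C}} e^{-\nu(z-\xi)(w-\overline{\xi})}\,\psi(\xi)\, d\lambda(\xi).$$ Then the integral operator $\mathcal{T}^\nu$ defines an isometric isomorphism from $L^{2,\nu}(\mathbb{C})$ onto the two-dimensional Bargmann-Fock space $\mathcal{F}^{2,\nu}(\mathbb{C}^2)$. Its inverse is given by $$\left(\mathcal{T}^\nu\right)^{-1}(\varphi)(\xi) = \left(\frac{\nu}{\pi}\right)^{3/2} \int_{\mathbb{C}^2} e^{-\nu(|z|^2+|w|^2)+\nu(\overline{z}\xi+\overline{w}\,\overline{\xi}-\overline{z}\,\overline{w})}\,\varphi(z,w)\, d\lambda(z,w).$$ Moreover, we have $$\int_{\mathbb{C}} e^{-\nu(z-\xi)(w-\overline{\xi})}\, H_{m,n}^{\nu}(\xi,\overline{\xi})\, d\lambda(\xi) = \left(\frac{\pi}{\nu}\right)\nu^{m+n} z^m w^n$$ for all integers $m,n\ge 0$ and all $z,w\in\mathbb{C}$.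
   Context: For $X=\mathbb{C}$ or $X=\mathbb{C}^2$, $d\lambda$ denotes Lebesgue measure on $X$ (with $\mathbb{C}\simeq\mathbb{R}^2$, $\mathbb{C}^2\simeq\mathbb{R}^4$), and $L^{2,\nu}(X)$ is the Hilbert space of functions on $X$ that are square integrable with respect to the Gaussian measure $e^{-\nu|s|^2}d\lambda(s)$, where $|s|^2=|z|^2+|w|^2$ for $s=(z,w)\in\mathbb{C}^2$. The Bargmann-Fock space $\mathcal{F}^{2,\nu}(X)$ is the space of holomorphic functions on $X$ belonging to $L^{2,\nu}(X)$, with the norm of $L^{2,\nu}(X)$. The univariate complex Hermite polynomials are, for integers $m,n\ge0$, $$H_{m,n}^\nu(z,\overline{z})=(-1)^{m+n}e^{\nu z\overline{z}}\frac{\partial^{m+n}}{\partial \overline{z}^{m}\partial z^{n}}\left(e^{-\nu z\overline{z}}\right),$$ where $\partial/\partial z$ and $\partial/\partial\overline{z}$ are the Wirtinger derivatives.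
   Formalization: The integral in the inverse formula need not converge absolutely (e.g. φ the transform of a disc's indicator); it is read as the L^{2,ν}(C) limit of integrals over balls |(z,w)|≤R, R→∞, and literally for a.e. ξ at which it converges absolutely. *)

theory Defs
  imports "HOL-Analysis.Analysis"
begin

definition gauss_measure :: "real \<Rightarrow> 'a::euclidean_space measure" where
  "gauss_measure \<nu> = density lebesgue (\<lambda>s. ennreal (exp (- \<nu> * (norm s)\<^sup>2)))"

text \<open>Elements of the weighted \<open>L\<^sup>2\<close> space are represented by functions; functions that agree
  almost everywhere represent the same element.\<close>

definition L2_gauss :: "real \<Rightarrow> ('a::euclidean_space \<Rightarrow> complex) set" where
  "L2_gauss \<nu> = {f. f \<in> borel_measurable lebesgue \<and>
                     integrable (gauss_measure \<nu>) (\<lambda>s. (cmod (f s))\<^sup>2)}"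

definition norm_gauss :: "real \<Rightarrow> ('a::euclidean_space \<Rightarrow> complex) \<Rightarrow> real" where
  "norm_gauss \<nu> f = sqrt (LINT s|gauss_measure \<nu>. (cmod (f s))\<^sup>2)"

text \<open>The membership conditions matter: the norm of a function outside the space is a junk value.\<close>

definition tendsto_L2_gauss ::
  "real \<Rightarrow> (real \<Rightarrow> 'a::euclidean_space \<Rightarrow> complex) \<Rightarrow> ('a \<Rightarrow> complex) \<Rightarrow> bool" where
  "tendsto_L2_gauss \<nu> F f \<longleftrightarrow>
     (\<forall>R. F R \<in> L2_gauss \<nu>) \<and> f \<in> L2_gauss \<nu> \<and>
     ((\<lambda>R. norm_gauss \<nu> (\<lambda>x. F R x - f x)) \<longlongrightarrow> 0) at_top"

text \<open>Complex differentiability at every point: the real Frechet derivative exists and is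
  complex linear.\<close>

definition holomorphic2 :: "(complex \<times> complex \<Rightarrow> complex) \<Rightarrow> bool" where
  "holomorphic2 f \<longleftrightarrow>
     (\<forall>s. \<exists>a b. (f has_derivative (\<lambda>h. a * fst h + b * snd h)) (at s))"

definition Fock2 :: "real \<Rightarrow> (complex \<times> complex \<Rightarrow> complex) set" where
  "Fock2 \<nu> = {f. holomorphic2 f} \<inter> L2_gauss \<nu>"

text \<open>An isometric isomorphism from a space \<open>V\<close> of functions modulo equality almost everywhere
  onto a space \<open>W\<close> in which almost everywhere equal functions are equal (as in \<open>Fock2\<close>).\<close>

definition isometric_isomorphism_L2 ::
  "real \<Rightarrow> (('a::euclidean_space \<Rightarrow> complex) \<Rightarrow> 'b::euclidean_space \<Rightarrow> complex) \<Rightarrow>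
   ('a \<Rightarrow> complex) set \<Rightarrow> ('b \<Rightarrow> complex) set \<Rightarrow> bool" where
  "isometric_isomorphism_L2 \<nu> T V W \<longleftrightarrow>
     (\<forall>f\<in>V. T f \<in> W) \<and>
     (\<forall>f\<in>V. \<forall>g\<in>V. T f = T g \<longleftrightarrow> (AE x in lebesgue. f x = g x)) \<and>
     (\<forall>f\<in>V. \<forall>g\<in>V. \<forall>a b. T (\<lambda>x. a * f x + b * g x) = (\<lambda>y. a * T f y + b * T g y)) \<and>
     (\<forall>f\<in>V. norm_gauss \<nu> (T f) = norm_gauss \<nu> f) \<and>
     (\<forall>h\<in>W. \<exists>f\<in>V. T f = h)"

definition T_kernel :: "real \<Rightarrow> complex \<Rightarrow> complex \<Rightarrow> complex \<Rightarrow> complex" where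
  "T_kernel \<nu> z w \<xi> = exp (- complex_of_real \<nu> * (z - \<xi>) * (w - cnj \<xi>))"

definition T_op :: "real \<Rightarrow> (complex \<Rightarrow> complex) \<Rightarrow> complex \<times> complex \<Rightarrow> complex" where
  "T_op \<nu> \<psi> = (\<lambda>(z, w). complex_of_real ((\<nu> / pi) powr (3/2)) *
                 (LINT \<xi>|lebesgue. T_kernel \<nu> z w \<xi> * \<psi> \<xi>))"

definition Tinv_integrand ::
  "real \<Rightarrow> (complex \<times> complex \<Rightarrow> complex) \<Rightarrow> complex \<Rightarrow> complex \<times> complex \<Rightarrow> complex" where
  "Tinv_integrand \<nu> \<phi> \<xi> = (\<lambda>(z, w).
     exp (- complex_of_real \<nu> * complex_of_real ((cmod z)\<^sup>2 + (cmod w)\<^sup>2)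
          + complex_of_real \<nu> * (cnj z * \<xi> + cnj w * cnj \<xi> - cnj z * cnj w)) * \<phi> (z, w))"

text \<open>The inversion integral extended over \<open>A\<close>. For \<open>A = UNIV\<close> it does not converge absolutely
  for every \<open>\<phi>\<close> in \<open>Fock2 \<nu>\<close> (it diverges, for every \<open>\<xi>\<close>, if \<open>\<phi>\<close> is the transform of
  the indicator function of a disc), so, as in Fourier-Plancherel inversion, the integral over the
  whole space has to be understood in general as the \<open>L\<^sup>2\<close> limit of integrals over growing balls.\<close>

definition Tinv_on ::
  "real \<Rightarrow> (complex \<times> complex) set \<Rightarrow> (complex \<times> complex \<Rightarrow> complex) \<Rightarrow> complex \<Rightarrow> complex" where
  "Tinv_on \<nu> A \<phi> \<xi> = complex_of_real ((\<nu> / pi) powr (3/2)) *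
                 (LINT s:A|lebesgue. Tinv_integrand \<nu> \<phi> \<xi> s)"

definition partial_x :: "(complex \<Rightarrow> complex) \<Rightarrow> complex \<Rightarrow> complex" where
  "partial_x f z = vector_derivative (\<lambda>t. f (z + complex_of_real t)) (at 0)"

definition partial_y :: "(complex \<Rightarrow> complex) \<Rightarrow> complex \<Rightarrow> complex" where
  "partial_y f z = vector_derivative (\<lambda>t. f (z + \<i> * complex_of_real t)) (at 0)"

definition wirtinger :: "(complex \<Rightarrow> complex) \<Rightarrow> complex \<Rightarrow> complex" where
  "wirtinger f z = (partial_x f z - \<i> * partial_y f z) / 2"

definition wirtinger_bar :: "(complex \<Rightarrow> complex) \<Rightarrow> complex \<Rightarrow> complex" where
  "wirtinger_bar f z = (partial_x f z + \<i> * partial_y f z) / 2"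

definition complex_hermite :: "real \<Rightarrow> nat \<Rightarrow> nat \<Rightarrow> complex \<Rightarrow> complex" where
  "complex_hermite \<nu> m n z =
     (- 1) ^ (m + n) * exp (complex_of_real \<nu> * z * cnj z) *
     (wirtinger_bar ^^ m) ((wirtinger ^^ n) (\<lambda>u. exp (- complex_of_real \<nu> * u * cnj u))) z"

end

theory Submission
  imports Defs "HOL-Probability.Characteristic_Functions" "HOL-Complex_Analysis.Cauchy_Integral_Formula"
begin

text \<open>Let \<open>\<gamma>\<close> be the Gaussian measure, on \<open>\<complex>\<close> or on \<open>\<complex>\<^sup>2\<close>, and \<open>c = (\<nu>/pi) powr (3/2)\<close>. For \<open>s = (z, w)\<close> put
\<open>k\<^sub>s(x) = exp (\<nu> (z cnj x + w x - z w))\<close>, which is \<open>Fock_kernel\<close>. Then \<open>T_op \<psi> s\<close> is \<open>c\<close> times the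
\<open>\<gamma>\<close>-integral of \<open>k\<^sub>s \<psi>\<close>, and the inverse formula integrates against \<open>cnj k\<^sub>s\<close>: it is the Hilbert
space adjoint of \<open>T_op\<close>. Every explicit computation comes from one planar integral with two
independent complex parameters,
\<open>\<integral> exp (- \<nu> |x|\<^sup>2 + a x + b cnj x) dx = (pi/\<nu>) exp (a b / \<nu>)\<close>
(\<open>has_bochner_integral_gaussian\<close>).

Isometry. Formally \<open>\<integral> k\<^sub>s(x) cnj (k\<^sub>s(y)) d\<gamma>(s)\<close> is a point mass at \<open>x = y\<close>, but that integral
diverges. With the weight \<open>exp (- \<mu> |s|\<^sup>2)\<close>, \<open>\<mu> > \<nu>\<close>, it converges, and its value is, up to Gaussian
weights in \<open>x\<close> and \<open>y\<close>, an approximate identity in \<open>x - y\<close> (\<open>Fock_kernel_regularized\<close>, \<open>T_op_regularized\<close>). Schur's test and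
Fatou's lemma make \<open>T_op\<close> a contraction; letting \<open>\<mu>\<close> tend to \<open>\<nu>\<close> gives equality of norms for
bounded continuous \<open>\<psi>\<close>, and these are dense, so equality holds on the whole space
(\<open>T_op_isometry\<close>).

Surjectivity. If \<open>h\<close> vanishes off a ball, the adjoint integral \<open>T_adj h\<close> converges absolutely, and
\<open>T_op (T_adj h)\<close> integrates \<open>h\<close> against the reproducing kernel of the Fock space (\<open>T_op_T_adj\<close>). For
\<open>\<phi>\<close> in the Fock space the truncations of \<open>\<phi>\<close> to growing balls have a Cauchy sequence of
\<open>T_adj\<close>-images; its limit is mapped to \<open>\<phi>\<close> because \<open>\<phi>\<close> is reproduced by the kernel
(\<open>Fock_reproducing\<close>). That property is a mean value theorem at the origin, transported by
translations; it combines Cauchy's formula on circles with the rotation invariance of Lebesgue measure.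

Inversion. Let \<open>\<phi> = T_op \<psi>\<close> and let \<open>D\<close> be the difference between the inversion integral over the
ball of radius \<open>R\<close> and \<open>\<psi>\<close>. Adjointness and preservation of inner products give
\<open>\<parallel>D\<parallel>\<^sup>2 = \<langle>1\<^sub>R \<phi> - \<phi>, T_op D\<rangle>\<close>, hence \<open>\<parallel>D\<parallel> \<le> \<parallel>1\<^sub>R \<phi> - \<phi>\<parallel>\<close>, which tends to \<open>0\<close>. An almost everywhere
convergent subsequence identifies the limit wherever the full integral converges absolutely.

Hermite polynomials. In the Gaussian integral above, multiplying the integrand by \<open>x\<close> amounts to
differentiating in \<open>a\<close>, and multiplying by \<open>cnj x\<close> to differentiating in \<open>b\<close>. The polynomials times
the Gaussian satisfy a recurrence that involves only these multiplications, so their integrals are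
found by induction (\<open>bilaplace_gauss_deriv\<close>).\<close>

section \<open>Gaussian integrals with complex linear terms\<close>

lemma has_bochner_integral_prod_mult:
  fixes f :: "'a \<Rightarrow> 'c::{real_normed_field, banach, second_countable_topology}"
  assumes "sigma_finite_measure M" "sigma_finite_measure N"
    and f: "has_bochner_integral M f a" and g: "has_bochner_integral N g b"
  shows "has_bochner_integral (M \<Otimes>\<^sub>M N) (\<lambda>(x, y). f x * g y) (a * b)"
proof -
  interpret M: sigma_finite_measure M by fact
  interpret N: sigma_finite_measure N by fact
  interpret P: pair_sigma_finite M N ..
  have fi: "integrable M f" "integral\<^sup>L M f = a" and gi: "integrable N g" "integral\<^sup>L N g = b"
    using f g by (auto simp: has_bochner_integral_iff)
  have fm [measurable]: "f \<in> borel_measurable M" and gm [measurable]: "g \<in> borel_measurable N"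
    using fi gi by auto
  have int: "integrable (M \<Otimes>\<^sub>M N) (\<lambda>(x, y). f x * g y)"
  proof (rule P.Fubini_integrable)
    show "(\<lambda>(x, y). f x * g y) \<in> borel_measurable (M \<Otimes>\<^sub>M N)" by measurable
    show "integrable M (\<lambda>x. LINT y|N. norm (case (x, y) of (x, y) \<Rightarrow> f x * g y))"
      using fi gi by (simp add: norm_mult)
    show "AE x in M. integrable N (\<lambda>y. case (x, y) of (x, y) \<Rightarrow> f x * g y)"
      using gi by simp
  qed
  moreover have "integral\<^sup>L (M \<Otimes>\<^sub>M N) (\<lambda>(x, y). f x * g y) = a * b"
    using P.integral_fst[OF int] fi gi by simp
  ultimately show ?thesis by (simp add: has_bochner_integral_iff)
qed

text \<open>Completing the square in the real part of \<open>c\<close> leaves the imaginary part as a frequency, so the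
integral is a value of the characteristic function of the standard normal distribution.\<close>

lemma has_bochner_integral_gaussian_real:
  fixes c :: complex
  assumes "\<nu> > 0"
  shows "has_bochner_integral lborel (\<lambda>x::real. exp (- of_real \<nu> * (of_real x)\<^sup>2 + c * of_real x))
           (of_real (sqrt (pi / \<nu>)) * exp (c\<^sup>2 / (4 * of_real \<nu>)))"
proof -
  define p q where "p = Re c" and "q = Im c"
  have c: "c = of_real p + \<i> * of_real q" by (simp add: p_def q_def complex_eq_iff)
  define \<sigma> where "\<sigma> = sqrt (2 * \<nu>)"
  have \<sigma>: "\<sigma> > 0" "\<sigma>\<^sup>2 = 2 * \<nu>" using assms by (auto simp: \<sigma>_def)
  define t where "t = q / \<sigma>"
  define F where "F y = of_real (std_normal_density y) * exp (\<i> * of_real (t * y))" for y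
  have "has_bochner_integral lborel F (of_real (exp (- t\<^sup>2 / 2)))"
  proof -
    have [measurable]: "F \<in> borel_measurable borel"
      unfolding F_def std_normal_density_def
      by (intro borel_measurable_continuous_onI continuous_intros) auto
    have "integrable lborel F"
      by (rule Bochner_Integration.integrable_bound[OF integrable_std_normal_moment[of 0]])
         (auto simp: F_def norm_mult)
    moreover have "(LINT y|lborel. F y) = of_real (exp (- t\<^sup>2 / 2))"
    proof -
      have "char std_normal_distribution t = (LINT y|lborel. F y)"
        unfolding char_def F_def by (subst integral_density) (auto simp: scaleR_conv_of_real)
      thus ?thesis by (simp add: char_std_normal_distribution)
    qed
    ultimately show ?thesis by (simp add: has_bochner_integral_iff)
  qed
  \<comment> \<open>The substitution \<open>y = \<sigma> x - p / \<sigma>\<close> centres the Gaussian at \<open>p / (2 \<nu>)\<close> and scales it to unit variance.\<close>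
  hence "has_bochner_integral lborel (\<lambda>x. F (- (p / \<sigma>) + \<sigma> * x)) (of_real (exp (- t\<^sup>2 / 2)) /\<^sub>R \<bar>\<sigma>\<bar>)"
    using lborel_has_bochner_integral_real_affine_iff[of \<sigma> F _ "- (p / \<sigma>)"] \<sigma> by simp
  hence "has_bochner_integral lborel
     (\<lambda>x. (of_real (sqrt (2 * pi)) * exp (of_real (p\<^sup>2 / (4 * \<nu>)) + \<i> * of_real (q * p / (2 * \<nu>))))
             * F (- (p / \<sigma>) + \<sigma> * x))
     ((of_real (sqrt (2 * pi)) * exp (of_real (p\<^sup>2 / (4 * \<nu>)) + \<i> * of_real (q * p / (2 * \<nu>))))
       * (of_real (exp (- t\<^sup>2 / 2)) /\<^sub>R \<bar>\<sigma>\<bar>))"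
    by (rule has_bochner_integral_mult_right)
  moreover have "(of_real (sqrt (2 * pi)) * exp (of_real (p\<^sup>2 / (4 * \<nu>)) + \<i> * of_real (q * p / (2 * \<nu>))))
             * F (- (p / \<sigma>) + \<sigma> * x) = exp (- of_real \<nu> * (of_real x)\<^sup>2 + c * of_real x)" for x
  proof -
    have e1: "- (- (p / \<sigma>) + \<sigma> * x)\<^sup>2 / 2 + p\<^sup>2 / (4 * \<nu>) = - \<nu> * x\<^sup>2 + p * x"
    proof -
      have "(- (p / \<sigma>) + \<sigma> * x)\<^sup>2 = p\<^sup>2 / \<sigma>\<^sup>2 - 2 * p * x + \<sigma>\<^sup>2 * x\<^sup>2"
        using \<sigma>(1) by (simp add: power2_eq_square field_simps)
      thus ?thesis using assms unfolding \<sigma> by (simp add: field_simps)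
    qed
    have e2: "q * p / (2 * \<nu>) + t * (- (p / \<sigma>) + \<sigma> * x) = q * x"
    proof -
      have "t * (- (p / \<sigma>) + \<sigma> * x) = q * x - q * p / \<sigma>\<^sup>2"
        using \<sigma>(1) by (simp add: t_def power2_eq_square field_simps)
      thus ?thesis unfolding \<sigma> by simp
    qed
    have F_eq: "F (- (p / \<sigma>) + \<sigma> * x) = of_real (1 / sqrt (2 * pi)) *
        exp (of_real (- (- (p / \<sigma>) + \<sigma> * x)\<^sup>2 / 2) + \<i> * of_real (t * (- (p / \<sigma>) + \<sigma> * x)))"
      unfolding F_def std_normal_density_def of_real_mult[of "1 / sqrt (2 * pi)"] exp_add exp_of_real
      by (simp only: mult.assoc)
    have combine: "(of_real (sqrt (2 * pi)) * exp (of_real A + \<i> * of_real B)) *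
        (of_real (1 / sqrt (2 * pi)) * exp (of_real u + \<i> * of_real v))
        = (exp (of_real (u + A) + \<i> * of_real (B + v)) :: complex)" for A B u v
      by (simp add: exp_add distrib_left)
    from F_eq have "(of_real (sqrt (2 * pi)) * exp (of_real (p\<^sup>2 / (4 * \<nu>)) + \<i> * of_real (q * p / (2 * \<nu>))))
             * F (- (p / \<sigma>) + \<sigma> * x)
        = exp (of_real (- (- (p / \<sigma>) + \<sigma> * x)\<^sup>2 / 2 + p\<^sup>2 / (4 * \<nu>)) +
               \<i> * of_real (q * p / (2 * \<nu>) + t * (- (p / \<sigma>) + \<sigma> * x)))"
      by (simp only: combine)
    also have "\<dots> = exp (- of_real \<nu> * (of_real x)\<^sup>2 + c * of_real x)"
      unfolding e1 e2 by (simp add: c algebra_simps)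
    finally show ?thesis .
  qed
  moreover have "(of_real (sqrt (2 * pi)) * exp (of_real (p\<^sup>2 / (4 * \<nu>)) + \<i> * of_real (q * p / (2 * \<nu>))))
       * (of_real (exp (- t\<^sup>2 / 2)) /\<^sub>R \<bar>\<sigma>\<bar>) = of_real (sqrt (pi / \<nu>)) * exp (c\<^sup>2 / (4 * of_real \<nu>))"
  proof -
    have a: "sqrt (2 * pi) / \<sigma> = sqrt (pi / \<nu>)" unfolding \<sigma>_def by (simp add: real_sqrt_divide[symmetric])
    have b: "c\<^sup>2 / (4 * of_real \<nu>) = of_real (p\<^sup>2 / (4 * \<nu>)) + \<i> * of_real (q * p / (2 * \<nu>)) + of_real (- t\<^sup>2 / 2)"
    proof -
      have t2: "t\<^sup>2 = q\<^sup>2 / (2 * \<nu>)" by (simp add: t_def power_divide \<sigma>)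
      show ?thesis using assms unfolding t2 c by (simp add: power2_eq_square field_simps)
    qed
    have scal: "of_real (sqrt (2 * pi)) * E * (of_real e /\<^sub>R \<bar>\<sigma>\<bar>) = of_real (sqrt (2 * pi) / \<sigma>) * (E * of_real e)"
      for E :: complex and e using \<sigma> by (simp add: scaleR_conv_of_real field_simps)
    show ?thesis
      using scal[of "complex_of_real (exp (p\<^sup>2 / (4 * \<nu>))) * iexp (q * p / (2 * \<nu>))" "exp (- t\<^sup>2 / 2)"]
      unfolding a b exp_add exp_of_real by (simp only: mult.assoc)
  qed
  ultimately show ?thesis by simp
qed

text \<open>Lets a planar Gaussian integral factor into two integrals over the line.\<close>

lemma distr_Complex_lborel:
  "distr (lborel \<Otimes>\<^sub>M lborel) borel (\<lambda>(x, y). Complex x y) = (lborel :: complex measure)"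
proof (rule lborel_eqI[symmetric])
  have m [measurable]: "(\<lambda>(x, y). Complex x y) \<in> borel_measurable (lborel \<Otimes>\<^sub>M lborel)"
    unfolding lborel_prod by (auto intro!: borel_measurable_continuous_onI continuous_intros simp: case_prod_beta Complex_eq)
  fix l u :: complex
  assume le: "\<And>b. b \<in> Basis \<Longrightarrow> l \<bullet> b \<le> u \<bullet> b"
  have "(\<lambda>(x, y). Complex x y) -` box l u \<inter> space (lborel \<Otimes>\<^sub>M lborel)
      = {Re l<..<Re u} \<times> {Im l<..<Im u}"
    by (auto simp: box_def Basis_complex_def space_pair_measure inner_complex_def)
  thus "emeasure (distr (lborel \<Otimes>\<^sub>M lborel) borel (\<lambda>(x, y). Complex x y)) (box l u) = (\<Prod>b\<in>Basis. (u - l) \<bullet> b)"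
    using le[of 1] le[of "\<i>"] by (simp add: emeasure_distr lborel.emeasure_pair_measure_Times Basis_complex_def inner_complex_def ennreal_mult)
qed simp

text \<open>For \<open>x = u + \<i> v\<close> the exponent is a quadratic in \<open>u\<close> with linear coefficient \<open>a + b\<close> plus a quadratic
in \<open>v\<close> with linear coefficient \<open>\<i> (a - b)\<close>, and \<open>(a + b)\<^sup>2 - (a - b)\<^sup>2 = 4 a b\<close>. Since \<open>a\<close> and \<open>b\<close> need not be
conjugate, this one formula also gives mixed products of the kernels of the transform.\<close>

lemma has_bochner_integral_gaussian:
  fixes a b :: complex
  assumes "\<nu> > 0"
  shows "has_bochner_integral lborel (\<lambda>x::complex. exp (- of_real \<nu> * (x * cnj x) + a * x + b * cnj x))
           (of_real (pi / \<nu>) * exp (a * b / of_real \<nu>))"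
proof -
  let ?f = "\<lambda>x::complex. exp (- of_real \<nu> * (x * cnj x) + a * x + b * cnj x)"
  have "has_bochner_integral (lborel \<Otimes>\<^sub>M lborel)
     (\<lambda>(x, y). exp (- of_real \<nu> * (of_real x)\<^sup>2 + (a + b) * of_real x) *
               exp (- of_real \<nu> * (of_real y)\<^sup>2 + (\<i> * (a - b)) * of_real y))
     ((of_real (sqrt (pi / \<nu>)) * exp ((a + b)\<^sup>2 / (4 * of_real \<nu>))) *
      (of_real (sqrt (pi / \<nu>)) * exp ((\<i> * (a - b))\<^sup>2 / (4 * of_real \<nu>))))"
    by (intro has_bochner_integral_prod_mult has_bochner_integral_gaussian_real assms) unfold_locales
  moreover have "(\<lambda>(x, y). exp (- of_real \<nu> * (of_real x)\<^sup>2 + (a + b) * of_real x) *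
               exp (- of_real \<nu> * (of_real y)\<^sup>2 + (\<i> * (a - b)) * of_real y)) = (\<lambda>(x, y). ?f (Complex x y))"
    by (auto simp: fun_eq_iff exp_add[symmetric] Complex_eq power2_eq_square algebra_simps)
  moreover have "(of_real (sqrt (pi / \<nu>)) * exp ((a + b)\<^sup>2 / (4 * of_real \<nu>))) *
      (of_real (sqrt (pi / \<nu>)) * exp ((\<i> * (a - b))\<^sup>2 / (4 * of_real \<nu>)))
      = of_real (pi / \<nu>) * exp (a * b / of_real \<nu>)"
  proof -
    have "(a + b)\<^sup>2 / (4 * of_real \<nu>) + (\<i> * (a - b))\<^sup>2 / (4 * of_real \<nu>) = a * b / of_real \<nu>"
      using assms by (simp add: power2_eq_square field_simps)
    moreover have "complex_of_real (sqrt (pi / \<nu>)) * of_real (sqrt (pi / \<nu>)) = of_real (pi / \<nu>)"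
      unfolding of_real_mult[symmetric] using assms by simp
    ultimately show ?thesis by (metis (no_types, lifting) exp_add mult.assoc mult.left_commute)
  qed
  ultimately have "has_bochner_integral (lborel \<Otimes>\<^sub>M lborel) (\<lambda>(x, y). ?f (Complex x y))
      (of_real (pi / \<nu>) * exp (a * b / of_real \<nu>))" by simp
  moreover have m [measurable]: "(\<lambda>(x, y). Complex x y) \<in> borel_measurable (lborel \<Otimes>\<^sub>M lborel)"
    unfolding lborel_prod by (auto intro!: borel_measurable_continuous_onI continuous_intros simp: case_prod_beta Complex_eq)
  moreover have [measurable]: "?f \<in> borel_measurable borel"
    by (auto intro!: borel_measurable_continuous_onI continuous_intros)
  ultimately have "has_bochner_integral (distr (lborel \<Otimes>\<^sub>M lborel) borel (\<lambda>(x, y). Complex x y)) ?f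
      (of_real (pi / \<nu>) * exp (a * b / of_real \<nu>))"
    by (simp add: has_bochner_integral_iff integrable_distr_eq integral_distr case_prod_beta' split_def)
  thus ?thesis by (simp add: distr_Complex_lborel)
qed

section \<open>Holomorphic dependence on parameters\<close>

text \<open>Decay that survives multiplication by any \<open>exp (r |x|)\<close>. Multiplying by \<open>x\<close> or \<open>cnj x\<close> preserves it,
so the transform defined next can be differentiated repeatedly.\<close>

definition rapid :: "(complex \<Rightarrow> complex) \<Rightarrow> bool" where
  "rapid g \<longleftrightarrow> g \<in> borel_measurable lebesgue \<and>
     (\<forall>r. integrable lebesgue (\<lambda>x. exp (r * cmod x) * cmod (g x)))"

text \<open>A Laplace transform in \<open>x\<close> and \<open>cnj x\<close> with independent complex parameters. Up to a constant and
the factor \<open>exp (- \<nu> z w)\<close> the transform \<open>T_op\<close> is its value at \<open>(\<nu> w, \<nu> z)\<close> on the Gaussian times \<open>\<psi>\<close>.\<close>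

definition bilaplace :: "(complex \<Rightarrow> complex) \<Rightarrow> complex \<times> complex \<Rightarrow> complex" where
  "bilaplace g s = (LINT x|lebesgue. exp (fst s * x + snd s * cnj x) * g x)"

lemma continuous_imp_lebesgue_measurable:
  fixes f :: "'a::euclidean_space \<Rightarrow> 'b::real_normed_vector"
  shows "continuous_on UNIV f \<Longrightarrow> f \<in> borel_measurable lebesgue"
  by (simp add: borel_measurable_continuous_onI measurable_completion)

lemma rapid_measurable: "rapid g \<Longrightarrow> g \<in> borel_measurable lebesgue"
  by (simp add: rapid_def)

lemma rapid_bound:
  assumes g: "rapid g" and f: "f \<in> borel_measurable lebesgue"
    and le: "\<And>x. cmod (f x) \<le> C * exp (r * cmod x)"
  shows "rapid (\<lambda>x. f x * g x)"
  unfolding rapid_def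
proof (intro conjI allI)
  note [measurable] = rapid_measurable[OF g] f
  have [measurable]: "(\<lambda>x::complex. x) \<in> borel_measurable lebesgue"
    by (intro continuous_imp_lebesgue_measurable continuous_intros)
  show "(\<lambda>x. f x * g x) \<in> borel_measurable lebesgue" by measurable
  fix q
  have "integrable lebesgue (\<lambda>x. C * (exp ((q + r) * cmod x) * cmod (g x)))"
    using g by (auto simp: rapid_def)
  thus "integrable lebesgue (\<lambda>x. exp (q * cmod x) * cmod (f x * g x))"
  proof (rule Bochner_Integration.integrable_bound)
    show "AE x in lebesgue. norm (exp (q * cmod x) * cmod (f x * g x))
        \<le> norm (C * (exp ((q + r) * cmod x) * cmod (g x)))"
    proof (intro AE_I2)
      fix x
      have "0 \<le> C * exp (r * cmod x)" using le[of x] norm_ge_zero order_trans by blast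
      hence "C \<ge> 0" by (simp add: zero_le_mult_iff)
      moreover have "exp (q * cmod x) * (cmod (f x) * cmod (g x))
           \<le> exp (q * cmod x) * ((C * exp (r * cmod x)) * cmod (g x))"
        using le[of x] by (intro mult_left_mono mult_right_mono) auto
      ultimately show "norm (exp (q * cmod x) * cmod (f x * g x))
        \<le> norm (C * (exp ((q + r) * cmod x) * cmod (g x)))"
        by (simp add: norm_mult exp_add ring_distribs abs_mult mult_ac)
    qed
  qed measurable
qed

lemma rapid_integrable: "rapid g \<Longrightarrow> integrable lebesgue g"
  using Bochner_Integration.integrable_norm_iff[of g lebesgue] unfolding rapid_def
  by (auto dest!: spec[of _ 0])

lemma norm_exp_linear_le:
  "cmod (exp (a * x + b * cnj x)) \<le> exp ((cmod a + cmod b) * cmod x)"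
proof -
  have "cmod (exp (a * x + b * cnj x)) \<le> exp (cmod (a * x + b * cnj x))"
    by (rule norm_exp)
  also have "cmod (a * x + b * cnj x) \<le> (cmod a + cmod b) * cmod x"
    by (rule order_trans[OF norm_triangle_ineq]) (simp add: norm_mult distrib_right)
  finally show ?thesis by simp
qed

lemma rapid_exp: "rapid g \<Longrightarrow> rapid (\<lambda>x. exp (a * x + b * cnj x) * g x)"
  by (rule rapid_bound[where C = 1 and r = "cmod a + cmod b"])
     (auto intro!: continuous_imp_lebesgue_measurable continuous_intros norm_exp_linear_le
       simp del: norm_exp_eq_Re)

lemma rapid_id: "rapid g \<Longrightarrow> rapid (\<lambda>x. x * g x)"
  by (rule rapid_bound[where C = 1 and r = 1])
     (auto intro!: continuous_imp_lebesgue_measurable continuous_intros order_trans[OF _ exp_ge_add_one_self])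

lemma rapid_cnj: "rapid g \<Longrightarrow> rapid (\<lambda>x. cnj x * g x)"
  by (rule rapid_bound[where C = 1 and r = 1])
     (auto intro!: continuous_imp_lebesgue_measurable continuous_intros order_trans[OF _ exp_ge_add_one_self])

lemma rapid_cmult: "rapid g \<Longrightarrow> rapid (\<lambda>x. c * g x)"
  by (rule rapid_bound[where C = "cmod c" and r = 0]) auto

lemma rapid_diff: 
  assumes "rapid f" "rapid g" shows "rapid (\<lambda>x. f x - g x)"
  unfolding rapid_def
proof (intro conjI allI)
  note [measurable] = rapid_measurable[OF assms(1)] rapid_measurable[OF assms(2)]
  have [measurable]: "(\<lambda>x::complex. x) \<in> borel_measurable lebesgue"
    by (intro continuous_imp_lebesgue_measurable continuous_intros)
  show "(\<lambda>x. f x - g x) \<in> borel_measurable lebesgue" by measurable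
  fix r
  have "integrable lebesgue (\<lambda>x. exp (r * cmod x) * cmod (f x) + exp (r * cmod x) * cmod (g x))"
    using assms by (auto simp: rapid_def)
  thus "integrable lebesgue (\<lambda>x. exp (r * cmod x) * cmod (f x - g x))"
  proof (rule Bochner_Integration.integrable_bound, goal_cases)
    case 1 show ?case by measurable
  next
    case 2 show ?case
      by (auto simp: abs_mult simp flip: distrib_left intro!: norm_triangle_ineq4 mult_left_mono)
  qed
qed

lemma norm_exp_remainder: "cmod (exp u - 1 - u) \<le> (cmod u)\<^sup>2 * exp (cmod u)"
proof -
  have "cmod (exp u - 1 - u) \<le> exp \<bar>Re u\<bar> * (cmod u)\<^sup>2"
    using Taylor_exp[of u 1] by (simp add: power2_eq_square algebra_simps)
  also have "\<dots> \<le> exp (cmod u) * (cmod u)\<^sup>2"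
    by (intro mult_right_mono) (auto simp: abs_Re_le_cmod)
  finally show ?thesis by (simp add: mult.commute)
qed

text \<open>Differentiation under the integral sign. The second order remainder of the exponential is at most
\<open>|h|\<^sup>2\<close> times one integrable function, uniformly for \<open>|h| \<le> 1\<close>.\<close>

lemma bilaplace_has_derivative:
  assumes g: "rapid g"
  shows "(bilaplace g has_derivative
      (\<lambda>h. fst h * bilaplace (\<lambda>x. x * g x) s + snd h * bilaplace (\<lambda>x. cnj x * g x) s)) (at s)"
proof -
  let ?e = "\<lambda>s x. exp (fst s * x + snd s * cnj x)"
  let ?D = "\<lambda>h. fst h * bilaplace (\<lambda>x. x * g x) s + snd h * bilaplace (\<lambda>x. cnj x * g x) s"
  note [measurable] = rapid_measurable[OF g]
  have [measurable]: "(\<lambda>x::complex. x) \<in> borel_measurable lebesgue"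
    by (intro continuous_imp_lebesgue_measurable continuous_intros)
  \<comment> \<open>Besides the exponential at \<open>s\<close>, the majorant absorbs \<open>exp |u| \<le> exp (2 |x|)\<close> and \<open>|x|\<^sup>2 \<le> 2 exp |x|\<close>.\<close>
  define r where "r = cmod (fst s) + cmod (snd s) + 3"
  define C where "C = (LINT x|lebesgue. 8 * (exp (r * cmod x) * cmod (g x)))"
  have remainder: "cmod (bilaplace g (s + h) - bilaplace g s - ?D h) \<le> (norm h)\<^sup>2 * C" if h: "norm h \<le> 1" for h
  proof -
    have i1: "integrable lebesgue (\<lambda>x. ?e (s + h) x * g x)" "integrable lebesgue (\<lambda>x. ?e s x * g x)"
      "integrable lebesgue (\<lambda>x. ?e s x * (x * g x))" "integrable lebesgue (\<lambda>x. ?e s x * (cnj x * g x))"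
      using rapid_integrable[OF rapid_exp[OF g]] rapid_integrable[OF rapid_exp[OF rapid_id[OF g]]]
        rapid_integrable[OF rapid_exp[OF rapid_cnj[OF g]]] by blast+
    let ?R = "\<lambda>x. ?e (s + h) x * g x - ?e s x * g x -
        (fst h * (?e s x * (x * g x)) + snd h * (?e s x * (cnj x * g x)))"
    have "bilaplace g (s + h) - bilaplace g s - ?D h = (LINT x|lebesgue. ?R x)"
      unfolding bilaplace_def Bochner_Integration.integral_diff[OF Bochner_Integration.integrable_diff[OF i1(1,2)]
          Bochner_Integration.integrable_add[OF integrable_mult_right[OF i1(3)] integrable_mult_right[OF i1(4)]]]
        Bochner_Integration.integral_diff[OF i1(1,2)]
        Bochner_Integration.integral_add[OF integrable_mult_right[OF i1(3)] integrable_mult_right[OF i1(4)]]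
        integral_mult_right_zero ..
    hence "cmod (bilaplace g (s + h) - bilaplace g s - ?D h) \<le> (LINT x|lebesgue. cmod (?R x))"
      by (simp only: integral_norm_bound)
    also have "\<dots> \<le> (LINT x|lebesgue. (norm h)\<^sup>2 * (8 * (exp (r * cmod x) * cmod (g x))))"
    proof (rule integral_mono)
      show "integrable lebesgue (\<lambda>x. cmod (?R x))"
        by (intro integrable_norm Bochner_Integration.integrable_diff Bochner_Integration.integrable_add
            integrable_mult_right i1)
      show "integrable lebesgue (\<lambda>x. (norm h)\<^sup>2 * (8 * (exp (r * cmod x) * cmod (g x))))"
        using g by (auto simp: rapid_def)
      fix x :: complex
      define u where "u = fst h * x + snd h * cnj x"
      have "?R x = ?e s x * (exp u - 1 - u) * g x"
      proof -
        have "?e (s + h) x = ?e s x * exp u"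
          unfolding exp_add[symmetric] by (simp add: u_def algebra_simps)
        thus ?thesis unfolding u_def by (simp only:) (simp add: algebra_simps)
      qed
      hence "cmod (?R x) = cmod (?e s x) * cmod (exp u - 1 - u) * cmod (g x)" by (simp add: norm_mult)
      also have "\<dots> \<le> exp ((cmod (fst s) + cmod (snd s)) * cmod x) * ((norm h)\<^sup>2 * (8 * exp (3 * cmod x))) * cmod (g x)"
      proof (intro mult_mono norm_exp_linear_le)
        have "cmod u \<le> (cmod (fst h) + cmod (snd h)) * cmod x"
          unfolding u_def by (rule order_trans[OF norm_triangle_ineq]) (simp add: norm_mult distrib_right)
        also have "\<dots> \<le> (2 * norm h) * cmod x"
          using norm_fst_le[of "fst h" "snd h"] norm_snd_le[of "snd h" "fst h"] by (intro mult_right_mono) auto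
        finally have u: "cmod u \<le> (2 * norm h) * cmod x" .
        also have "\<dots> \<le> 2 * cmod x" using h by (simp add: mult_left_le_one_le)
        finally have u': "cmod u \<le> 2 * cmod x" .
        have x2: "(cmod x)\<^sup>2 \<le> 2 * exp (cmod x)"
          using exp_lower_Taylor_quadratic[OF norm_ge_zero, of x] norm_ge_zero[of x] by linarith
        have "cmod (exp u - 1 - u) \<le> (cmod u)\<^sup>2 * exp (cmod u)" by (rule norm_exp_remainder)
        also have "\<dots> \<le> ((2 * norm h) * cmod x)\<^sup>2 * exp (2 * cmod x)"
          using u u' by (intro mult_mono power_mono) auto
        also have "\<dots> = (norm h)\<^sup>2 * (4 * ((cmod x)\<^sup>2 * exp (2 * cmod x)))"
          by (simp add: power_mult_distrib)
        also have "\<dots> \<le> (norm h)\<^sup>2 * (4 * ((2 * exp (cmod x)) * exp (2 * cmod x)))"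
          using x2 by (intro mult_left_mono mult_right_mono) auto
        also have "\<dots> = (norm h)\<^sup>2 * (8 * exp (3 * cmod x))"
          by (simp add: exp_add[symmetric])
        finally show "cmod (exp u - 1 - u) \<le> (norm h)\<^sup>2 * (8 * exp (3 * cmod x))" .
      qed auto
      also have "\<dots> = (norm h)\<^sup>2 * (8 * (exp (r * cmod x) * cmod (g x)))"
        by (simp add: r_def exp_add distrib_right)
      finally show "cmod (?R x) \<le> (norm h)\<^sup>2 * (8 * (exp (r * cmod x) * cmod (g x)))" .
    qed
    also have "\<dots> = (norm h)\<^sup>2 * C" unfolding C_def by simp
    finally show ?thesis .
  qed
  show ?thesis
    unfolding has_derivative_at
  proof
    show "bounded_linear ?D"
      by (intro bounded_linear_add bounded_linear_mult_const bounded_linear_fst bounded_linear_snd)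
    show "(\<lambda>h. norm (bilaplace g (s + h) - bilaplace g s - ?D h) / norm h) \<midarrow>0\<rightarrow> 0"
    proof (rule Lim_null_comparison)
      have "((\<lambda>h::complex \<times> complex. norm h * C) \<longlongrightarrow> norm (0::complex \<times> complex) * C) (at 0)"
        by (intro tendsto_intros)
      thus "((\<lambda>h::complex \<times> complex. norm h * C) \<longlongrightarrow> 0) (at 0)" by simp
      have "eventually (\<lambda>h::complex \<times> complex. h \<in> ball 0 1 \<and> h \<noteq> 0) (at 0)"
        unfolding eventually_at by (intro exI[of _ 1]) (auto simp: dist_commute)
      thus "\<forall>\<^sub>F h in at 0. norm (norm (bilaplace g (s + h) - bilaplace g s - ?D h) / norm h) \<le> norm h * C"
      proof eventually_elim
        case (elim h)
        have "norm (bilaplace g (s + h) - bilaplace g s - ?D h) \<le> (norm h)\<^sup>2 * C"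
          using elim by (intro remainder) auto
        thus ?case using elim by (simp add: divide_le_eq power2_eq_square mult_ac)
      qed
    qed
  qed
qed

lemma bilaplace_moments:
  assumes g: "rapid g"
  shows "((\<lambda>a. bilaplace g (a, b)) has_field_derivative bilaplace (\<lambda>x. x * g x) (a, b)) (at a)"
    "((\<lambda>b. bilaplace g (a, b)) has_field_derivative bilaplace (\<lambda>x. cnj x * g x) (a, b)) (at b)"
proof -
  have "((\<lambda>a. (a, b)) has_derivative (\<lambda>h. (h, 0))) (at a)" "((\<lambda>b. (a, b)) has_derivative (\<lambda>h. (0, h))) (at b)"
    by (auto intro!: derivative_eq_intros)
  note D = this[THEN has_derivative_compose, OF bilaplace_has_derivative[OF g]]
  show "((\<lambda>a. bilaplace g (a, b)) has_field_derivative bilaplace (\<lambda>x. x * g x) (a, b)) (at a)"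
    unfolding has_field_derivative_def by (rule has_derivative_eq_rhs[OF D(1)]) (simp add: fun_eq_iff)
  show "((\<lambda>b. bilaplace g (a, b)) has_field_derivative bilaplace (\<lambda>x. cnj x * g x) (a, b)) (at b)"
    unfolding has_field_derivative_def by (rule has_derivative_eq_rhs[OF D(2)]) (simp add: fun_eq_iff)
qed

lemma gaussian_exp_le:
  fixes \<nu> x r :: real
  assumes "\<nu> > 0" "x \<ge> 0"
  shows "exp (r * x) * exp (- \<nu> * x\<^sup>2) \<le> exp (r\<^sup>2 / (2 * \<nu>)) * exp (- (\<nu> / 2) * x\<^sup>2)"
proof -
  have "0 \<le> (r - \<nu> * x)\<^sup>2" by (rule zero_le_power2)
  hence "2 * \<nu> * (r * x) \<le> r\<^sup>2 + \<nu>\<^sup>2 * x\<^sup>2" by (simp add: power2_eq_square algebra_simps)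
  hence "r * x \<le> (r\<^sup>2 + \<nu>\<^sup>2 * x\<^sup>2) / (2 * \<nu>)" using assms by (simp add: field_simps)
  also have "\<dots> = r\<^sup>2 / (2 * \<nu>) + \<nu> / 2 * x\<^sup>2" using assms by (simp add: field_simps power2_eq_square)
  finally show ?thesis unfolding exp_add[symmetric] by simp
qed

lemma norm_exp_cnj: "cmod (exp (- of_real \<nu> * (x * cnj x))) = exp (- \<nu> * (cmod x)\<^sup>2)"
  by (simp add: complex_mult_cnj cmod_power2)

lemma integrable_gaussian_weight:
  assumes "\<nu> > 0" shows "integrable lborel (\<lambda>x::complex. exp (- \<nu> * (cmod x)\<^sup>2))"
proof -
  have "integrable lborel (\<lambda>x::complex. cmod (exp (- of_real \<nu> * (x * cnj x) + 0 * x + 0 * cnj x)))"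
    using has_bochner_integral_gaussian[OF assms, of 0 0]
    by (intro integrable_norm) (auto simp: has_bochner_integral_iff)
  thus ?thesis by (simp only: mult_zero_left add_0_right norm_exp_cnj)
qed

lemma integrable_exp_gaussian_weight:
  assumes "\<nu> > 0" shows "integrable lborel (\<lambda>x::complex. exp (r * cmod x) * exp (- \<nu> * (cmod x)\<^sup>2))"
proof -
  have "integrable lborel (\<lambda>x::complex. exp (r\<^sup>2 / (2 * \<nu>)) * exp (- (\<nu> / 2) * (cmod x)\<^sup>2))"
    using assms by (intro integrable_mult_right integrable_gaussian_weight) auto
  thus ?thesis
  proof (rule Bochner_Integration.integrable_bound)
    show "AE x in lborel. norm (exp (r * cmod x) * exp (- \<nu> * (cmod x)\<^sup>2))
        \<le> norm (exp (r\<^sup>2 / (2 * \<nu>)) * exp (- (\<nu> / 2) * (cmod x)\<^sup>2))"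
      using gaussian_exp_le[OF assms] by (auto simp: abs_mult)
  qed measurable
qed

lemma rapid_gaussian:
  assumes "\<nu> > 0" shows "rapid (\<lambda>x. exp (- of_real \<nu> * (x * cnj x)))"
  unfolding rapid_def norm_exp_cnj
proof (intro conjI allI)
  show "(\<lambda>x. exp (- of_real \<nu> * (x * cnj x))) \<in> borel_measurable lebesgue"
    by (intro continuous_imp_lebesgue_measurable continuous_intros)
  fix r
  show "integrable lebesgue (\<lambda>x::complex. exp (r * cmod x) * exp (- \<nu> * (cmod x)\<^sup>2))"
    using integrable_exp_gaussian_weight[OF assms] by (subst integrable_completion) auto
qed

lemma bilaplace_gaussian:
  assumes "\<nu> > 0"
  shows "bilaplace (\<lambda>x. exp (- of_real \<nu> * (x * cnj x))) (a, b) = of_real (pi / \<nu>) * exp (a * b / of_real \<nu>)"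
proof -
  have "bilaplace (\<lambda>x. exp (- of_real \<nu> * (x * cnj x))) (a, b) =
     (LINT x|lborel. exp (- of_real \<nu> * (x * cnj x) + a * x + b * cnj x))"
    unfolding bilaplace_def exp_add[symmetric]
    by (subst integral_completion) (auto intro!: borel_measurable_continuous_onI continuous_intros simp: algebra_simps)
  thus ?thesis using has_bochner_integral_gaussian[OF assms, of a b] by (simp add: has_bochner_integral_iff)
qed

section \<open>Complex Hermite polynomials\<close>

text \<open>The \<open>m\<close>-th derivative with respect to \<open>cnj x\<close> of \<open>(cnj x)\<^sup>n exp (- \<nu> x cnj x)\<close>. One differentiation turns this
function into \<open>n (cnj x)\<^bsup>n-1\<^esup> exp (- \<nu> x cnj x)\<close> minus \<open>\<nu> x\<close> times itself, and further derivatives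
commute with multiplication by \<open>x\<close>; this gives the recurrence. For \<open>n = 0\<close> the index \<open>n - 1\<close> is
harmless because its coefficient vanishes.\<close>

fun gauss_deriv :: "real \<Rightarrow> nat \<Rightarrow> nat \<Rightarrow> complex \<Rightarrow> complex" where
  "gauss_deriv \<nu> 0 n x = cnj x ^ n * exp (- of_real \<nu> * (x * cnj x))"
| "gauss_deriv \<nu> (Suc m) n x = of_nat n * gauss_deriv \<nu> m (n - 1) x - of_real \<nu> * (x * gauss_deriv \<nu> m n x)"

lemma rapid_gauss_deriv:
  assumes "\<nu> > 0" shows "rapid (gauss_deriv \<nu> m n)"
proof (induction m arbitrary: n)
  case 0
  show ?case
  proof (induction n)
    case 0 thus ?case using rapid_gaussian[OF assms] by simp
  next
    case (Suc n) thus ?case using rapid_cnj[OF Suc] by (simp add: mult.assoc cong: if_cong)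
  qed
next
  case (Suc m)
  show ?case unfolding gauss_deriv.simps
    by (intro rapid_diff rapid_cmult rapid_id Suc)
qed

text \<open>Multiplication by \<open>x\<close> and by \<open>cnj x\<close> become differentiation in \<open>a\<close> and in \<open>b\<close>. In the recurrence for
\<open>m\<close> the term from differentiating \<open>a\<^sup>n\<close> cancels the term with coefficient \<open>n\<close>, and only the factor
\<open>- b\<close> from the exponential survives.\<close>

lemma bilaplace_gauss_deriv:
  assumes "\<nu> > 0"
  shows "bilaplace (gauss_deriv \<nu> m n) (a, b) =
    of_real (pi / \<nu>) * (- b) ^ m * (a / of_real \<nu>) ^ n * exp (a * b / of_real \<nu>)"
proof (induction m arbitrary: n a b)
  case 0
  show ?case
  proof (induction n arbitrary: a b)
    case 0 thus ?case using bilaplace_gaussian[OF assms, of a b] by simp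
  next
    case (Suc n)
    have eq: "gauss_deriv \<nu> 0 (Suc n) = (\<lambda>x. cnj x * gauss_deriv \<nu> 0 n x)" by (auto simp: mult.assoc)
    have "((\<lambda>b. bilaplace (gauss_deriv \<nu> 0 n) (a, b)) has_field_derivative bilaplace (gauss_deriv \<nu> 0 (Suc n)) (a, b)) (at b)"
      unfolding eq by (rule bilaplace_moments(2)[OF rapid_gauss_deriv[OF assms]])
    moreover have "((\<lambda>b. bilaplace (gauss_deriv \<nu> 0 n) (a, b)) has_field_derivative
        of_real (pi / \<nu>) * (a / of_real \<nu>) ^ n * (exp (a * b / of_real \<nu>) * (a / of_real \<nu>))) (at b)"
      unfolding Suc using assms by (auto intro!: derivative_eq_intros)
    ultimately have "bilaplace (gauss_deriv \<nu> 0 (Suc n)) (a, b) =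
        of_real (pi / \<nu>) * (a / of_real \<nu>) ^ n * (exp (a * b / of_real \<nu>) * (a / of_real \<nu>))"
      by (rule DERIV_unique)
    thus ?case by (simp del: gauss_deriv.simps)
  qed
next
  case (Suc m)
  let ?E = "exp (a * b / of_real \<nu>)"
  let ?d = "of_real (pi / \<nu>) * (- b) ^ m * (of_nat n * (a / of_real \<nu>) ^ (n - 1) / of_real \<nu> * ?E
            + (a / of_real \<nu>) ^ n * (?E * (b / of_real \<nu>)))"
  have "((\<lambda>a. bilaplace (gauss_deriv \<nu> m n) (a, b)) has_field_derivative ?d) (at a)"
  proof -
    have 1: "((\<lambda>a. (a / of_real \<nu>) ^ n) has_field_derivative of_nat n * (a / of_real \<nu>) ^ (n - 1) / of_real \<nu>) (at a)"
      using assms by (auto intro!: derivative_eq_intros)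
    have 2: "((\<lambda>a. exp (a * b / of_real \<nu>)) has_field_derivative ?E * (b / of_real \<nu>)) (at a)"
      using assms by (auto intro!: derivative_eq_intros)
    show ?thesis unfolding Suc mult.assoc[of _ "(_ / _) ^ n"]
      by (rule DERIV_cong[OF DERIV_cmult[OF DERIV_mult[OF 1 2]]]) (simp add: algebra_simps)
  qed
  with bilaplace_moments(1)[OF rapid_gauss_deriv[OF assms]]
  have "bilaplace (\<lambda>x. x * gauss_deriv \<nu> m n x) (a, b) = ?d" by (rule DERIV_unique)
  moreover have "bilaplace (gauss_deriv \<nu> (Suc m) n) (a, b) =
      of_nat n * bilaplace (gauss_deriv \<nu> m (n - 1)) (a, b) - of_real \<nu> * bilaplace (\<lambda>x. x * gauss_deriv \<nu> m n x) (a, b)"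
  proof -
    let ?e = "\<lambda>x. exp (a * x + b * cnj x)"
    have i: "integrable lebesgue (\<lambda>x. ?e x * gauss_deriv \<nu> m (n - 1) x)"
      "integrable lebesgue (\<lambda>x. ?e x * (x * gauss_deriv \<nu> m n x))"
      using rapid_integrable[OF rapid_exp[OF rapid_gauss_deriv[OF assms]]]
        rapid_integrable[OF rapid_exp[OF rapid_id[OF rapid_gauss_deriv[OF assms]]]] by blast+
    have "bilaplace (gauss_deriv \<nu> (Suc m) n) (a, b) =
      (LINT x|lebesgue. of_nat n * (?e x * gauss_deriv \<nu> m (n - 1) x) - of_real \<nu> * (?e x * (x * gauss_deriv \<nu> m n x)))"
      unfolding bilaplace_def by (intro Bochner_Integration.integral_cong) (simp_all add: algebra_simps)
    also have "\<dots> = of_nat n * (LINT x|lebesgue. ?e x * gauss_deriv \<nu> m (n - 1) x)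
        - of_real \<nu> * (LINT x|lebesgue. ?e x * (x * gauss_deriv \<nu> m n x))"
      unfolding Bochner_Integration.integral_diff[OF integrable_mult_right[OF i(1)] integrable_mult_right[OF i(2)]]
      by simp
    finally show ?thesis unfolding bilaplace_def by simp
  qed
  ultimately have "bilaplace (gauss_deriv \<nu> (Suc m) n) (a, b) =
     of_nat n * (of_real (pi / \<nu>) * (- b) ^ m * (a / of_real \<nu>) ^ (n - 1) * ?E) - of_real \<nu> * ?d"
    by (simp only: Suc)
  moreover have cancel: "of_real \<nu> * (K * (N * P / of_real \<nu> * E + Q * (E * (b / of_real \<nu>))))
      = K * (N * P * E + Q * (E * b))" for K N P Q E :: complex
    using assms by (simp add: field_simps)
  ultimately show ?case by (simp only: cancel) (simp add: algebra_simps)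
qed

lemma wirtinger_eqI:
  assumes "(f has_derivative (\<lambda>h. A * h + B * cnj h)) (at z)"
  shows "wirtinger f z = A" "wirtinger_bar f z = B"
proof -
  have x: "((\<lambda>t. f (z + of_real t)) has_vector_derivative (A + B)) (at 0)"
    unfolding has_vector_derivative_def
  proof (rule has_derivative_eq_rhs)
    show "((\<lambda>t. f (z + of_real t)) has_derivative (\<lambda>t. A * of_real t + B * cnj (of_real t))) (at 0)"
      by (rule has_derivative_compose[where g = f and f = "\<lambda>t. z + of_real t", of "of_real"])
         (use assms in \<open>auto intro!: derivative_eq_intros\<close>)
  qed (auto simp: scaleR_conv_of_real algebra_simps)
  have y: "((\<lambda>t. f (z + \<i> * of_real t)) has_vector_derivative (\<i> * A - \<i> * B)) (at 0)"
    unfolding has_vector_derivative_def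
  proof (rule has_derivative_eq_rhs)
    show "((\<lambda>t. f (z + \<i> * of_real t)) has_derivative (\<lambda>t. A * (\<i> * of_real t) + B * cnj (\<i> * of_real t))) (at 0)"
      by (rule has_derivative_compose[where g = f and f = "\<lambda>t. z + \<i> * of_real t", of "\<lambda>t. \<i> * of_real t"])
         (use assms in \<open>auto intro!: derivative_eq_intros\<close>)
  qed (auto simp: scaleR_conv_of_real algebra_simps)
  have "partial_x f z = A + B" "partial_y f z = \<i> * A - \<i> * B"
    unfolding partial_x_def partial_y_def using x y by (auto intro: vector_derivative_at)
  thus "wirtinger f z = A" "wirtinger_bar f z = B"
    by (simp_all add: wirtinger_def wirtinger_bar_def right_diff_distrib mult.assoc[symmetric])
qed

lemma gauss_deriv_0_has_derivative:
  "((\<lambda>x. cnj x ^ n * exp (- of_real \<nu> * (x * cnj x))) has_derivative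
     (\<lambda>h. (- of_real \<nu> * cnj z * (cnj z ^ n * exp (- of_real \<nu> * (z * cnj z)))) * h
         + gauss_deriv \<nu> (Suc 0) n z * cnj h)) (at z)"
proof -
  have 1: "((\<lambda>x. cnj x ^ n) has_derivative (\<lambda>h. of_nat n * cnj h * cnj z ^ (n - 1))) (at z)"
    by (rule has_derivative_power[OF has_derivative_cnj[OF has_derivative_ident]])
  have 2: "((\<lambda>x. exp (- of_real \<nu> * (x * cnj x))) has_derivative
      (\<lambda>h. exp (- of_real \<nu> * (z * cnj z)) * (- of_real \<nu> * (z * cnj h + h * cnj z)))) (at z)"
  proof -
    have "((\<lambda>x. - of_real \<nu> * (x * cnj x)) has_derivative (\<lambda>h. - of_real \<nu> * (z * cnj h + h * cnj z))) (at z)"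
      by (intro has_derivative_mult_right has_derivative_mult has_derivative_ident has_derivative_cnj)
    from has_derivative_compose[OF this DERIV_exp[unfolded has_field_derivative_def]] show ?thesis
      by (rule has_derivative_eq_rhs) (simp add: fun_eq_iff mult.commute)
  qed
  show ?thesis
    by (rule has_derivative_eq_rhs[OF has_derivative_mult[OF 1 2]]) (simp add: fun_eq_iff algebra_simps)
qed

lemma gauss_deriv_has_derivative:
  "\<exists>A. (gauss_deriv \<nu> m n has_derivative (\<lambda>h. A * h + gauss_deriv \<nu> (Suc m) n z * cnj h)) (at z)"
proof (induction m arbitrary: n)
  case 0
  have "((\<lambda>x. cnj x ^ n * exp (- of_real \<nu> * (x * cnj x))) has_derivative
     (\<lambda>h. (- of_real \<nu> * cnj z * (cnj z ^ n * exp (- of_real \<nu> * (z * cnj z)))) * h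
         + gauss_deriv \<nu> (Suc 0) n z * cnj h)) (at z)"
    by (rule gauss_deriv_0_has_derivative)
  moreover have "gauss_deriv \<nu> 0 n = (\<lambda>x. cnj x ^ n * exp (- of_real \<nu> * (x * cnj x)))"
    by (rule ext) simp
  ultimately show ?case by metis
next
  case (Suc m)
  obtain A where A: "(gauss_deriv \<nu> m n has_derivative (\<lambda>h. A * h + gauss_deriv \<nu> (Suc m) n z * cnj h)) (at z)"
    using Suc by blast
  obtain A' where A': "(gauss_deriv \<nu> m (n - 1) has_derivative (\<lambda>h. A' * h + gauss_deriv \<nu> (Suc m) (n - 1) z * cnj h)) (at z)"
    using Suc by blast
  have eq: "gauss_deriv \<nu> (Suc m) n = (\<lambda>x. of_nat n * gauss_deriv \<nu> m (n - 1) x - of_real \<nu> * (x * gauss_deriv \<nu> m n x))"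
    by (rule ext) simp
  have "((\<lambda>x. of_nat n * gauss_deriv \<nu> m (n - 1) x - of_real \<nu> * (x * gauss_deriv \<nu> m n x)) has_derivative
    (\<lambda>h. of_nat n * (A' * h + gauss_deriv \<nu> (Suc m) (n - 1) z * cnj h)
      - of_real \<nu> * (z * (A * h + gauss_deriv \<nu> (Suc m) n z * cnj h) + h * gauss_deriv \<nu> m n z))) (at z)"
    by (intro has_derivative_diff has_derivative_mult_right has_derivative_mult has_derivative_ident A A')
  hence "(gauss_deriv \<nu> (Suc m) n has_derivative (\<lambda>h. (of_nat n * A' - of_real \<nu> * (z * A + gauss_deriv \<nu> m n z)) * h
      + gauss_deriv \<nu> (Suc (Suc m)) n z * cnj h)) (at z)"
    unfolding eq by (rule has_derivative_eq_rhs) (simp add: fun_eq_iff algebra_simps)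
  thus ?case by blast
qed

text \<open>Differentiating in \<open>x\<close> only multiplies by \<open>- \<nu> cnj x\<close>, because \<open>cnj x\<close> is constant for that
derivative; the remaining derivatives in \<open>cnj x\<close> are those of \<open>gauss_deriv\<close>.\<close>

lemma complex_hermite_eq:
  "complex_hermite \<nu> m n z = (- 1) ^ (m + n) * exp (of_real \<nu> * z * cnj z) *
     ((- of_real \<nu>) ^ n * gauss_deriv \<nu> m n z)"
proof -
  have 1: "(wirtinger ^^ n) (\<lambda>u. exp (- of_real \<nu> * u * cnj u)) = (\<lambda>u. (- of_real \<nu>) ^ n * gauss_deriv \<nu> 0 n u)" for n
  proof (induction n)
    case 0 thus ?case by (simp add: mult.assoc)
  next
    case (Suc n)
    have D: "((\<lambda>u. (- of_real \<nu>) ^ n * gauss_deriv \<nu> 0 n u) has_derivative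
      (\<lambda>h. ((- of_real \<nu>) ^ Suc n * gauss_deriv \<nu> 0 (Suc n) z) * h +
         ((- of_real \<nu>) ^ n * gauss_deriv \<nu> (Suc 0) n z) * cnj h)) (at z)" for z
      unfolding gauss_deriv.simps(1)
      by (rule has_derivative_eq_rhs[OF has_derivative_mult_right[OF gauss_deriv_0_has_derivative]])
         (simp add: fun_eq_iff algebra_simps)
    show ?case
      by (rule ext) (simp only: funpow.simps o_def Suc wirtinger_eqI(1)[OF D])
  qed
  have 2: "(wirtinger_bar ^^ m) (\<lambda>u. c * gauss_deriv \<nu> 0 n u) = (\<lambda>u. c * gauss_deriv \<nu> m n u)" for c
  proof (induction m)
    case (Suc m)
    show ?case
    proof
      fix z
      obtain A where A: "(gauss_deriv \<nu> m n has_derivative (\<lambda>h. A * h + gauss_deriv \<nu> (Suc m) n z * cnj h)) (at z)"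
        using gauss_deriv_has_derivative by blast
      have "((\<lambda>u. c * gauss_deriv \<nu> m n u) has_derivative
          (\<lambda>h. (c * A) * h + (c * gauss_deriv \<nu> (Suc m) n z) * cnj h)) (at z)"
        by (rule has_derivative_eq_rhs[OF has_derivative_mult_right[OF A]]) (simp add: algebra_simps)
      thus "(wirtinger_bar ^^ Suc m) (\<lambda>u. c * gauss_deriv \<nu> 0 n u) z = c * gauss_deriv \<nu> (Suc m) n z"
        by (simp only: funpow.simps o_def Suc wirtinger_eqI(2))
    qed
  qed simp
  show ?thesis unfolding complex_hermite_def 1 2 ..
qed

lemma T_kernel_eq:
  "T_kernel \<nu> z w x = exp (- of_real \<nu> * z * w) *
     (exp ((of_real \<nu> * w) * x + (of_real \<nu> * z) * cnj x) * exp (- of_real \<nu> * (x * cnj x)))"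
  unfolding T_kernel_def exp_add[symmetric] by (simp add: algebra_simps)

lemma T_kernel_complex_hermite:
  assumes "\<nu> > 0"
  shows "has_bochner_integral lebesgue (\<lambda>x. T_kernel \<nu> z w x * complex_hermite \<nu> m n x)
          (of_real (pi / \<nu>) * of_real \<nu> ^ (m + n) * z ^ m * w ^ n)"
proof -
  let ?a = "of_real \<nu> * w" and ?b = "of_real \<nu> * z"
  let ?c = "exp (- of_real \<nu> * z * w) * ((- 1) ^ (m + n) * (- of_real \<nu>) ^ n)"
  have eq: "T_kernel \<nu> z w x * complex_hermite \<nu> m n x = ?c * (exp (?a * x + ?b * cnj x) * gauss_deriv \<nu> m n x)" for x
  proof -
    have "exp (- of_real \<nu> * (x * cnj x)) * exp (of_real \<nu> * x * cnj x) = 1"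
      unfolding exp_add[symmetric] by simp
    moreover have "K * (e * A) * (s * B * (p * g)) = (A * B) * (K * (s * p) * (e * g))"
      for K e A s B p g :: complex by (simp only: mult_ac)
    ultimately show ?thesis unfolding T_kernel_eq complex_hermite_eq by (simp only: mult_1_left)
  qed
  have "has_bochner_integral lebesgue (\<lambda>x. exp (?a * x + ?b * cnj x) * gauss_deriv \<nu> m n x) (bilaplace (gauss_deriv \<nu> m n) (?a, ?b))"
    using rapid_integrable[OF rapid_exp[OF rapid_gauss_deriv[OF assms]]]
    by (auto simp: has_bochner_integral_iff bilaplace_def)
  hence "has_bochner_integral lebesgue (\<lambda>x. ?c * (exp (?a * x + ?b * cnj x) * gauss_deriv \<nu> m n x)) (?c * bilaplace (gauss_deriv \<nu> m n) (?a, ?b))"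
    by (rule has_bochner_integral_mult_right)
  moreover have "?c * bilaplace (gauss_deriv \<nu> m n) (?a, ?b) = of_real (pi / \<nu>) * of_real \<nu> ^ (m + n) * z ^ m * w ^ n"
  proof -
    have 1: "exp (- of_real \<nu> * z * w) * exp (of_real \<nu> * w * (of_real \<nu> * z) / of_real \<nu>) = 1"
      unfolding exp_add[symmetric] using assms by (simp add: field_simps)
    have 2: "(- 1) ^ (m + n) * (- of_real \<nu>) ^ n * (- (of_real \<nu> * z)) ^ m = (of_real \<nu> ^ (m + n) * z ^ m :: complex)"
    proof -
      have p: "(- y) ^ k = (- 1) ^ k * y ^ k" for y :: complex and k by (rule power_minus)
      have q: "(- 1) ^ k * (- 1) ^ k = (1::complex)" for k by (simp flip: power_mult_distrib)
      have regroup: "M * N * (N * a) * (M * (b * c)) = (M * M) * (N * N) * (b * a * c)"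
        for M N a b c :: complex by (simp only: mult_ac)
      show ?thesis
        unfolding p[of "of_real \<nu>"] p[of "of_real \<nu> * z"] power_add power_mult_distrib
        using regroup[of "(- 1) ^ m" "(- 1) ^ n"] by (simp only: q mult_1_left)
    qed
    have regroup: "e * (s * t) * (c * u * W * e') = c * (s * t * u) * W"
      if "e * e' = 1" for e e' s t c u W :: complex
    proof -
      have "e * (s * t) * (c * u * W * e') = (e * e') * (c * (s * t * u) * W)" by (simp only: mult_ac)
      thus ?thesis using that by simp
    qed
    have 3: "of_real \<nu> * w / of_real \<nu> = w" using assms by simp
    show ?thesis
      unfolding bilaplace_gauss_deriv[OF assms] 3
      using regroup[OF 1, of "(- 1) ^ (m + n)" "(- of_real \<nu>) ^ n" "of_real (pi / \<nu>)"
          "(- (of_real \<nu> * z)) ^ m" "w ^ n"]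
      unfolding 2 by (simp only: mult.assoc)
  qed
  ultimately show ?thesis unfolding eq by simp
qed

section \<open>Square integrable functions\<close>

definition sq_int :: "'a measure \<Rightarrow> ('a \<Rightarrow> complex) \<Rightarrow> bool" where
  "sq_int M f \<longleftrightarrow> f \<in> borel_measurable M \<and> integrable M (\<lambda>x. (cmod (f x))\<^sup>2)"

definition l2norm :: "'a measure \<Rightarrow> ('a \<Rightarrow> complex) \<Rightarrow> real" where
  "l2norm M f = sqrt (LINT x|M. (cmod (f x))\<^sup>2)"

lemma sq_int_measurable: "sq_int M f \<Longrightarrow> f \<in> borel_measurable M"
  by (simp add: sq_int_def)

lemma sq_int_integrable: "sq_int M f \<Longrightarrow> integrable M (\<lambda>x. (cmod (f x))\<^sup>2)"
  by (simp add: sq_int_def)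

lemma l2norm_nonneg [simp]: "0 \<le> l2norm M f"
  by (simp add: l2norm_def)

lemma l2norm_sq: "(l2norm M f)\<^sup>2 = (LINT x|M. (cmod (f x))\<^sup>2)"
  by (simp add: l2norm_def)

lemma sq_int_bound:
  assumes "sq_int M g" "f \<in> borel_measurable M" "AE x in M. cmod (f x) \<le> cmod (g x)"
  shows "sq_int M f"
  unfolding sq_int_def
proof
  note [measurable] = assms(2)
  show "integrable M (\<lambda>x. (cmod (f x))\<^sup>2)"
  proof (rule Bochner_Integration.integrable_bound[OF sq_int_integrable[OF assms(1)]])
    show "AE x in M. norm ((cmod (f x))\<^sup>2) \<le> norm ((cmod (g x))\<^sup>2)"
      using assms(3) by eventually_elim (simp add: power_mono)
  qed measurable
qed fact

lemma l2norm_mono: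
  assumes "sq_int M g" "f \<in> borel_measurable M" "AE x in M. cmod (f x) \<le> cmod (g x)"
  shows "l2norm M f \<le> l2norm M g"
  unfolding l2norm_def
proof (intro real_sqrt_le_mono integral_mono_AE)
  show "integrable M (\<lambda>x. (cmod (f x))\<^sup>2)" using sq_int_bound[OF assms] by (simp add: sq_int_def)
  show "AE x in M. (cmod (f x))\<^sup>2 \<le> (cmod (g x))\<^sup>2"
    using assms(3) by eventually_elim (simp add: power_mono)
qed (use assms(1) in \<open>simp add: sq_int_def\<close>)

lemma sq_int_add:
  assumes "sq_int M f" "sq_int M g" shows "sq_int M (\<lambda>x. f x + g x)"
  unfolding sq_int_def
proof
  note [measurable] = sq_int_measurable[OF assms(1)] sq_int_measurable[OF assms(2)]
  show "(\<lambda>x. f x + g x) \<in> borel_measurable M" by measurable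
  have "integrable M (\<lambda>x. 2 * (cmod (f x))\<^sup>2 + 2 * (cmod (g x))\<^sup>2)"
    using assms by (auto simp: sq_int_def)
  thus "integrable M (\<lambda>x. (cmod (f x + g x))\<^sup>2)"
  proof (rule Bochner_Integration.integrable_bound)
    have "(cmod (f x + g x))\<^sup>2 \<le> 2 * (cmod (f x))\<^sup>2 + 2 * (cmod (g x))\<^sup>2" for x
    proof -
      have "(cmod (f x + g x))\<^sup>2 \<le> (cmod (f x) + cmod (g x))\<^sup>2"
        by (intro power_mono norm_triangle_ineq) auto
      also have "\<dots> \<le> 2 * (cmod (f x))\<^sup>2 + 2 * (cmod (g x))\<^sup>2"
        using zero_le_power2[of "cmod (f x) - cmod (g x)"] by (simp add: power2_eq_square algebra_simps)
      finally show ?thesis .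
    qed
    thus "AE x in M. norm ((cmod (f x + g x))\<^sup>2) \<le> norm (2 * (cmod (f x))\<^sup>2 + 2 * (cmod (g x))\<^sup>2)"
      by auto
  qed measurable
qed

lemma sq_int_cmult:
  assumes "sq_int M f" shows "sq_int M (\<lambda>x. c * f x)"
  using assms by (auto simp: sq_int_def norm_mult power_mult_distrib)

lemma sq_int_diff:
  assumes "sq_int M f" "sq_int M g" shows "sq_int M (\<lambda>x. f x - g x)"
  using sq_int_add[OF assms(1) sq_int_cmult[OF assms(2), of "-1"]] by simp

lemma l2norm_minus: "l2norm M (\<lambda>x. f x - g x) = l2norm M (\<lambda>x. g x - f x)"
  by (simp add: l2norm_def norm_minus_commute)

lemma sq_int_mult:
  assumes "sq_int M f" "sq_int M g" shows "integrable M (\<lambda>x. f x * g x)"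
proof -
  note [measurable] = sq_int_measurable[OF assms(1)] sq_int_measurable[OF assms(2)]
  have "integrable M (\<lambda>x. (cmod (f x))\<^sup>2 + (cmod (g x))\<^sup>2)"
    using assms by (auto simp: sq_int_def)
  thus ?thesis
  proof (rule Bochner_Integration.integrable_bound)
    have "cmod (f x) * cmod (g x) \<le> (cmod (f x))\<^sup>2 + (cmod (g x))\<^sup>2" for x
      using zero_le_power2[of "cmod (f x) - cmod (g x)"] mult_nonneg_nonneg[of "cmod (f x)" "cmod (g x)"]
      by (simp add: power2_eq_square algebra_simps del: mult_nonneg_nonneg)
    thus "AE x in M. norm (f x * g x) \<le> norm ((cmod (f x))\<^sup>2 + (cmod (g x))\<^sup>2)"
      by (auto simp: norm_mult)
  qed measurable
qed

lemma Cauchy_Schwarz_l2norm_abs: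
  assumes "sq_int M f" "sq_int M g"
  shows "(LINT x|M. cmod (f x) * cmod (g x)) \<le> l2norm M f * l2norm M g"
proof -
  note [measurable] = sq_int_measurable[OF assms(1)] sq_int_measurable[OF assms(2)]
  have i: "integrable M (\<lambda>x. cmod (f x) * cmod (g x))"
    using integrable_norm[OF sq_int_mult[OF assms]] by (simp add: norm_mult)
  have "(\<integral>\<^sup>+x. ennreal (cmod (f x)) * ennreal (cmod (g x)) \<partial>M)\<^sup>2 \<le>
      (\<integral>\<^sup>+x. (ennreal (cmod (f x)))\<^sup>2 \<partial>M) * (\<integral>\<^sup>+x. (ennreal (cmod (g x)))\<^sup>2 \<partial>M)"
    by (rule Cauchy_Schwarz_nn_integral) auto
  also have "(\<integral>\<^sup>+x. (ennreal (cmod (f x)))\<^sup>2 \<partial>M) = ennreal ((l2norm M f)\<^sup>2)"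
    unfolding l2norm_sq ennreal_power[OF norm_ge_zero] using assms(1) by (intro nn_integral_eq_integral) (auto simp: sq_int_def)
  also have "(\<integral>\<^sup>+x. (ennreal (cmod (g x)))\<^sup>2 \<partial>M) = ennreal ((l2norm M g)\<^sup>2)"
    unfolding l2norm_sq ennreal_power[OF norm_ge_zero] using assms(2) by (intro nn_integral_eq_integral) (auto simp: sq_int_def)
  also have "(\<integral>\<^sup>+x. ennreal (cmod (f x)) * ennreal (cmod (g x)) \<partial>M) = ennreal (LINT x|M. cmod (f x) * cmod (g x))"
    unfolding ennreal_mult[OF norm_ge_zero norm_ge_zero, symmetric]
    using i by (intro nn_integral_eq_integral) auto
  finally have "(LINT x|M. cmod (f x) * cmod (g x))\<^sup>2 \<le> (l2norm M f)\<^sup>2 * (l2norm M g)\<^sup>2"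
    by (simp add: ennreal_power ennreal_mult[symmetric])
  hence "(LINT x|M. cmod (f x) * cmod (g x))\<^sup>2 \<le> (l2norm M f * l2norm M g)\<^sup>2"
    by (simp add: power_mult_distrib)
  thus ?thesis by (rule power2_le_imp_le) simp
qed

lemma Cauchy_Schwarz_l2norm:
  assumes "sq_int M f" "sq_int M g"
  shows "cmod (LINT x|M. f x * g x) \<le> l2norm M f * l2norm M g"
proof -
  have "cmod (LINT x|M. f x * g x) \<le> (LINT x|M. cmod (f x * g x))" by (rule integral_norm_bound)
  also have "\<dots> \<le> l2norm M f * l2norm M g"
    using Cauchy_Schwarz_l2norm_abs[OF assms] by (simp add: norm_mult)
  finally show ?thesis .
qed

lemma l2norm_triangle:
  assumes "sq_int M f" "sq_int M g"
  shows "l2norm M (\<lambda>x. f x + g x) \<le> l2norm M f + l2norm M g"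
proof (rule power2_le_imp_le)
  have i: "integrable M (\<lambda>x. cmod (f x) * cmod (g x))"
    using integrable_norm[OF sq_int_mult[OF assms]] by (simp add: norm_mult)
  have "(l2norm M (\<lambda>x. f x + g x))\<^sup>2 \<le> (LINT x|M. (cmod (f x))\<^sup>2 + 2 * (cmod (f x) * cmod (g x)) + (cmod (g x))\<^sup>2)"
    unfolding l2norm_sq
  proof (rule integral_mono)
    fix x
    have "(cmod (f x + g x))\<^sup>2 \<le> (cmod (f x) + cmod (g x))\<^sup>2"
      by (intro power_mono norm_triangle_ineq) auto
    thus "(cmod (f x + g x))\<^sup>2 \<le> (cmod (f x))\<^sup>2 + 2 * (cmod (f x) * cmod (g x)) + (cmod (g x))\<^sup>2"
      by (simp add: power2_sum)
  qed (use assms i sq_int_add[OF assms] in \<open>auto simp: sq_int_def\<close>)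
  also have "\<dots> = (l2norm M f)\<^sup>2 + 2 * (LINT x|M. cmod (f x) * cmod (g x)) + (l2norm M g)\<^sup>2"
    unfolding l2norm_sq using assms i by (simp add: sq_int_def)
  also have "\<dots> \<le> (l2norm M f)\<^sup>2 + 2 * (l2norm M f * l2norm M g) + (l2norm M g)\<^sup>2"
    using Cauchy_Schwarz_l2norm_abs[OF assms] by simp
  also have "\<dots> = (l2norm M f + l2norm M g)\<^sup>2" by (simp add: power2_sum)
  finally show "(l2norm M (\<lambda>x. f x + g x))\<^sup>2 \<le> (l2norm M f + l2norm M g)\<^sup>2" .
qed simp

lemma l2norm_diff_triangle:
  assumes "sq_int M f" "sq_int M g" "sq_int M h"
  shows "l2norm M (\<lambda>x. f x - h x) \<le> l2norm M (\<lambda>x. f x - g x) + l2norm M (\<lambda>x. g x - h x)"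
  using l2norm_triangle[OF sq_int_diff[OF assms(1,2)] sq_int_diff[OF assms(2,3)]] by simp

lemma l2norm_reverse_triangle:
  assumes "sq_int M f" "sq_int M g"
  shows "\<bar>l2norm M f - l2norm M g\<bar> \<le> l2norm M (\<lambda>x. f x - g x)"
  using l2norm_triangle[OF sq_int_diff[OF assms] assms(2)]
    l2norm_triangle[OF sq_int_diff[OF assms(2,1)] assms(1)] l2norm_minus[of M f g] by simp

lemma l2norm_cong_AE:
  assumes "f \<in> borel_measurable M" "g \<in> borel_measurable M" "AE x in M. f x = g x"
  shows "l2norm M f = l2norm M g"
proof -
  note [measurable] = assms(1,2)
  have "(LINT x|M. (cmod (f x))\<^sup>2) = (LINT x|M. (cmod (g x))\<^sup>2)"
    by (rule integral_cong_AE) (use assms(3) in auto)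
  thus ?thesis by (simp add: l2norm_def)
qed

lemma l2norm_eq_0_iff:
  assumes "sq_int M f" shows "l2norm M f = 0 \<longleftrightarrow> (AE x in M. f x = 0)"
  using integral_nonneg_eq_0_iff_AE[OF sq_int_integrable[OF assms]] by (simp add: l2norm_def)

lemma l2norm_tendsto_AE_subseq:
  assumes "\<And>n. sq_int M (F n)" "sq_int M f" "(\<lambda>n. l2norm M (\<lambda>x. F n x - f x)) \<longlonglongrightarrow> 0"
  shows "\<exists>r::nat\<Rightarrow>nat. strict_mono r \<and> (AE x in M. (\<lambda>n. F (r n) x) \<longlonglongrightarrow> f x)"
proof -
  let ?u = "\<lambda>n x. (cmod (F n x - f x))\<^sup>2"
  have "(\<lambda>n. (l2norm M (\<lambda>x. F n x - f x))\<^sup>2) \<longlonglongrightarrow> 0\<^sup>2"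
    by (intro tendsto_intros assms)
  hence "(\<lambda>n. LINT x|M. norm (?u n x)) \<longlonglongrightarrow> 0" by (simp add: l2norm_sq)
  then obtain r :: "nat \<Rightarrow> nat" where r: "strict_mono r" "AE x in M. (\<lambda>n. ?u (r n) x) \<longlonglongrightarrow> 0"
    using tendsto_L1_AE_subseq[of M ?u] sq_int_integrable[OF sq_int_diff[OF assms(1,2)]] by blast
  from r(2) have "AE x in M. (\<lambda>n. F (r n) x) \<longlonglongrightarrow> f x"
  proof eventually_elim
    case (elim x)
    have "(\<lambda>n. sqrt (?u (r n) x)) \<longlonglongrightarrow> sqrt 0" by (intro tendsto_intros elim)
    hence "(\<lambda>n. F (r n) x - f x) \<longlonglongrightarrow> 0" by (simp add: tendsto_norm_zero_iff)
    thus ?case by (simp add: LIM_zero_iff)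
  qed
  with r(1) show ?thesis by blast
qed

text \<open>Riesz-Fischer. Along a subsequence with differences \<open>d\<^sub>k\<close> of norm at most \<open>2\<^sup>-\<^sup>k\<close> the series of
\<open>2\<^sup>k |d\<^sub>k|\<^sup>2\<close> has finite integral. Where its sum is finite the \<open>|d\<^sub>k|\<close> decay geometrically, so the
subsequence converges almost everywhere, and Fatou's lemma turns this into convergence in norm.\<close>

lemma l2_complete:
  assumes F: "\<And>n. sq_int M (F n)"
    and cauchy: "\<And>m n. m \<le> n \<Longrightarrow> l2norm M (\<lambda>x. F n x - F m x) \<le> e m" and e: "e \<longlonglongrightarrow> 0"
  shows "\<exists>f. sq_int M f \<and> (\<lambda>n. l2norm M (\<lambda>x. F n x - f x)) \<longlonglongrightarrow> 0"
proof -
  note [measurable] = sq_int_measurable[OF F]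
  have nn: "(\<integral>\<^sup>+x. ennreal ((cmod (F n x - F m x))\<^sup>2) \<partial>M) = ennreal ((l2norm M (\<lambda>x. F n x - F m x))\<^sup>2)" for m n
    unfolding l2norm_sq using sq_int_diff[OF F F] by (intro nn_integral_eq_integral) (auto simp: sq_int_def)
  have e0: "e n \<ge> 0" for n using cauchy[of n n] l2norm_nonneg[of M "\<lambda>x. F n x - F n x"] by linarith
  have "\<exists>N. \<forall>n\<ge>N. e n \<le> (1/2)^k" for k
  proof -
    have "\<forall>\<^sub>F n in sequentially. e n < (1/2)^k" by (rule order_tendstoD[OF e]) simp
    thus ?thesis unfolding eventually_sequentially by (meson less_imp_le)
  qed
  then obtain N where N: "\<And>k n. n \<ge> N k \<Longrightarrow> e n \<le> (1/2)^k" by metis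
  \<comment> \<open>The sum makes \<open>r\<close> monotone with \<open>r k \<ge> N k\<close>; the summand \<open>k\<close> makes it tend to infinity.\<close>
  define r where "r k = (\<Sum>j\<le>k. N j) + k" for k
  have rN: "r k \<ge> N k" for k unfolding r_def using member_le_sum[of k "{..k}" N] by auto
  have rmono: "r k \<le> r (Suc k)" and rk: "r k \<ge> k" for k by (auto simp: r_def)
  define d where "d k x = F (r (Suc k)) x - F (r k) x" for k x
  have dm [measurable]: "d k \<in> borel_measurable M" for k unfolding d_def[abs_def] by measurable
  have dle: "(\<integral>\<^sup>+x. ennreal ((cmod (d k x))\<^sup>2) \<partial>M) \<le> ennreal ((1/4)^k)" for k
  proof -
    have "(l2norm M (\<lambda>x. F (r (Suc k)) x - F (r k) x))\<^sup>2 \<le> ((1/2)^k)\<^sup>2"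
      using order_trans[OF cauchy[OF rmono] N[OF rN]] by (intro power_mono) auto
    also have "((1/2::real)^k)\<^sup>2 = (1/4)^k" by (simp add: power2_eq_square power_mult_distrib[symmetric])
    finally show ?thesis unfolding d_def nn by (rule ennreal_leI)
  qed
  have "(\<integral>\<^sup>+x. (\<Sum>k. ennreal (2^k * (cmod (d k x))\<^sup>2)) \<partial>M) = (\<Sum>k. \<integral>\<^sup>+x. ennreal (2^k * (cmod (d k x))\<^sup>2) \<partial>M)"
    by (rule nn_integral_suminf) measurable
  also have "\<dots> \<le> (\<Sum>k. ennreal ((1/2)^k))"
  proof (rule suminf_le)
    fix k
    have "(\<integral>\<^sup>+x. ennreal (2^k * (cmod (d k x))\<^sup>2) \<partial>M) = ennreal (2^k) * (\<integral>\<^sup>+x. ennreal ((cmod (d k x))\<^sup>2) \<partial>M)"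
      by (subst nn_integral_cmult[symmetric]) (auto simp: ennreal_mult)
    also have "\<dots> \<le> ennreal (2^k) * ennreal ((1/4)^k)" by (intro mult_left_mono dle) auto
    also have "\<dots> = ennreal ((1/2)^k)" by (simp add: ennreal_mult[symmetric] power_mult_distrib[symmetric])
    finally show "(\<integral>\<^sup>+x. ennreal (2^k * (cmod (d k x))\<^sup>2) \<partial>M) \<le> ennreal ((1/2)^k)" .
  qed auto
  also have "\<dots> = ennreal (\<Sum>k. (1/2)^k)" by (rule suminf_ennreal2) (auto intro: summable_geometric)
  also have "\<dots> < \<infinity>" by simp
  finally have "AE x in M. (\<Sum>k. ennreal (2^k * (cmod (d k x))\<^sup>2)) \<noteq> \<infinity>"
    by (intro nn_integral_PInf_AE) auto
  hence conv: "AE x in M. convergent (\<lambda>k. F (r k) x)"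
  proof eventually_elim
    case (elim x)
    define S where "S = (\<Sum>k. ennreal (2^k * (cmod (d k x))\<^sup>2))"
    have Sfin: "S < \<infinity>" using elim by (auto simp: S_def less_top)
    have le: "cmod (d k x) \<le> sqrt (enn2real S) * (1 / sqrt 2)^k" for k
    proof -
      have "ennreal (2^k * (cmod (d k x))\<^sup>2) \<le> S"
        unfolding S_def using ennreal_suminf_lessD[of "\<lambda>k. ennreal (2^k * (cmod (d k x))\<^sup>2)" _ k]
        by (meson leI less_irrefl)
      hence "2^k * (cmod (d k x))\<^sup>2 \<le> enn2real S"
        using enn2real_mono[OF _ Sfin[unfolded infinity_ennreal_def]] by (metis enn2real_ennreal zero_le_mult_iff zero_le_numeral zero_le_power zero_le_power2)
      hence "sqrt (2^k * (cmod (d k x))\<^sup>2) \<le> sqrt (enn2real S)" by (rule real_sqrt_le_mono)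
      moreover have "sqrt (2^k * (cmod (d k x))\<^sup>2) = sqrt 2 ^ k * cmod (d k x)"
        by (simp add: real_sqrt_mult real_sqrt_power)
      ultimately have "cmod (d k x) \<le> sqrt (enn2real S) / sqrt 2 ^ k"
        by (simp add: pos_le_divide_eq mult.commute)
      thus ?thesis by (simp add: power_one_over)
    qed
    have "summable (\<lambda>k. sqrt (enn2real S) * (1 / sqrt 2)^k)"
      by (intro summable_mult summable_geometric) auto
    hence "summable (\<lambda>k. d k x)" by (rule summable_comparison_test') (rule le)
    hence "convergent (\<lambda>n. \<Sum>k<n. d k x)" by (simp add: summable_iff_convergent)
    moreover have "(\<Sum>k<n. d k x) = F (r n) x - F (r 0) x" for n
      unfolding d_def by (rule sum_lessThan_telescope)
    ultimately have "convergent (\<lambda>n. F (r n) x - F (r 0) x)" by simp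
    from convergent_add[OF this convergent_const[of "F (r 0) x"]] show ?case by simp
  qed
  define f where "f x = lim (\<lambda>k. F (r k) x)" for x
  have [measurable]: "f \<in> borel_measurable M" unfolding f_def[abs_def] by measurable
  have bound: "(\<integral>\<^sup>+x. ennreal ((cmod (F n x - f x))\<^sup>2) \<partial>M) \<le> ennreal ((e n)\<^sup>2)" for n
  proof -
    have "(\<integral>\<^sup>+x. ennreal ((cmod (F n x - f x))\<^sup>2) \<partial>M)
       = (\<integral>\<^sup>+x. liminf (\<lambda>k. ennreal ((cmod (F n x - F (r k) x))\<^sup>2)) \<partial>M)"
    proof (rule nn_integral_cong_AE)
      from conv show "AE x in M. ennreal ((cmod (F n x - f x))\<^sup>2) = liminf (\<lambda>k. ennreal ((cmod (F n x - F (r k) x))\<^sup>2))"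
      proof eventually_elim
        case (elim x)
        hence "(\<lambda>k. F (r k) x) \<longlonglongrightarrow> f x" unfolding f_def by (simp add: convergent_LIMSEQ_iff)
        hence "(\<lambda>k. ennreal ((cmod (F n x - F (r k) x))\<^sup>2)) \<longlonglongrightarrow> ennreal ((cmod (F n x - f x))\<^sup>2)"
          by (intro tendsto_intros)
        thus ?case using lim_imp_Liminf[of sequentially] by (metis sequentially_bot)
      qed
    qed
    also have "\<dots> \<le> liminf (\<lambda>k. \<integral>\<^sup>+x. ennreal ((cmod (F n x - F (r k) x))\<^sup>2) \<partial>M)"
      by (rule nn_integral_liminf) measurable
    also have "\<dots> \<le> ennreal ((e n)\<^sup>2)"
    proof (rule Liminf_le)
      have "\<forall>\<^sub>F k in sequentially. k \<ge> n" by (rule eventually_ge_at_top)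
      thus "\<forall>\<^sub>F k in sequentially. (\<integral>\<^sup>+x. ennreal ((cmod (F n x - F (r k) x))\<^sup>2) \<partial>M) \<le> ennreal ((e n)\<^sup>2)"
      proof eventually_elim
        case (elim k)
        hence "n \<le> r k" using rk[of k] by linarith
        thus ?case unfolding nn l2norm_minus[of M "F n"] using cauchy[of n "r k"]
          by (intro ennreal_leI power_mono) auto
      qed
    qed simp
    finally show ?thesis .
  qed
  have Ff: "sq_int M (\<lambda>x. F n x - f x)" for n
    unfolding sq_int_def
  proof
    show "integrable M (\<lambda>x. (cmod (F n x - f x))\<^sup>2)"
      by (rule integrableI_bounded) (auto intro!: le_less_trans[OF bound])
  qed measurable
  have "sq_int M f" using sq_int_diff[OF F Ff, of 0 0] by simp
  moreover have "l2norm M (\<lambda>x. F n x - f x) \<le> e n" for n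
  proof (rule power2_le_imp_le)
    have "ennreal ((l2norm M (\<lambda>x. F n x - f x))\<^sup>2) \<le> ennreal ((e n)\<^sup>2)"
      unfolding l2norm_sq using bound[of n] nn_integral_eq_integral[OF sq_int_integrable[OF Ff[of n]]] by simp
    thus "(l2norm M (\<lambda>x. F n x - f x))\<^sup>2 \<le> (e n)\<^sup>2" by simp
  qed fact
  hence "(\<lambda>n. l2norm M (\<lambda>x. F n x - f x)) \<longlonglongrightarrow> 0"
    by (intro Lim_null_comparison[OF _ e]) auto
  ultimately show ?thesis by blast
qed

section \<open>The transform as an inner product\<close>

lemma sets_gauss_measure [simp, measurable_cong]: "sets (gauss_measure \<nu>) = sets lebesgue"
  by (simp add: gauss_measure_def)

lemma gaussian_weight_lebesgue_measurable:
  "(\<lambda>x::'a::euclidean_space. exp (- \<nu> * (norm x)\<^sup>2)) \<in> borel_measurable lebesgue"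
  by (intro continuous_imp_lebesgue_measurable continuous_intros)

lemma
  fixes f :: "'a::euclidean_space \<Rightarrow> 'b::{banach, second_countable_topology}"
  assumes "f \<in> borel_measurable lebesgue"
  shows integrable_gauss_measure_lebesgue:
      "integrable (gauss_measure \<nu>) f \<longleftrightarrow> integrable lebesgue (\<lambda>x. exp (- \<nu> * (norm x)\<^sup>2) *\<^sub>R f x)" (is ?A)
    and integral_gauss_measure_lebesgue:
      "integral\<^sup>L (gauss_measure \<nu>) f = (LINT x|lebesgue. exp (- \<nu> * (norm x)\<^sup>2) *\<^sub>R f x)" (is ?B)
proof -
  show ?A unfolding gauss_measure_def
    by (rule integrable_density[OF assms gaussian_weight_lebesgue_measurable]) simp
  show ?B unfolding gauss_measure_def
    by (rule integral_density[OF assms gaussian_weight_lebesgue_measurable]) simp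
qed

lemma
  fixes f :: "'a::euclidean_space \<Rightarrow> 'b::{banach, second_countable_topology}"
  assumes [measurable]: "f \<in> borel_measurable borel"
  shows integrable_gauss_measure:
      "integrable (gauss_measure \<nu>) f \<longleftrightarrow> integrable lborel (\<lambda>x. exp (- \<nu> * (norm x)\<^sup>2) *\<^sub>R f x)" (is ?A)
    and integral_gauss_measure:
      "integral\<^sup>L (gauss_measure \<nu>) f = (LINT x|lborel. exp (- \<nu> * (norm x)\<^sup>2) *\<^sub>R f x)" (is ?B)
proof -
  have f: "f \<in> borel_measurable lebesgue" by (simp add: measurable_completion)
  have w: "(\<lambda>x. exp (- \<nu> * (norm x)\<^sup>2) *\<^sub>R f x) \<in> borel_measurable lborel" by measurable
  show ?A unfolding integrable_gauss_measure_lebesgue[OF f] by (rule integrable_completion[OF w])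
  show ?B unfolding integral_gauss_measure_lebesgue[OF f] by (rule integral_completion[OF w])
qed

lemma AE_gauss_measure: "(AE x in gauss_measure \<nu>. P x) \<longleftrightarrow> (AE x in lebesgue. P x)"
  unfolding gauss_measure_def
  by (subst AE_density) (use gaussian_weight_lebesgue_measurable in \<open>auto simp: measurable_compose[OF _ measurable_ennreal]\<close>)

lemma L2_gauss_iff: "f \<in> L2_gauss \<nu> \<longleftrightarrow> sq_int (gauss_measure \<nu>) f"
  by (simp add: L2_gauss_def sq_int_def measurable_cong_sets[OF sets_gauss_measure refl])

lemma norm_gauss_eq: "norm_gauss \<nu> f = l2norm (gauss_measure \<nu>) f"
  by (simp add: norm_gauss_def l2norm_def)

lemma sq_int_lebesgue_measurable: "sq_int (gauss_measure \<nu>) f \<Longrightarrow> f \<in> borel_measurable lebesgue"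
  using L2_gauss_iff L2_gauss_def by blast

lemma borel_imp_gauss_measurable:
  "f \<in> borel_measurable borel \<Longrightarrow> f \<in> borel_measurable (gauss_measure \<nu>)"
  by (simp add: measurable_cong_sets[OF sets_gauss_measure refl] measurable_completion)

text \<open>Needed for Fubini arguments: Lebesgue measurable functions are not measurable for the product of the
Borel algebras.\<close>

lemma exists_borel_version:
  fixes f :: "'a::euclidean_space \<Rightarrow> complex"
  assumes "f \<in> borel_measurable lebesgue"
  shows "\<exists>g \<in> borel_measurable borel. AE x in lebesgue. f x = g x"
proof -
  have "(\<lambda>x. Re (f x)) \<in> borel_measurable lebesgue" "(\<lambda>x. Im (f x)) \<in> borel_measurable lebesgue"
    using assms by (auto intro: borel_measurable_Re borel_measurable_Im)
  from this[THEN completion_ex_borel_measurable_real]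
  obtain u v where [measurable]: "u \<in> borel_measurable lborel" "v \<in> borel_measurable lborel"
    and ae: "AE x in lborel. Re (f x) = u x" "AE x in lborel. Im (f x) = v x"
    by auto
  have "AE x in lborel. f x = Complex (u x) (v x)"
    using ae by eventually_elim (simp add: complex_eq_iff)
  hence "AE x in lebesgue. f x = Complex (u x) (v x)" by (rule AE_completion)
  moreover have "(\<lambda>x. Complex (u x) (v x)) \<in> borel_measurable borel"
    by (subst borel_measurable_complex_iff) simp
  ultimately show ?thesis by (intro bexI[of _ "\<lambda>x. Complex (u x) (v x)"])
qed

lemma sq_int_cong_AE:
  assumes "sq_int M f" "g \<in> borel_measurable M" "AE x in M. f x = g x"
  shows "sq_int M g"
  by (rule sq_int_bound[OF assms(1,2)]) (use assms(3) in auto)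

lemma sq_int_gauss_borel:
  fixes f :: "'a::euclidean_space \<Rightarrow> complex"
  assumes [measurable]: "f \<in> borel_measurable borel"
  shows "sq_int (gauss_measure \<nu>) f \<longleftrightarrow> integrable lborel (\<lambda>x. exp (- \<nu> * (norm x)\<^sup>2) * (cmod (f x))\<^sup>2)"
  using borel_imp_gauss_measurable[OF assms] integrable_gauss_measure[of "\<lambda>x. (cmod (f x))\<^sup>2" \<nu>]
  by (simp add: sq_int_def)

lemma l2norm_gauss_borel:
  fixes f :: "'a::euclidean_space \<Rightarrow> complex"
  assumes [measurable]: "f \<in> borel_measurable borel"
  shows "(l2norm (gauss_measure \<nu>) f)\<^sup>2 = (LINT x|lborel. exp (- \<nu> * (norm x)\<^sup>2) * (cmod (f x))\<^sup>2)"
  using integral_gauss_measure[of "\<lambda>x. (cmod (f x))\<^sup>2" \<nu>] by (simp add: l2norm_sq)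

lemma norm_pair_sq: "(norm (s :: complex \<times> complex))\<^sup>2 = (cmod (fst s))\<^sup>2 + (cmod (snd s))\<^sup>2"
  by (simp add: norm_prod_def)

text \<open>What remains of \<open>T_kernel\<close> once its factor \<open>exp (- \<nu> |x|\<^sup>2)\<close> is absorbed into the measure.\<close>

definition Fock_kernel :: "real \<Rightarrow> complex \<times> complex \<Rightarrow> complex \<Rightarrow> complex" where
  "Fock_kernel \<nu> s x = exp (of_real \<nu> * (fst s * cnj x + snd s * x - fst s * snd s))"

lemma Fock_kernel_continuous: "continuous_on UNIV (\<lambda>p. Fock_kernel \<nu> (fst p) (snd p))"
  unfolding Fock_kernel_def by (intro continuous_intros)

lemma Fock_kernel_measurable [measurable (raw)]:
  assumes "f \<in> borel_measurable M" "g \<in> borel_measurable M"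
  shows "(\<lambda>x. Fock_kernel \<nu> (f x) (g x)) \<in> borel_measurable M"
proof -
  have "(\<lambda>p. Fock_kernel \<nu> (fst p) (snd p)) \<in> borel_measurable borel"
    by (rule borel_measurable_continuous_onI[OF Fock_kernel_continuous])
  from measurable_compose[OF borel_measurable_Pair[OF assms] this] show ?thesis by simp
qed

lemma of_real_gaussian: "of_real (exp (- \<nu> * (cmod x)\<^sup>2)) = exp (- of_real \<nu> * (x * cnj x))"
  by (simp only: exp_of_real[symmetric] complex_norm_square of_real_mult of_real_minus)

lemma T_kernel_Fock: "T_kernel \<nu> z w x = of_real (exp (- \<nu> * (cmod x)\<^sup>2)) * Fock_kernel \<nu> (z, w) x"
  unfolding of_real_gaussian Fock_kernel_def T_kernel_def exp_add[symmetric] by (simp add: algebra_simps)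

text \<open>The factors \<open>exp (- \<nu> z w)\<close> cancel the mixed terms of the Gaussian integral and leave the reproducing
kernel of the Fock space.\<close>

lemma Fock_kernel_inner:
  assumes "\<nu> > 0"
  shows "has_bochner_integral lborel
     (\<lambda>x. exp (- \<nu> * (norm x)\<^sup>2) *\<^sub>R (Fock_kernel \<nu> s x * cnj (Fock_kernel \<nu> t x)))
     (of_real (pi / \<nu>) * exp (of_real \<nu> * (fst s * cnj (fst t) + snd s * cnj (snd t))))"
proof -
  let ?a = "of_real \<nu> * (snd s + cnj (fst t))" and ?b = "of_real \<nu> * (fst s + cnj (snd t))"
  let ?c = "- of_real \<nu> * (fst s * snd s + cnj (fst t * snd t))"
  have "exp (- \<nu> * (norm x)\<^sup>2) *\<^sub>R (Fock_kernel \<nu> s x * cnj (Fock_kernel \<nu> t x)) =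
     exp ?c * exp (- of_real \<nu> * (x * cnj x) + ?a * x + ?b * cnj x)" for x
    unfolding scaleR_conv_of_real of_real_gaussian Fock_kernel_def exp_cnj exp_add[symmetric]
    by (simp add: algebra_simps)
  moreover have "exp ?c * (of_real (pi / \<nu>) * exp (?a * ?b / of_real \<nu>)) =
      of_real (pi / \<nu>) * exp (of_real \<nu> * (fst s * cnj (fst t) + snd s * cnj (snd t)))"
  proof -
    have "?c + ?a * ?b / of_real \<nu> = of_real \<nu> * (fst s * cnj (fst t) + snd s * cnj (snd t))"
      using assms by (simp add: field_simps)
    thus ?thesis by (simp only: mult.left_commute[of "exp ?c"] exp_add[symmetric])
  qed
  ultimately show ?thesis
    using has_bochner_integral_mult_right[OF has_bochner_integral_gaussian[OF assms, of ?a ?b], of "exp ?c"]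
    by (simp only:)
qed

lemma
  assumes "\<nu> > 0"
  shows sq_int_Fock_kernel: "sq_int (gauss_measure \<nu>) (Fock_kernel \<nu> s)"
    and l2norm_Fock_kernel: "(l2norm (gauss_measure \<nu>) (Fock_kernel \<nu> s))\<^sup>2 = pi / \<nu> * exp (\<nu> * (norm s)\<^sup>2)"
proof -
  have m [measurable]: "Fock_kernel \<nu> s \<in> borel_measurable borel" by measurable
  have eq: "exp (- \<nu> * (norm x)\<^sup>2) *\<^sub>R (Fock_kernel \<nu> s x * cnj (Fock_kernel \<nu> s x)) =
      of_real (exp (- \<nu> * (norm x)\<^sup>2) * (cmod (Fock_kernel \<nu> s x))\<^sup>2)" for x
    by (simp only: complex_norm_square scaleR_conv_of_real of_real_mult)
  have eq2: "of_real (pi / \<nu>) * exp (of_real \<nu> * (fst s * cnj (fst s) + snd s * cnj (snd s)))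
      = complex_of_real (pi / \<nu> * exp (\<nu> * (norm s)\<^sup>2))"
    unfolding norm_pair_sq by (simp only: complex_norm_square exp_of_real[symmetric] of_real_mult of_real_add)
  have *: "has_bochner_integral lborel (\<lambda>x. complex_of_real (exp (- \<nu> * (norm x)\<^sup>2) * (cmod (Fock_kernel \<nu> s x))\<^sup>2))
      (complex_of_real (pi / \<nu> * exp (\<nu> * (norm s)\<^sup>2)))"
    using Fock_kernel_inner[OF assms, of s s] unfolding eq eq2 .
  have "has_bochner_integral lborel (\<lambda>x. exp (- \<nu> * (norm x)\<^sup>2) * (cmod (Fock_kernel \<nu> s x))\<^sup>2)
      (pi / \<nu> * exp (\<nu> * (norm s)\<^sup>2))"
    using has_bochner_integral_Re[OF *] by (simp only: Re_complex_of_real)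
  thus "sq_int (gauss_measure \<nu>) (Fock_kernel \<nu> s)"
    "(l2norm (gauss_measure \<nu>) (Fock_kernel \<nu> s))\<^sup>2 = pi / \<nu> * exp (\<nu> * (norm s)\<^sup>2)"
    by (simp_all add: sq_int_gauss_borel l2norm_gauss_borel has_bochner_integral_iff)
qed

lemma T_op_eq:
  assumes "\<psi> \<in> borel_measurable lebesgue"
  shows "T_op \<nu> \<psi> s = of_real ((\<nu> / pi) powr (3/2)) * (LINT x|gauss_measure \<nu>. Fock_kernel \<nu> s x * \<psi> x)"
proof -
  have [measurable]: "Fock_kernel \<nu> s \<in> borel_measurable lebesgue"
    by (simp add: measurable_completion)
  note [measurable] = assms
  show ?thesis
    unfolding T_op_def by (subst integral_gauss_measure_lebesgue)
      (auto simp: case_prod_beta T_kernel_Fock scaleR_conv_of_real mult.assoc)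
qed

lemma T_integrable:
  assumes "\<nu> > 0" "sq_int (gauss_measure \<nu>) \<psi>"
  shows "integrable lebesgue (\<lambda>x. T_kernel \<nu> z w x * \<psi> x)"
proof -
  have [measurable]: "Fock_kernel \<nu> (z, w) \<in> borel_measurable lebesgue"
    by (simp add: measurable_completion)
  note [measurable] = sq_int_lebesgue_measurable[OF assms(2)]
  have "integrable (gauss_measure \<nu>) (\<lambda>x. Fock_kernel \<nu> (z, w) x * \<psi> x)"
    by (rule sq_int_mult[OF sq_int_Fock_kernel[OF assms(1)] assms(2)])
  thus ?thesis
    by (subst (asm) integrable_gauss_measure_lebesgue) (auto simp: T_kernel_Fock scaleR_conv_of_real mult.assoc)
qed

lemma T_op_bound:
  assumes "\<nu> > 0" "sq_int (gauss_measure \<nu>) \<psi>"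
  shows "cmod (T_op \<nu> \<psi> s) \<le> (\<nu> / pi) powr (3/2) * (l2norm (gauss_measure \<nu>) (Fock_kernel \<nu> s) * l2norm (gauss_measure \<nu>) \<psi>)"
  unfolding T_op_eq[OF sq_int_lebesgue_measurable[OF assms(2)]] norm_mult norm_of_real
  using Cauchy_Schwarz_l2norm[OF sq_int_Fock_kernel[OF assms(1)] assms(2)]
  by (intro mult_mono) auto

lemma T_op_linear:
  assumes "\<nu> > 0" "sq_int (gauss_measure \<nu>) f" "sq_int (gauss_measure \<nu>) g"
  shows "T_op \<nu> (\<lambda>x. a * f x + b * g x) = (\<lambda>s. a * T_op \<nu> f s + b * T_op \<nu> g s)"
proof
  fix s
  let ?k = "Fock_kernel \<nu> s"
  note k = sq_int_mult[OF sq_int_Fock_kernel[OF assms(1)]]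
  have "(LINT x|gauss_measure \<nu>. ?k x * (a * f x + b * g x))
      = (LINT x|gauss_measure \<nu>. a * (?k x * f x) + b * (?k x * g x))"
    by (intro Bochner_Integration.integral_cong) (simp_all add: algebra_simps)
  also have "\<dots> = a * (LINT x|gauss_measure \<nu>. ?k x * f x) + b * (LINT x|gauss_measure \<nu>. ?k x * g x)"
    using k[OF assms(2)] k[OF assms(3)] by simp
  finally show "T_op \<nu> (\<lambda>x. a * f x + b * g x) s = a * T_op \<nu> f s + b * T_op \<nu> g s"
    using sq_int_lebesgue_measurable[OF assms(2)] sq_int_lebesgue_measurable[OF assms(3)]
      sq_int_lebesgue_measurable[OF sq_int_add[OF sq_int_cmult[OF assms(2), of a] sq_int_cmult[OF assms(3), of b]]]
    by (simp add: T_op_eq algebra_simps)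
qed

lemma T_op_diff:
  assumes "\<nu> > 0" "sq_int (gauss_measure \<nu>) f" "sq_int (gauss_measure \<nu>) g"
  shows "T_op \<nu> (\<lambda>x. f x - g x) = (\<lambda>s. T_op \<nu> f s - T_op \<nu> g s)"
  using T_op_linear[OF assms, of 1 "- 1"] by simp

lemma T_op_cong_AE:
  assumes "f \<in> borel_measurable lebesgue" "g \<in> borel_measurable lebesgue" "AE x in lebesgue. f x = g x"
  shows "T_op \<nu> f = T_op \<nu> g"
proof
  fix s
  have [measurable]: "Fock_kernel \<nu> s \<in> borel_measurable lebesgue"
    by (simp add: measurable_completion)
  note [measurable] = assms(1,2)
  have "(LINT x|gauss_measure \<nu>. Fock_kernel \<nu> s x * f x) = (LINT x|gauss_measure \<nu>. Fock_kernel \<nu> s x * g x)"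
  proof (rule integral_cong_AE)
    show "AE x in gauss_measure \<nu>. Fock_kernel \<nu> s x * f x = Fock_kernel \<nu> s x * g x"
      unfolding AE_gauss_measure using assms(3) by eventually_elim simp
  qed measurable
  thus "T_op \<nu> f s = T_op \<nu> g s" using assms(1,2) by (simp add: T_op_eq)
qed

text \<open>Because \<open>exp (r |x|) |\<psi>| \<le> exp (2 r |x|) + |\<psi>|\<^sup>2\<close>.\<close>

lemma rapid_gaussian_times_sq_int:
  assumes "\<nu> > 0" "sq_int (gauss_measure \<nu>) \<psi>"
  shows "rapid (\<lambda>x. exp (- of_real \<nu> * (x * cnj x)) * \<psi> x)"
  unfolding rapid_def
proof (intro conjI allI)
  note [measurable] = sq_int_lebesgue_measurable[OF assms(2)]
  have "(\<lambda>x::complex. exp (- of_real \<nu> * (x * cnj x))) \<in> borel_measurable lebesgue"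
    by (intro continuous_imp_lebesgue_measurable continuous_intros)
  thus m: "(\<lambda>x. exp (- of_real \<nu> * (x * cnj x)) * \<psi> x) \<in> borel_measurable lebesgue" by measurable
  fix r
  have 1: "integrable lebesgue (\<lambda>x. exp (- \<nu> * (cmod x)\<^sup>2) * (cmod (\<psi> x))\<^sup>2)"
    using sq_int_integrable[OF assms(2)] by (subst (asm) integrable_gauss_measure_lebesgue) auto
  have 2: "integrable lebesgue (\<lambda>x::complex. exp (2 * r * cmod x) * exp (- \<nu> * (cmod x)\<^sup>2))"
    using integrable_exp_gaussian_weight[OF assms(1)] by (subst integrable_completion) auto
  show "integrable lebesgue (\<lambda>x. exp (r * cmod x) * cmod (exp (- of_real \<nu> * (x * cnj x)) * \<psi> x))"
  proof (rule Bochner_Integration.integrable_bound[OF Bochner_Integration.integrable_add[OF 1 2]])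
    have "exp (r * cmod x) * (exp (- \<nu> * (cmod x)\<^sup>2) * cmod (\<psi> x)) \<le>
      exp (- \<nu> * (cmod x)\<^sup>2) * (cmod (\<psi> x))\<^sup>2 + exp (2 * r * cmod x) * exp (- \<nu> * (cmod x)\<^sup>2)" for x
    proof -
      have am: "A * B \<le> A\<^sup>2 + B\<^sup>2" if "A \<ge> 0" "B \<ge> 0" for A B :: real
        using zero_le_power2[of "A - B"] mult_nonneg_nonneg[OF that] by (simp add: power2_eq_square algebra_simps)
      have "exp (r * cmod x) * cmod (\<psi> x) \<le> (exp (r * cmod x))\<^sup>2 + (cmod (\<psi> x))\<^sup>2"
        by (rule am) auto
      also have "(exp (r * cmod x))\<^sup>2 = exp (2 * r * cmod x)"
        by (simp add: power2_eq_square exp_add[symmetric])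
      finally have "exp (- \<nu> * (cmod x)\<^sup>2) * (exp (r * cmod x) * cmod (\<psi> x))
          \<le> exp (- \<nu> * (cmod x)\<^sup>2) * (exp (2 * r * cmod x) + (cmod (\<psi> x))\<^sup>2)"
        by (intro mult_left_mono) auto
      thus ?thesis by (simp only: distrib_left mult_ac add_ac)
    qed
    thus "AE x in lebesgue. norm (exp (r * cmod x) * cmod (exp (- of_real \<nu> * (x * cnj x)) * \<psi> x))
        \<le> norm (exp (- \<nu> * (cmod x)\<^sup>2) * (cmod (\<psi> x))\<^sup>2 + exp (2 * r * cmod x) * exp (- \<nu> * (cmod x)\<^sup>2))"
      unfolding norm_mult norm_exp_cnj by (intro AE_I2) simp
    have "(\<lambda>x::complex. exp (r * cmod x)) \<in> borel_measurable lebesgue"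
      by (intro continuous_imp_lebesgue_measurable continuous_intros)
    thus "(\<lambda>x. exp (r * cmod x) * cmod (exp (- of_real \<nu> * (x * cnj x)) * \<psi> x)) \<in> borel_measurable lebesgue"
      by (rule borel_measurable_times[OF _ measurable_compose[OF m borel_measurable_norm]])
  qed
qed

lemma holomorphic2_T_op:
  assumes "\<nu> > 0" "sq_int (gauss_measure \<nu>) \<psi>"
  shows "holomorphic2 (T_op \<nu> \<psi>)"
  unfolding holomorphic2_def
proof
  fix s
  let ?g = "\<lambda>x. exp (- of_real \<nu> * (x * cnj x)) * \<psi> x"
  let ?c = "complex_of_real ((\<nu> / pi) powr (3/2))"
  let ?L = "\<lambda>s. (of_real \<nu> * snd s, of_real \<nu> * fst s) :: complex \<times> complex"
  note g = rapid_gaussian_times_sq_int[OF assms]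
  have T: "T_op \<nu> \<psi> = (\<lambda>s. ?c * (exp (- of_real \<nu> * (fst s * snd s)) * bilaplace ?g (?L s)))"
  proof
    fix s
    have "(LINT x|lebesgue. T_kernel \<nu> (fst s) (snd s) x * \<psi> x) =
      (LINT x|lebesgue. exp (- of_real \<nu> * (fst s * snd s)) *
        (exp ((of_real \<nu> * snd s) * x + (of_real \<nu> * fst s) * cnj x) * ?g x))"
      unfolding T_kernel_eq by (simp only: mult.assoc)
    thus "T_op \<nu> \<psi> s = ?c * (exp (- of_real \<nu> * (fst s * snd s)) * bilaplace ?g (?L s))"
      unfolding T_op_def bilaplace_def by (simp add: case_prod_beta)
  qed
  have dL: "(?L has_derivative ?L) (at s)"
    by (rule bounded_linear_imp_has_derivative)
       (intro bounded_linear_Pair bounded_linear_const_mult bounded_linear_fst bounded_linear_snd)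
  define p q where "p = bilaplace (\<lambda>x. x * ?g x) (?L s)" and "q = bilaplace (\<lambda>x. cnj x * ?g x) (?L s)"
  have dB: "((\<lambda>s. bilaplace ?g (?L s)) has_derivative (\<lambda>h. of_real \<nu> * snd h * p + of_real \<nu> * fst h * q)) (at s)"
    using has_derivative_compose[OF dL bilaplace_has_derivative[OF g]] by (simp add: p_def q_def)
  have "((\<lambda>s. - of_real \<nu> * (fst s * snd s)) has_derivative
      (\<lambda>h. - of_real \<nu> * (fst s * snd h + fst h * snd s))) (at s)"
    by (intro has_derivative_mult_right has_derivative_mult has_derivative_fst has_derivative_snd has_derivative_ident)
  note dE = has_derivative_compose[OF this DERIV_exp[unfolded has_field_derivative_def]]
  let ?e = "exp (- of_real \<nu> * (fst s * snd s))" and ?B = "bilaplace ?g (?L s)"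
  have "(T_op \<nu> \<psi> has_derivative (\<lambda>h. (?c * (?e * (of_real \<nu> * q) - ?e * (of_real \<nu> * snd s) * ?B)) * fst h
      + (?c * (?e * (of_real \<nu> * p) - ?e * (of_real \<nu> * fst s) * ?B)) * snd h)) (at s)"
    unfolding T by (rule has_derivative_eq_rhs[OF has_derivative_mult_right[OF has_derivative_mult[OF dE dB]]])
      (simp add: fun_eq_iff algebra_simps)
  thus "\<exists>a b. (T_op \<nu> \<psi> has_derivative (\<lambda>h. a * fst h + b * snd h)) (at s)" by blast
qed

lemma holomorphic2_continuous: "holomorphic2 f \<Longrightarrow> continuous_on UNIV f"
  unfolding holomorphic2_def
  by (meson continuous_at_imp_continuous_on has_derivative_continuous)

lemma holomorphic2_measurable: "holomorphic2 f \<Longrightarrow> f \<in> borel_measurable borel"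
  by (intro borel_measurable_continuous_onI holomorphic2_continuous)

section \<open>The regularized norm of the transform\<close>

lemma borel_measurable_cnj_comp [measurable (raw)]:
  "f \<in> borel_measurable M \<Longrightarrow> (\<lambda>x. cnj (f x)) \<in> borel_measurable M"
  by (rule measurable_compose[OF _ borel_measurable_continuous_onI[OF continuous_on_cnj[OF continuous_on_id]]])

lemma integrable_gaussian_pair:
  assumes "\<epsilon> > 0"
  shows "integrable lborel (\<lambda>s::complex \<times> complex. exp (C * (cmod (fst s) + cmod (snd s))) * exp (- \<epsilon> * (norm s)\<^sup>2))"
proof -
  let ?g = "\<lambda>z::complex. exp (C * cmod z) * exp (- \<epsilon> * (cmod z)\<^sup>2)"
  have "has_bochner_integral lborel ?g (integral\<^sup>L lborel ?g)"
    using integrable_exp_gaussian_weight[OF assms] by (simp add: has_bochner_integral_iff)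
  from has_bochner_integral_prod_mult[OF _ _ this this]
  have "integrable (lborel \<Otimes>\<^sub>M lborel) (\<lambda>(z, w). ?g z * ?g w)"
    by (auto simp: has_bochner_integral_iff lborel.sigma_finite_measure_axioms)
  moreover have "(\<lambda>(z, w). ?g z * ?g w) = (\<lambda>s. exp (C * (cmod (fst s) + cmod (snd s))) * exp (- \<epsilon> * (norm s)\<^sup>2))"
    unfolding norm_pair_sq by (auto simp: fun_eq_iff exp_add[symmetric] algebra_simps)
  ultimately show ?thesis unfolding lborel_prod by simp
qed

lemma norm_Fock_kernel_le:
  assumes "\<nu> > 0"
  shows "cmod (Fock_kernel \<nu> s x) \<le> exp (\<nu> * cmod x * (cmod (fst s) + cmod (snd s)) + \<nu> / 2 * (norm s)\<^sup>2)"
proof -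
  have "cmod (of_real \<nu> * (fst s * cnj x + snd s * x - fst s * snd s))
      = \<nu> * cmod (fst s * cnj x + snd s * x - fst s * snd s)" using assms by (simp add: norm_mult)
  also have "\<dots> \<le> \<nu> * (cmod (fst s) * cmod x + cmod (snd s) * cmod x + cmod (fst s) * cmod (snd s))"
    using assms by (intro mult_left_mono order_trans[OF norm_triangle_ineq4] add_mono order_trans[OF norm_triangle_ineq])
      (auto simp: norm_mult)
  also have "\<dots> \<le> \<nu> * (cmod (fst s) * cmod x + cmod (snd s) * cmod x + (norm s)\<^sup>2 / 2)"
    using assms zero_le_power2[of "cmod (fst s) - cmod (snd s)"] unfolding norm_pair_sq
    by (intro mult_left_mono add_left_mono) (auto simp: power2_eq_square algebra_simps)
  finally have "cmod (of_real \<nu> * (fst s * cnj x + snd s * x - fst s * snd s))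
    \<le> \<nu> * cmod x * (cmod (fst s) + cmod (snd s)) + \<nu> / 2 * (norm s)\<^sup>2"
    by (simp add: algebra_simps)
  thus ?thesis unfolding Fock_kernel_def using norm_exp order_trans exp_le_cancel_iff by blast
qed

text \<open>The exponent that two successive planar Gaussian integrals produce. With \<open>xb\<close> and \<open>yb\<close> in place of the
conjugates of \<open>x\<close> and \<open>y\<close> it is an identity of rational functions.\<close>

lemma Fock_kernel_regularized_exponent:
  fixes m n x y xb yb :: complex
  assumes "m \<noteq> 0" "m + n \<noteq> 0" "m - n \<noteq> 0"
  shows "n\<^sup>2 * x * yb / m + (n * xb - n\<^sup>2 * yb / m) * (n * y - n\<^sup>2 * x / m) / ((m\<^sup>2 - n\<^sup>2) / m)
    = n\<^sup>2 * ((x * xb + y * yb) / (m + n) - m * ((x - y) * (xb - yb)) / (m\<^sup>2 - n\<^sup>2))"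
proof -
  have D: "m\<^sup>2 - n\<^sup>2 = (m + n) * (m - n)" by (simp add: power2_eq_square algebra_simps)
  have "m\<^sup>2 - n\<^sup>2 \<noteq> 0" using assms unfolding D by simp
  define D where "D = m\<^sup>2 - n\<^sup>2"
  have D0: "D \<noteq> 0" and mn: "1 / (m + n) = (m - n) / D"
    using assms \<open>m\<^sup>2 - n\<^sup>2 \<noteq> 0\<close> by (simp_all add: D_def D field_simps)
  have A: "(x * xb + y * yb) / (m + n) = (x * xb + y * yb) * (m - n) / D"
    using mn by (metis mult.right_neutral times_divide_eq_right)
  have B: "n\<^sup>2 * x * yb / m = n\<^sup>2 * x * yb * (m\<^sup>2 - n\<^sup>2) / (m * D)"
    using D0 by (simp add: D_def)
  have C: "(n * xb - n\<^sup>2 * yb / m) * (n * y - n\<^sup>2 * x / m) / (D / m)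
    = n\<^sup>2 * ((m * xb - n * yb) * (m * y - n * x)) / (m * D)"
    using assms(1) D0 by (simp add: field_simps power2_eq_square)
  have "n\<^sup>2 * x * yb * (m\<^sup>2 - n\<^sup>2) + n\<^sup>2 * ((m * xb - n * yb) * (m * y - n * x))
     = m * (n\<^sup>2 * ((x * xb + y * yb) * (m - n) - m * ((x - y) * (xb - yb))))"
    by (simp add: power2_eq_square algebra_simps)
  hence "n\<^sup>2 * x * yb * (m\<^sup>2 - n\<^sup>2) / (m * D) + n\<^sup>2 * ((m * xb - n * yb) * (m * y - n * x)) / (m * D)
     = n\<^sup>2 * ((x * xb + y * yb) * (m - n) / D - m * ((x - y) * (xb - yb)) / D)"
    using assms(1) unfolding add_divide_distrib[symmetric] diff_divide_distrib[symmetric] by simp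
  thus ?thesis unfolding D_def[symmetric] A C unfolding D_def B .
qed

text \<open>For \<open>\<mu> = \<nu>\<close> the integrand has constant modulus along \<open>w = - cnj z\<close>, so the integral would diverge; any
\<open>\<mu> > \<nu>\<close> makes it converge. As \<open>\<mu>\<close> tends to \<open>\<nu>\<close> the result concentrates on \<open>x = y\<close>.\<close>

lemma Fock_kernel_regularized:
  assumes "0 < \<nu>" "\<nu> < \<mu>"
  shows "has_bochner_integral lborel
    (\<lambda>s. exp (- \<mu> * (norm s)\<^sup>2) *\<^sub>R (Fock_kernel \<nu> s x * cnj (Fock_kernel \<nu> s y)))
    (of_real (pi\<^sup>2 / (\<mu>\<^sup>2 - \<nu>\<^sup>2) *
       exp (\<nu>\<^sup>2 * (((cmod x)\<^sup>2 + (cmod y)\<^sup>2) / (\<mu> + \<nu>) - \<mu> * (cmod (x - y))\<^sup>2 / (\<mu>\<^sup>2 - \<nu>\<^sup>2)))))"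
proof -
  let ?\<Phi> = "\<lambda>s. exp (- \<mu> * (norm s)\<^sup>2) *\<^sub>R (Fock_kernel \<nu> s x * cnj (Fock_kernel \<nu> s y))"
  have [measurable]: "?\<Phi> \<in> borel_measurable borel" by measurable
  have \<mu>: "\<mu> > 0" using assms by simp
  have int: "integrable lborel ?\<Phi>"
  proof (rule Bochner_Integration.integrable_bound[OF integrable_gaussian_pair])
    show "\<mu> - \<nu> > 0" using assms by simp
    show "AE s in lborel. norm (?\<Phi> s) \<le> norm (exp (\<nu> * (cmod x + cmod y) * (cmod (fst s) + cmod (snd s))) *
        exp (- (\<mu> - \<nu>) * (norm s)\<^sup>2))"
    proof (intro AE_I2)
      fix s
      have "norm (?\<Phi> s) = exp (- \<mu> * (norm s)\<^sup>2) * (cmod (Fock_kernel \<nu> s x) * cmod (Fock_kernel \<nu> s y))"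
        by (simp add: norm_mult)
      also have "\<dots> \<le> exp (- \<mu> * (norm s)\<^sup>2) *
          (exp (\<nu> * cmod x * (cmod (fst s) + cmod (snd s)) + \<nu> / 2 * (norm s)\<^sup>2) *
           exp (\<nu> * cmod y * (cmod (fst s) + cmod (snd s)) + \<nu> / 2 * (norm s)\<^sup>2))"
        by (intro mult_left_mono mult_mono norm_Fock_kernel_le assms) auto
      also have "\<dots> = norm (exp (\<nu> * (cmod x + cmod y) * (cmod (fst s) + cmod (snd s))) *
        exp (- (\<mu> - \<nu>) * (norm s)\<^sup>2))"
        unfolding exp_add[symmetric] real_norm_def abs_exp_cancel by (simp add: algebra_simps)
      finally show "norm (?\<Phi> s) \<le> norm (exp (\<nu> * (cmod x + cmod y) * (cmod (fst s) + cmod (snd s))) *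
        exp (- (\<mu> - \<nu>) * (norm s)\<^sup>2))" .
    qed
  qed measurable
  let ?m = "complex_of_real \<mu>" and ?n = "complex_of_real \<nu>"
  \<comment> \<open>The coefficient of \<open>- |z|\<^sup>2\<close> that is left after the integration over \<open>w\<close>.\<close>
  let ?\<kappa> = "(\<mu>\<^sup>2 - \<nu>\<^sup>2) / \<mu>"
  have D: "\<mu>\<^sup>2 - \<nu>\<^sup>2 > 0" using assms by (simp add: power_strict_mono)
  hence \<kappa>: "?\<kappa> > 0" using \<mu> by simp
  let ?A = "?n * cnj x - ?n\<^sup>2 * cnj y / ?m" and ?B = "?n * y - ?n\<^sup>2 * x / ?m"
  let ?C = "of_real (pi / \<mu>) * exp (?n\<^sup>2 * x * cnj y / ?m)"
  have inner: "(LINT w|lborel. ?\<Phi> (z, w)) = ?C * exp (- of_real ?\<kappa> * (z * cnj z) + ?A * z + ?B * cnj z)" for z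
  proof -
    have e: "?\<Phi> (z, w) = exp (- ?m * (z * cnj z) + ?n * (z * cnj x) + ?n * (cnj z * y)) *
        exp (- ?m * (w * cnj w) + (?n * (x - z)) * w + (?n * (cnj y - cnj z)) * cnj w)" for w
    proof -
      have "of_real (exp (- \<mu> * (norm (z, w))\<^sup>2)) = exp (- ?m * (z * cnj z + w * cnj w))"
        unfolding norm_pair_sq fst_conv snd_conv
        by (simp only: complex_norm_square exp_of_real[symmetric] of_real_mult of_real_add of_real_minus)
      thus ?thesis unfolding scaleR_conv_of_real
        by (simp only: Fock_kernel_def exp_cnj fst_conv snd_conv exp_add[symmetric]) (simp add: algebra_simps)
    qed
    have "(LINT w|lborel. ?\<Phi> (z, w)) = exp (- ?m * (z * cnj z) + ?n * (z * cnj x) + ?n * (cnj z * y)) *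
        (of_real (pi / \<mu>) * exp ((?n * (x - z)) * (?n * (cnj y - cnj z)) / ?m))"
      using has_bochner_integral_integral_eq[OF has_bochner_integral_mult_right[OF has_bochner_integral_gaussian[OF \<mu>,
          of "?n * (x - z)" "?n * (cnj y - cnj z)"], of "exp (- ?m * (z * cnj z) + ?n * (z * cnj x) + ?n * (cnj z * y))"]]
      unfolding e .
    also have "\<dots> = ?C * exp (- of_real ?\<kappa> * (z * cnj z) + ?A * z + ?B * cnj z)"
    proof -
      have "(- ?m * (z * cnj z) + ?n * (z * cnj x) + ?n * (cnj z * y)) + (?n * (x - z)) * (?n * (cnj y - cnj z)) / ?m
        = ?n\<^sup>2 * x * cnj y / ?m + (- of_real ?\<kappa> * (z * cnj z) + ?A * z + ?B * cnj z)"
        using \<mu> by (simp add: field_simps power2_eq_square)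
      thus ?thesis by (simp only: mult.left_commute[of "exp _" "of_real _"] mult.assoc exp_add[symmetric])
    qed
    finally show ?thesis .
  qed
  have "(LINT s|lborel. ?\<Phi> s) = (LINT z|lborel. LINT w|lborel. ?\<Phi> (z, w))"
    using lborel_pair.integral_fst'[of ?\<Phi>] int unfolding lborel_prod by simp
  also have "\<dots> = ?C * (of_real (pi / ?\<kappa>) * exp (?A * ?B / of_real ?\<kappa>))"
    unfolding inner
    using has_bochner_integral_integral_eq[OF has_bochner_integral_mult_right[OF has_bochner_integral_gaussian[OF \<kappa>, of ?A ?B], of ?C]] .
  also have "\<dots> = of_real (pi / \<mu> * (pi / ?\<kappa>)) * exp (?n\<^sup>2 * x * cnj y / ?m + ?A * ?B / of_real ?\<kappa>)"
    unfolding exp_add of_real_mult by (simp only: mult_ac)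
  also have "?n\<^sup>2 * x * cnj y / ?m + ?A * ?B / of_real ?\<kappa> =
     of_real (\<nu>\<^sup>2 * (((cmod x)\<^sup>2 + (cmod y)\<^sup>2) / (\<mu> + \<nu>) - \<mu> * (cmod (x - y))\<^sup>2 / (\<mu>\<^sup>2 - \<nu>\<^sup>2)))"
  proof -
    have nz: "?m \<noteq> 0" "?m + ?n \<noteq> 0" "?m - ?n \<noteq> 0"
      using assms by (auto simp flip: of_real_add of_real_diff simp del: of_real_eq_iff)
    show ?thesis
      using Fock_kernel_regularized_exponent[OF nz, of x "cnj y" "cnj x" y]
      by (simp only: of_real_mult of_real_diff of_real_divide of_real_add of_real_power
          complex_norm_square[unfolded of_real_power, symmetric] complex_cnj_diff[symmetric])
  qed
  also have "pi / \<mu> * (pi / ?\<kappa>) = pi\<^sup>2 / (\<mu>\<^sup>2 - \<nu>\<^sup>2)" using \<mu> D by (simp add: power2_eq_square field_simps)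
  also have "of_real (pi\<^sup>2 / (\<mu>\<^sup>2 - \<nu>\<^sup>2)) * exp (complex_of_real E) = of_real (pi\<^sup>2 / (\<mu>\<^sup>2 - \<nu>\<^sup>2) * exp E)" for E
    by (simp add: exp_of_real)
  finally show ?thesis using int by (simp only: has_bochner_integral_iff)
qed

text \<open>Write \<open>|T_op \<psi> s|\<^sup>2\<close> as a double integral over \<open>(x, y)\<close> and integrate over \<open>s\<close> first. The substitute \<open>f\<close>
carries half of the Gaussian weight, so that its unweighted norm is the norm of \<open>\<psi>\<close>. The kernel
\<open>(\<tau>/pi) exp (- \<tau> |x - y|\<^sup>2)\<close> has total mass one in each variable, and \<open>\<tau>\<close> tends to infinity and
\<open>\<delta>\<close> to zero as \<open>\<mu>\<close> tends to \<open>\<nu>\<close>.\<close>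

lemma T_op_regularized:
  fixes \<psi> :: "complex \<Rightarrow> complex"
  assumes \<nu>: "0 < \<nu>" "\<nu> < \<mu>" and [measurable]: "\<psi> \<in> borel_measurable borel"
    and \<psi>: "sq_int (gauss_measure \<nu>) \<psi>"
  assumes f_def: "f = (\<lambda>x. of_real (exp (- (\<nu> / 2) * (cmod x)\<^sup>2)) * \<psi> x)"
    and \<tau>_def: "\<tau> = \<nu>\<^sup>2 * \<mu> / (\<mu>\<^sup>2 - \<nu>\<^sup>2)" and \<delta>_def: "\<delta> = \<nu> * (\<mu> - \<nu>) / (2 * (\<mu> + \<nu>))"
    and F_def: "F = (\<lambda>p. (of_real (exp (- \<delta> * (cmod (fst p))\<^sup>2)) * f (fst p)) *
      cnj (of_real (exp (- \<delta> * (cmod (snd p))\<^sup>2)) * f (snd p)) * of_real (exp (- \<tau> * (cmod (fst p - snd p))\<^sup>2)))"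
  shows "integrable lborel F"
    and "of_real (LINT s|lborel. exp (- \<mu> * (norm s)\<^sup>2) * (cmod (T_op \<nu> \<psi> s))\<^sup>2) =
      of_real (\<nu> / \<mu> * (\<tau> / pi)) * (LINT p|lborel. F p)"
proof -
  let ?k = "Fock_kernel \<nu>" and ?G = "gauss_measure \<nu> :: complex measure"
  define c where "c = (\<nu> / pi) powr (3/2)"
  define g where "g x = exp (- \<nu> * (norm x)\<^sup>2) *\<^sub>R \<psi> x" for x
  have [measurable]: "g \<in> borel_measurable borel" unfolding g_def[abs_def] by measurable
  have sm: "sigma_finite_measure (lborel :: complex measure)" by unfold_locales
  define u where "u s x = ?k s x * g x" for s x
  define \<Psi> where "\<Psi> s p = exp (- \<mu> * (norm s)\<^sup>2) *\<^sub>R (u s (fst p) * cnj (u s (snd p)))" for s p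
  have [measurable]: "case_prod \<Psi> \<in> borel_measurable (lborel \<Otimes>\<^sub>M lborel)"
  proof -
    define S X Y where "S q = fst q" and "X q = fst (snd q)" and "Y q = snd (snd q)"
      for q :: "(complex \<times> complex) \<times> complex \<times> complex"
    have [measurable]: "S \<in> borel_measurable borel" "X \<in> borel_measurable borel" "Y \<in> borel_measurable borel"
      unfolding S_def[abs_def] X_def[abs_def] Y_def[abs_def]
      by (intro borel_measurable_continuous_onI continuous_intros)+
    have "case_prod \<Psi> = (\<lambda>q. exp (- \<mu> * (norm (S q))\<^sup>2) *\<^sub>R ((?k (S q) (X q) * g (X q)) * cnj (?k (S q) (Y q) * g (Y q))))"
      by (auto simp: \<Psi>_def u_def S_def X_def Y_def)
    also have "\<dots> \<in> borel_measurable borel" by measurable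
    finally show ?thesis unfolding lborel_prod by simp
  qed
  have u_int: "integrable lborel (u s)" "(LINT x|lborel. u s x) = (LINT x|?G. ?k s x * \<psi> x)"
    "(LINT x|lborel. cmod (u s x)) \<le> l2norm ?G (?k s) * l2norm ?G \<psi>" for s
  proof -
    have m: "(\<lambda>x. ?k s x * \<psi> x) \<in> borel_measurable borel" by measurable
    have eq: "u s = (\<lambda>x. exp (- \<nu> * (norm x)\<^sup>2) *\<^sub>R (?k s x * \<psi> x))" by (simp add: u_def g_def fun_eq_iff)
    have i: "integrable ?G (\<lambda>x. ?k s x * \<psi> x)" by (rule sq_int_mult[OF sq_int_Fock_kernel[OF \<nu>(1)] \<psi>])
    show "integrable lborel (u s)" using i unfolding eq integrable_gauss_measure[OF m] .
    show "(LINT x|lborel. u s x) = (LINT x|?G. ?k s x * \<psi> x)" unfolding eq integral_gauss_measure[OF m] ..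
    have m': "(\<lambda>x. cmod (?k s x) * cmod (\<psi> x)) \<in> borel_measurable borel" by measurable
    have "(LINT x|lborel. cmod (u s x)) = (LINT x|?G. cmod (?k s x) * cmod (\<psi> x))"
      unfolding eq integral_gauss_measure[OF m'] by (simp add: norm_mult)
    also have "\<dots> \<le> l2norm ?G (?k s) * l2norm ?G \<psi>"
      by (rule Cauchy_Schwarz_l2norm_abs[OF sq_int_Fock_kernel[OF \<nu>(1)] \<psi>])
    finally show "(LINT x|lborel. cmod (u s x)) \<le> l2norm ?G (?k s) * l2norm ?G \<psi>" .
  qed
  have prod: "integrable lborel (\<lambda>p. u s (fst p) * cnj (u s (snd p)))"
    "(LINT p|lborel. u s (fst p) * cnj (u s (snd p))) = (LINT x|lborel. u s x) * cnj (LINT x|lborel. u s x)" for s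
    using has_bochner_integral_prod_mult[OF sm sm, of "u s" _ "\<lambda>x. cnj (u s x)"] u_int(1)[of s]
    unfolding lborel_prod case_prod_beta by (auto simp: has_bochner_integral_iff)
  have prodn: "(LINT p|lborel. cmod (u s (fst p)) * cmod (u s (snd p))) = (LINT x|lborel. cmod (u s x))\<^sup>2" for s
    using has_bochner_integral_prod_mult[OF sm sm, of "\<lambda>x. cmod (u s x)" _ "\<lambda>x. cmod (u s x)"] u_int(1)[of s]
    unfolding lborel_prod case_prod_beta by (auto simp: has_bochner_integral_iff power2_eq_square)
  have \<Psi>_int: "integrable (lborel \<Otimes>\<^sub>M lborel) (case_prod \<Psi>)"
  proof (rule lborel_pair.Fubini_integrable)
    have "integrable lborel (\<lambda>s::complex \<times> complex. (pi / \<nu> * (l2norm ?G \<psi>)\<^sup>2) *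
        (exp (0 * (cmod (fst s) + cmod (snd s))) * exp (- (\<mu> - \<nu>) * (norm s)\<^sup>2)))"
      using \<nu> by (intro integrable_mult_right integrable_gaussian_pair) auto
    thus "integrable lborel (\<lambda>s. LINT p|lborel. norm (case (s, p) of (s, p) \<Rightarrow> \<Psi> s p))"
    proof (rule Bochner_Integration.integrable_bound)
      show "AE s in lborel. norm (LINT p|lborel. norm (case (s, p) of (s, p) \<Rightarrow> \<Psi> s p)) \<le>
         norm ((pi / \<nu> * (l2norm ?G \<psi>)\<^sup>2) * (exp (0 * (cmod (fst s) + cmod (snd s))) * exp (- (\<mu> - \<nu>) * (norm s)\<^sup>2)))"
      proof (intro AE_I2)
        fix s :: "complex \<times> complex"
        have "(LINT p|lborel. norm (\<Psi> s p)) = exp (- \<mu> * (norm s)\<^sup>2) * (LINT x|lborel. cmod (u s x))\<^sup>2"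
          unfolding \<Psi>_def norm_scaleR norm_mult complex_mod_cnj abs_exp_cancel integral_mult_right_zero prodn ..
        also have "\<dots> \<le> exp (- \<mu> * (norm s)\<^sup>2) * (l2norm ?G (?k s) * l2norm ?G \<psi>)\<^sup>2"
          by (intro mult_left_mono power_mono u_int integral_nonneg_AE) auto
        also have "\<dots> = (pi / \<nu> * (l2norm ?G \<psi>)\<^sup>2) * exp (- (\<mu> - \<nu>) * (norm s)\<^sup>2)"
        proof -
          have "exp (- \<mu> * (norm s)\<^sup>2) * exp (\<nu> * (norm s)\<^sup>2) = exp (- (\<mu> - \<nu>) * (norm s)\<^sup>2)"
            unfolding exp_add[symmetric] by (simp add: algebra_simps)
          thus ?thesis unfolding power_mult_distrib l2norm_Fock_kernel[OF \<nu>(1)]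
            by (simp only: mult_ac)
        qed
        finally have "(LINT p|lborel. norm (\<Psi> s p)) \<le> (pi / \<nu> * (l2norm ?G \<psi>)\<^sup>2) * exp (- (\<mu> - \<nu>) * (norm s)\<^sup>2)" .
        moreover have "(LINT p|lborel. norm (\<Psi> s p)) \<ge> 0" by (rule integral_nonneg_AE) auto
        ultimately show "norm (LINT p|lborel. norm (case (s, p) of (s, p) \<Rightarrow> \<Psi> s p)) \<le>
         norm ((pi / \<nu> * (l2norm ?G \<psi>)\<^sup>2) * (exp (0 * (cmod (fst s) + cmod (snd s))) * exp (- (\<mu> - \<nu>) * (norm s)\<^sup>2)))"
          using \<nu> by simp
      qed
    qed measurable
    show "AE s in lborel. integrable lborel (\<lambda>p. case (s, p) of (s, p) \<Rightarrow> \<Psi> s p)"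
      unfolding \<Psi>_def using prod(1) by simp
  qed measurable
  have D: "\<mu>\<^sup>2 - \<nu>\<^sup>2 > 0" using \<nu> by (simp add: power_strict_mono)
  have \<Psi>F: "(LINT s|lborel. \<Psi> s p) = of_real (pi\<^sup>2 / (\<mu>\<^sup>2 - \<nu>\<^sup>2)) * F p" for p
  proof -
    obtain x y where p: "p = (x, y)" by force
    have "(LINT s|lborel. \<Psi> s p) = (LINT s|lborel. (g x * cnj (g y)) *
         (exp (- \<mu> * (norm s)\<^sup>2) *\<^sub>R (?k s x * cnj (?k s y))))"
      unfolding \<Psi>_def u_def p by (simp add: mult_ac)
    also have "\<dots> = (g x * cnj (g y)) * of_real (pi\<^sup>2 / (\<mu>\<^sup>2 - \<nu>\<^sup>2) *
       exp (\<nu>\<^sup>2 * (((cmod x)\<^sup>2 + (cmod y)\<^sup>2) / (\<mu> + \<nu>) - \<mu> * (cmod (x - y))\<^sup>2 / (\<mu>\<^sup>2 - \<nu>\<^sup>2))))"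
      by (rule has_bochner_integral_integral_eq[OF has_bochner_integral_mult_right[OF Fock_kernel_regularized[OF \<nu>]]])
    also have "\<dots> = (\<psi> x * cnj (\<psi> y)) * of_real (pi\<^sup>2 / (\<mu>\<^sup>2 - \<nu>\<^sup>2)) * of_real (exp (- \<nu> * (cmod x)\<^sup>2) * exp (- \<nu> * (cmod y)\<^sup>2) *
       exp (\<nu>\<^sup>2 * (((cmod x)\<^sup>2 + (cmod y)\<^sup>2) / (\<mu> + \<nu>) - \<mu> * (cmod (x - y))\<^sup>2 / (\<mu>\<^sup>2 - \<nu>\<^sup>2))))"
      unfolding g_def scaleR_conv_of_real of_real_mult complex_cnj_mult complex_cnj_complex_of_real by (simp only: mult_ac)
    also have "exp (- \<nu> * (cmod x)\<^sup>2) * exp (- \<nu> * (cmod y)\<^sup>2) *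
       exp (\<nu>\<^sup>2 * (((cmod x)\<^sup>2 + (cmod y)\<^sup>2) / (\<mu> + \<nu>) - \<mu> * (cmod (x - y))\<^sup>2 / (\<mu>\<^sup>2 - \<nu>\<^sup>2))) =
       exp (- \<delta> * (cmod x)\<^sup>2) * exp (- (\<nu> / 2) * (cmod x)\<^sup>2) * (exp (- \<delta> * (cmod y)\<^sup>2) * exp (- (\<nu> / 2) * (cmod y)\<^sup>2)) *
       exp (- \<tau> * (cmod (x - y))\<^sup>2)"
    proof -
      have 1: "- \<nu> * X + \<nu>\<^sup>2 * (X / (\<mu> + \<nu>)) = - \<delta> * X + - (\<nu> / 2) * X" for X
        using \<nu> by (simp add: \<delta>_def field_simps power2_eq_square)
      have 2: "\<nu>\<^sup>2 * (\<mu> * Z / (\<mu>\<^sup>2 - \<nu>\<^sup>2)) = \<tau> * Z" for Z by (simp add: \<tau>_def)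
      show ?thesis unfolding exp_add[symmetric] using 1[of "(cmod x)\<^sup>2"] 1[of "(cmod y)\<^sup>2"] 2[of "(cmod (x - y))\<^sup>2"]
        by (simp add: add_divide_distrib right_diff_distrib distrib_left)
    qed
    finally show ?thesis unfolding F_def f_def p fst_conv snd_conv of_real_mult complex_cnj_mult complex_cnj_complex_of_real
      by (simp only: mult_ac)
  qed
  have "integrable lborel (\<lambda>p. LINT s|lborel. \<Psi> s p)"
    by (rule lborel_pair.integrable_snd[OF \<Psi>_int])
  hence "integrable lborel (\<lambda>p. of_real ((\<mu>\<^sup>2 - \<nu>\<^sup>2) / pi\<^sup>2) * (of_real (pi\<^sup>2 / (\<mu>\<^sup>2 - \<nu>\<^sup>2)) * F p))"
    unfolding \<Psi>F by (rule integrable_mult_right)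
  moreover have "of_real ((\<mu>\<^sup>2 - \<nu>\<^sup>2) / pi\<^sup>2) * (of_real (pi\<^sup>2 / (\<mu>\<^sup>2 - \<nu>\<^sup>2)) * F p) = F p" for p
  proof -
    have "(\<mu>\<^sup>2 - \<nu>\<^sup>2) / pi\<^sup>2 * (pi\<^sup>2 / (\<mu>\<^sup>2 - \<nu>\<^sup>2)) = 1" using D by simp
    thus ?thesis unfolding mult.assoc[symmetric] of_real_mult[symmetric] by simp
  qed
  ultimately show "integrable lborel F" by simp
  have T: "T_op \<nu> \<psi> s = of_real c * (LINT x|lborel. u s x)" for s
    using T_op_eq[OF sq_int_lebesgue_measurable[OF \<psi>], of \<nu> s] by (simp add: u_int(2) c_def)
  have c2: "c\<^sup>2 * (pi\<^sup>2 / (\<mu>\<^sup>2 - \<nu>\<^sup>2)) = \<nu> / \<mu> * (\<tau> / pi)"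
  proof -
    have "c\<^sup>2 = (\<nu> / pi) ^ 3"
      using \<nu> unfolding c_def by (simp add: powr_powr flip: powr_numeral)
    moreover have "(\<nu> / pi) ^ 3 * pi\<^sup>2 = \<nu> ^ 3 / pi" by (simp add: power_divide power2_eq_square power3_eq_cube)
    ultimately have "c\<^sup>2 * (pi\<^sup>2 / (\<mu>\<^sup>2 - \<nu>\<^sup>2)) = \<nu> ^ 3 / pi / (\<mu>\<^sup>2 - \<nu>\<^sup>2)" by simp
    also have "\<dots> = \<nu> / \<mu> * (\<tau> / pi)"
      using \<nu> by (simp add: \<tau>_def power2_eq_square power3_eq_cube mult_ac)
    finally show ?thesis .
  qed
  have "of_real (LINT s|lborel. exp (- \<mu> * (norm s)\<^sup>2) * (cmod (T_op \<nu> \<psi> s))\<^sup>2) =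
      (LINT s|lborel. of_real (c\<^sup>2) * (LINT p|lborel. \<Psi> s p))"
    unfolding integral_complex_of_real[symmetric]
  proof (rule Bochner_Integration.integral_cong[OF refl])
    fix s
    have "(LINT p|lborel. \<Psi> s p) = of_real (exp (- \<mu> * (norm s)\<^sup>2)) * ((LINT x|lborel. u s x) * cnj (LINT x|lborel. u s x))"
      unfolding \<Psi>_def scaleR_conv_of_real integral_mult_right_zero prod(2) ..
    moreover have "complex_of_real ((cmod (T_op \<nu> \<psi> s))\<^sup>2) = of_real (c\<^sup>2) * ((LINT x|lborel. u s x) * cnj (LINT x|lborel. u s x))"
      unfolding T norm_mult norm_of_real power_mult_distrib power2_abs of_real_mult complex_norm_square[symmetric] ..
    ultimately show "complex_of_real (exp (- \<mu> * (norm s)\<^sup>2) * (cmod (T_op \<nu> \<psi> s))\<^sup>2) = of_real (c\<^sup>2) * (LINT p|lborel. \<Psi> s p)"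
      unfolding of_real_mult by (simp only: mult_ac)
  qed
  also have "\<dots> = of_real (c\<^sup>2) * (LINT s|lborel. LINT p|lborel. \<Psi> s p)" by (rule integral_mult_right_zero)
  also have "(LINT s|lborel. LINT p|lborel. \<Psi> s p) = (LINT p|lborel. LINT s|lborel. \<Psi> s p)"
    using lborel_pair.Fubini_integral[OF \<Psi>_int] by simp
  also have "\<dots> = of_real (pi\<^sup>2 / (\<mu>\<^sup>2 - \<nu>\<^sup>2)) * (LINT p|lborel. F p)" unfolding \<Psi>F by (rule integral_mult_right_zero)
  also have "of_real (c\<^sup>2) * (of_real (pi\<^sup>2 / (\<mu>\<^sup>2 - \<nu>\<^sup>2)) * (LINT p|lborel. F p)) = of_real (\<nu> / \<mu> * (\<tau> / pi)) * (LINT p|lborel. F p)"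
    unfolding c2[symmetric] of_real_mult mult.assoc ..
  finally show "of_real (LINT s|lborel. exp (- \<mu> * (norm s)\<^sup>2) * (cmod (T_op \<nu> \<psi> s))\<^sup>2) =
      of_real (\<nu> / \<mu> * (\<tau> / pi)) * (LINT p|lborel. F p)" .
qed

section \<open>The contraction property\<close>

lemma gaussian_shift_integral:
  fixes x :: complex
  assumes "\<tau> > 0"
  shows "has_bochner_integral lborel (\<lambda>y. exp (- \<tau> * (cmod (x - y))\<^sup>2)) (pi / \<tau>)"
proof -
  have e: "exp (- of_real \<tau> * (x * cnj x)) * exp (- of_real \<tau> * (y * cnj y) + (of_real \<tau> * cnj x) * y + (of_real \<tau> * x) * cnj y)
      = of_real (exp (- \<tau> * (cmod (x - y))\<^sup>2))" for y
    unfolding of_real_gaussian exp_add[symmetric] by (simp add: algebra_simps)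
  have v: "exp (- of_real \<tau> * (x * cnj x)) * (of_real (pi / \<tau>) * exp ((of_real \<tau> * cnj x) * (of_real \<tau> * x) / of_real \<tau>))
      = complex_of_real (pi / \<tau>)"
  proof -
    have "exp (- of_real \<tau> * (x * cnj x)) * exp ((of_real \<tau> * cnj x) * (of_real \<tau> * x) / of_real \<tau>) = 1"
      using assms unfolding exp_add[symmetric] by (simp add: field_simps)
    thus ?thesis by (simp only: mult.left_commute[of "exp _"]) simp
  qed
  have "has_bochner_integral lborel (\<lambda>y. complex_of_real (exp (- \<tau> * (cmod (x - y))\<^sup>2))) (complex_of_real (pi / \<tau>))"
    using has_bochner_integral_mult_right[OF has_bochner_integral_gaussian[OF assms, of "of_real \<tau> * cnj x" "of_real \<tau> * x"],
        of "exp (- of_real \<tau> * (x * cnj x))"] unfolding e v .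
  from has_bochner_integral_Re[OF this] show ?thesis by (simp only: Re_complex_of_real)
qed

text \<open>Schur's test: bound \<open>|f(x)| |f(y)|\<close> by half the sum of the squares and integrate the Gaussian in the
variable that is left free.\<close>

lemma schur_gaussian:
  fixes f :: "complex \<Rightarrow> complex"
  assumes \<tau>: "\<tau> > 0" and [measurable]: "f \<in> borel_measurable borel"
    and f: "integrable lborel (\<lambda>x. (cmod (f x))\<^sup>2)"
  shows "(\<integral>\<^sup>+p. ennreal (cmod (f (fst p)) * cmod (f (snd p)) * exp (- \<tau> * (cmod (fst p - snd p))\<^sup>2)) \<partial>lborel)
    \<le> ennreal (pi / \<tau> * (LINT x|lborel. (cmod (f x))\<^sup>2))"
proof -
  let ?e = "\<lambda>x y :: complex. exp (- \<tau> * (cmod (x - y))\<^sup>2)"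
  let ?I = "LINT x|lborel. (cmod (f x))\<^sup>2"
  have I: "(\<integral>\<^sup>+x. ennreal ((cmod (f x))\<^sup>2) \<partial>lborel) = ennreal ?I"
    using f by (intro nn_integral_eq_integral) auto
  have e: "(\<integral>\<^sup>+y. ennreal (?e x y) \<partial>lborel) = ennreal (pi / \<tau>)" for x
    using gaussian_shift_integral[OF \<tau>, of x] by (subst nn_integral_eq_integral) (auto simp: has_bochner_integral_iff)
  have m [measurable]: "(\<lambda>(x, y). ennreal (1/2 * (cmod (f x))\<^sup>2) * ennreal (?e x y)) \<in> borel_measurable (lborel \<Otimes>\<^sub>M lborel)"
    "(\<lambda>(x, y). ennreal (1/2 * (cmod (f y))\<^sup>2) * ennreal (?e x y)) \<in> borel_measurable (lborel \<Otimes>\<^sub>M lborel)"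
    by measurable
  have half: "(\<integral>\<^sup>+x. ennreal (1/2 * (cmod (f x))\<^sup>2) * ennreal (pi / \<tau>) \<partial>lborel) = ennreal (1/2 * (pi / \<tau>) * ?I)"
  proof -
    have "(\<integral>\<^sup>+x. ennreal (1/2 * (cmod (f x))\<^sup>2) * ennreal (pi / \<tau>) \<partial>lborel)
      = (\<integral>\<^sup>+x. ennreal (1/2 * (pi / \<tau>)) * ennreal ((cmod (f x))\<^sup>2) \<partial>lborel)"
      using \<tau> by (intro nn_integral_cong) (simp add: ennreal_mult[symmetric])
    also have "\<dots> = ennreal (1/2 * (pi / \<tau>)) * ennreal ?I" by (simp add: nn_integral_cmult I)
    finally show ?thesis using \<tau> by (simp add: ennreal_mult[symmetric])
  qed
  have 1: "(\<integral>\<^sup>+p. (case p of (x, y) \<Rightarrow> ennreal (1/2 * (cmod (f x))\<^sup>2) * ennreal (?e x y)) \<partial>(lborel \<Otimes>\<^sub>M lborel)) = ennreal (1/2 * (pi / \<tau>) * ?I)"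
  proof (subst lborel.nn_integral_fst[symmetric])
    have "(\<integral>\<^sup>+y. ennreal (1/2 * (cmod (f x))\<^sup>2) * ennreal (?e x y) \<partial>lborel) = ennreal (1/2 * (cmod (f x))\<^sup>2) * ennreal (pi / \<tau>)" for x
      by (subst nn_integral_cmult) (simp_all only: e, measurable)
    thus "(\<integral>\<^sup>+x. \<integral>\<^sup>+y. (case (x, y) of (x, y) \<Rightarrow> ennreal (1/2 * (cmod (f x))\<^sup>2) * ennreal (?e x y)) \<partial>lborel \<partial>lborel) = ennreal (1/2 * (pi / \<tau>) * ?I)"
      by (simp only: prod.case half)
  qed (rule m)
  have 2: "(\<integral>\<^sup>+p. (case p of (x, y) \<Rightarrow> ennreal (1/2 * (cmod (f y))\<^sup>2) * ennreal (?e x y)) \<partial>(lborel \<Otimes>\<^sub>M lborel)) = ennreal (1/2 * (pi / \<tau>) * ?I)"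
  proof (subst lborel_pair.nn_integral_snd[symmetric])
    have "(\<integral>\<^sup>+x. ennreal (?e x y) \<partial>lborel) = ennreal (pi / \<tau>)" for y
      using e[of y] by (simp only: norm_minus_commute[of y])
    hence "(\<integral>\<^sup>+x. ennreal (1/2 * (cmod (f y))\<^sup>2) * ennreal (?e x y) \<partial>lborel) = ennreal (1/2 * (cmod (f y))\<^sup>2) * ennreal (pi / \<tau>)" for y
      by (subst nn_integral_cmult) (simp_all only:, measurable)
    thus "(\<integral>\<^sup>+y. \<integral>\<^sup>+x. (case (x, y) of (x, y) \<Rightarrow> ennreal (1/2 * (cmod (f y))\<^sup>2) * ennreal (?e x y)) \<partial>lborel \<partial>lborel) = ennreal (1/2 * (pi / \<tau>) * ?I)"
      by (simp only: prod.case half)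
  qed (rule m)
  have "(\<integral>\<^sup>+p. ennreal (cmod (f (fst p)) * cmod (f (snd p)) * ?e (fst p) (snd p)) \<partial>(lborel \<Otimes>\<^sub>M lborel))
    \<le> (\<integral>\<^sup>+p. (case p of (x, y) \<Rightarrow> ennreal (1/2 * (cmod (f x))\<^sup>2) * ennreal (?e x y)) +
          (case p of (x, y) \<Rightarrow> ennreal (1/2 * (cmod (f y))\<^sup>2) * ennreal (?e x y)) \<partial>(lborel \<Otimes>\<^sub>M lborel))"
  proof (rule nn_integral_mono)
    fix p :: "complex \<times> complex"
    obtain x y where p: "p = (x, y)" by force
    have "cmod (f x) * cmod (f y) \<le> 1/2 * (cmod (f x))\<^sup>2 + 1/2 * (cmod (f y))\<^sup>2"
      using zero_le_power2[of "cmod (f x) - cmod (f y)"] by (simp add: power2_eq_square algebra_simps)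
    hence "cmod (f x) * cmod (f y) * ?e x y \<le> (1/2 * (cmod (f x))\<^sup>2 + 1/2 * (cmod (f y))\<^sup>2) * ?e x y"
      by (rule mult_right_mono) simp
    hence "ennreal (cmod (f x) * cmod (f y) * ?e x y) \<le> ennreal (1/2 * (cmod (f x))\<^sup>2 * ?e x y + 1/2 * (cmod (f y))\<^sup>2 * ?e x y)"
      by (intro ennreal_leI) (simp only: distrib_right)
    also have "\<dots> = ennreal (1/2 * (cmod (f x))\<^sup>2) * ennreal (?e x y) + ennreal (1/2 * (cmod (f y))\<^sup>2) * ennreal (?e x y)"
      by (simp only: ennreal_plus ennreal_mult mult_nonneg_nonneg zero_le_power2 exp_ge_zero zero_le_divide_1_iff zero_le_numeral)
    finally show "ennreal (cmod (f (fst p)) * cmod (f (snd p)) * ?e (fst p) (snd p)) \<le> 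
       (case p of (x, y) \<Rightarrow> ennreal (1/2 * (cmod (f x))\<^sup>2) * ennreal (?e x y)) +
          (case p of (x, y) \<Rightarrow> ennreal (1/2 * (cmod (f y))\<^sup>2) * ennreal (?e x y))"
      unfolding p by simp
  qed
  also have "\<dots> = ennreal (1/2 * (pi / \<tau>) * ?I) + ennreal (1/2 * (pi / \<tau>) * ?I)"
    by (subst nn_integral_add[OF m]) (simp only: 1 2)
  also have "\<dots> = ennreal (pi / \<tau> * ?I)"
    using \<tau> by (subst ennreal_plus[symmetric]) auto
  finally show ?thesis unfolding lborel_prod .
qed

lemma gaussian_half_sq: "(cmod (of_real (exp (- (\<nu> / 2) * (cmod x)\<^sup>2)) * w))\<^sup>2 = exp (- \<nu> * (cmod x)\<^sup>2) * (cmod w)\<^sup>2"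
  by (simp add: norm_mult power_mult_distrib power2_eq_square[of "exp _"] exp_add[symmetric])

lemma T_op_regularized_le:
  fixes \<psi> :: "complex \<Rightarrow> complex"
  assumes \<nu>: "0 < \<nu>" "\<nu> < \<mu>" and [measurable]: "\<psi> \<in> borel_measurable borel"
    and \<psi>: "sq_int (gauss_measure \<nu>) \<psi>"
  shows "(LINT s|lborel. exp (- \<mu> * (norm s)\<^sup>2) * (cmod (T_op \<nu> \<psi> s))\<^sup>2) \<le> (l2norm (gauss_measure \<nu>) \<psi>)\<^sup>2"
proof -
  define f where "f = (\<lambda>x. of_real (exp (- (\<nu> / 2) * (cmod x)\<^sup>2)) * \<psi> x)"
  define \<tau> where "\<tau> = \<nu>\<^sup>2 * \<mu> / (\<mu>\<^sup>2 - \<nu>\<^sup>2)"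
  define \<delta> where "\<delta> = \<nu> * (\<mu> - \<nu>) / (2 * (\<mu> + \<nu>))"
  define F where "F = (\<lambda>p. (of_real (exp (- \<delta> * (cmod (fst p))\<^sup>2)) * f (fst p)) *
      cnj (of_real (exp (- \<delta> * (cmod (snd p))\<^sup>2)) * f (snd p)) * of_real (exp (- \<tau> * (cmod (fst p - snd p))\<^sup>2)))"
  have [measurable]: "f \<in> borel_measurable borel" unfolding f_def by measurable
  note reg = T_op_regularized[OF \<nu> assms(3) \<psi> f_def \<tau>_def \<delta>_def F_def]
  have D: "\<mu>\<^sup>2 - \<nu>\<^sup>2 > 0" using \<nu> by (simp add: power_strict_mono)
  have \<tau>: "\<tau> > 0" and \<delta>: "\<delta> \<ge> 0" using \<nu> D by (auto simp: \<tau>_def \<delta>_def)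
  have f2: "integrable lborel (\<lambda>x. (cmod (f x))\<^sup>2)" "(LINT x|lborel. (cmod (f x))\<^sup>2) = (l2norm (gauss_measure \<nu>) \<psi>)\<^sup>2"
    using \<psi> by (simp_all only: sq_int_gauss_borel[OF assms(3)] l2norm_gauss_borel[OF assms(3)] f_def gaussian_half_sq)
  have "ennreal (LINT p|lborel. cmod (F p)) = (\<integral>\<^sup>+p. ennreal (cmod (F p)) \<partial>lborel)"
    using reg(1) by (intro nn_integral_eq_integral[symmetric]) auto
  also have "\<dots> \<le> (\<integral>\<^sup>+p. ennreal (cmod (f (fst p)) * cmod (f (snd p)) * exp (- \<tau> * (cmod (fst p - snd p))\<^sup>2)) \<partial>lborel)"
  proof (intro nn_integral_mono ennreal_leI)
    fix p :: "complex \<times> complex"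
    have "exp (- \<delta> * (cmod (fst p))\<^sup>2) * cmod (f (fst p)) \<le> 1 * cmod (f (fst p))"
      "exp (- \<delta> * (cmod (snd p))\<^sup>2) * cmod (f (snd p)) \<le> 1 * cmod (f (snd p))"
      using \<delta> by (intro mult_right_mono; simp)+
    hence "(exp (- \<delta> * (cmod (fst p))\<^sup>2) * cmod (f (fst p))) * (exp (- \<delta> * (cmod (snd p))\<^sup>2) * cmod (f (snd p))) *
       exp (- \<tau> * (cmod (fst p - snd p))\<^sup>2) \<le> (1 * cmod (f (fst p))) * (1 * cmod (f (snd p))) * exp (- \<tau> * (cmod (fst p - snd p))\<^sup>2)"
      by (intro mult_right_mono mult_mono) (use \<delta> in auto)
    thus "cmod (F p) \<le> cmod (f (fst p)) * cmod (f (snd p)) * exp (- \<tau> * (cmod (fst p - snd p))\<^sup>2)"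
      unfolding F_def norm_mult complex_mod_cnj norm_of_real abs_exp_cancel by (simp only: mult_1_left)
  qed
  also have "\<dots> \<le> ennreal (pi / \<tau> * (l2norm (gauss_measure \<nu>) \<psi>)\<^sup>2)"
    using schur_gaussian[OF \<tau> _ f2(1)] unfolding f2(2) by simp
  finally have le: "(LINT p|lborel. cmod (F p)) \<le> pi / \<tau> * (l2norm (gauss_measure \<nu>) \<psi>)\<^sup>2"
    using \<tau> by (subst (asm) ennreal_le_iff) auto
  have "(LINT s|lborel. exp (- \<mu> * (norm s)\<^sup>2) * (cmod (T_op \<nu> \<psi> s))\<^sup>2)
      \<le> cmod (of_real (LINT s|lborel. exp (- \<mu> * (norm s)\<^sup>2) * (cmod (T_op \<nu> \<psi> s))\<^sup>2))" by simp
  also have "\<dots> = \<nu> / \<mu> * (\<tau> / pi) * cmod (LINT p|lborel. F p)"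
    unfolding reg(2) norm_mult norm_of_real using \<nu> \<tau> by simp
  also have "\<dots> \<le> \<nu> / \<mu> * (\<tau> / pi) * (pi / \<tau> * (l2norm (gauss_measure \<nu>) \<psi>)\<^sup>2)"
    using \<nu> \<tau> by (intro mult_left_mono order_trans[OF integral_norm_bound le]) auto
  also have "\<dots> = \<nu> / \<mu> * (l2norm (gauss_measure \<nu>) \<psi>)\<^sup>2" using \<tau> by simp
  also have "\<dots> \<le> 1 * (l2norm (gauss_measure \<nu>) \<psi>)\<^sup>2" using \<nu> by (intro mult_right_mono) auto
  finally show ?thesis by simp
qed

lemma T_op_regularized_integrable:
  assumes \<nu>: "0 < \<nu>" "\<nu> < \<mu>" and \<psi>: "sq_int (gauss_measure \<nu>) \<psi>"
  shows "integrable lborel (\<lambda>s. exp (- \<mu> * (norm s)\<^sup>2) * (cmod (T_op \<nu> \<psi> s))\<^sup>2)"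
proof -
  note [measurable] = holomorphic2_measurable[OF holomorphic2_T_op[OF \<nu>(1) \<psi>]]
  let ?C = "((\<nu> / pi) powr (3/2))\<^sup>2 * (pi / \<nu> * (l2norm (gauss_measure \<nu>) \<psi>)\<^sup>2)"
  have "integrable lborel (\<lambda>s::complex \<times> complex. ?C * (exp (0 * (cmod (fst s) + cmod (snd s))) * exp (- (\<mu> - \<nu>) * (norm s)\<^sup>2)))"
    using \<nu> by (intro integrable_mult_right integrable_gaussian_pair) auto
  thus ?thesis
  proof (rule Bochner_Integration.integrable_bound)
    show "AE s in lborel. norm (exp (- \<mu> * (norm s)\<^sup>2) * (cmod (T_op \<nu> \<psi> s))\<^sup>2)
        \<le> norm (?C * (exp (0 * (cmod (fst s) + cmod (snd s))) * exp (- (\<mu> - \<nu>) * (norm s)\<^sup>2)))"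
    proof (intro AE_I2)
      fix s
      have "(cmod (T_op \<nu> \<psi> s))\<^sup>2 \<le> ((\<nu> / pi) powr (3/2) * (l2norm (gauss_measure \<nu>) (Fock_kernel \<nu> s) * l2norm (gauss_measure \<nu>) \<psi>))\<^sup>2"
        by (intro power_mono T_op_bound \<nu> \<psi>) auto
      also have "\<dots> = ?C * exp (\<nu> * (norm s)\<^sup>2)"
        unfolding power_mult_distrib l2norm_Fock_kernel[OF \<nu>(1)] by (simp only: mult_ac)
      finally have "exp (- \<mu> * (norm s)\<^sup>2) * (cmod (T_op \<nu> \<psi> s))\<^sup>2 \<le> exp (- \<mu> * (norm s)\<^sup>2) * (?C * exp (\<nu> * (norm s)\<^sup>2))"
        by (rule mult_left_mono) simp
      also have "\<dots> = ?C * (exp (- \<mu> * (norm s)\<^sup>2) * exp (\<nu> * (norm s)\<^sup>2))" by (simp only: mult.left_commute)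
      also have "exp (- \<mu> * (norm s)\<^sup>2) * exp (\<nu> * (norm s)\<^sup>2) = exp (- (\<mu> - \<nu>) * (norm s)\<^sup>2)"
        unfolding exp_add[symmetric] by (simp add: algebra_simps)
      finally show "norm (exp (- \<mu> * (norm s)\<^sup>2) * (cmod (T_op \<nu> \<psi> s))\<^sup>2)
        \<le> norm (?C * (exp (0 * (cmod (fst s) + cmod (snd s))) * exp (- (\<mu> - \<nu>) * (norm s)\<^sup>2)))"
        using \<nu> by (simp add: abs_mult)
    qed
  qed measurable
qed

text \<open>Regularization parameters that decrease to \<open>\<nu>\<close>.\<close>

definition reg_seq :: "real \<Rightarrow> nat \<Rightarrow> real" where
  "reg_seq \<nu> k = \<nu> + \<nu> / real (Suc k)"

lemma reg_seq_gt: "\<nu> > 0 \<Longrightarrow> reg_seq \<nu> k > \<nu>"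
  by (simp add: reg_seq_def)

lemma reg_seq_tendsto: "reg_seq \<nu> \<longlonglongrightarrow> \<nu>"
proof -
  have "(\<lambda>k. \<nu> + \<nu> * inverse (real (Suc k))) \<longlonglongrightarrow> \<nu> + \<nu> * 0"
    by (intro tendsto_intros LIMSEQ_inverse_real_of_nat)
  thus ?thesis unfolding reg_seq_def by (simp add: divide_inverse)
qed

text \<open>The regularized integrals are bounded by the squared norm of \<open>\<psi>\<close> for every \<open>\<mu> > \<nu>\<close>, so Fatou's lemma
yields both square integrability and the bound at \<open>\<mu> = \<nu>\<close>.\<close>

lemma T_op_contraction_borel:
  assumes \<nu>: "0 < \<nu>" and \<psi>b: "\<psi> \<in> borel_measurable borel" and \<psi>: "sq_int (gauss_measure \<nu>) \<psi>"
  shows "sq_int (gauss_measure \<nu>) (T_op \<nu> \<psi>)"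
    and "l2norm (gauss_measure \<nu>) (T_op \<nu> \<psi>) \<le> l2norm (gauss_measure \<nu>) \<psi>"
proof -
  note Tb [measurable] = holomorphic2_measurable[OF holomorphic2_T_op[OF \<nu> \<psi>]]
  let ?N = "(l2norm (gauss_measure \<nu>) \<psi>)\<^sup>2"
  let ?g = "\<lambda>\<mu> s. exp (- \<mu> * (norm s)\<^sup>2) * (cmod (T_op \<nu> \<psi> s))\<^sup>2"
  have gt: "reg_seq \<nu> k > \<nu>" for k using \<nu> by (rule reg_seq_gt)
  have "(\<integral>\<^sup>+s. ennreal (?g \<nu> s) \<partial>lborel) = (\<integral>\<^sup>+s. liminf (\<lambda>k. ennreal (?g (reg_seq \<nu> k) s)) \<partial>lborel)"
  proof (rule nn_integral_cong)
    fix s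
    have "(\<lambda>k. ennreal (?g (reg_seq \<nu> k) s)) \<longlonglongrightarrow> ennreal (?g \<nu> s)"
      by (intro tendsto_intros reg_seq_tendsto)
    thus "ennreal (?g \<nu> s) = liminf (\<lambda>k. ennreal (?g (reg_seq \<nu> k) s))"
      using lim_imp_Liminf[of sequentially] by (metis sequentially_bot)
  qed
  also have "\<dots> \<le> liminf (\<lambda>k. \<integral>\<^sup>+s. ennreal (?g (reg_seq \<nu> k) s) \<partial>lborel)"
    by (rule nn_integral_liminf) measurable
  also have "\<dots> \<le> ennreal ?N"
  proof (rule Liminf_le)
    show "\<forall>\<^sub>F k in sequentially. (\<integral>\<^sup>+s. ennreal (?g (reg_seq \<nu> k) s) \<partial>lborel) \<le> ennreal ?N"
    proof (intro always_eventually allI)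
      fix k
      have "(\<integral>\<^sup>+s. ennreal (?g (reg_seq \<nu> k) s) \<partial>lborel) = ennreal (LINT s|lborel. ?g (reg_seq \<nu> k) s)"
        by (rule nn_integral_eq_integral[OF T_op_regularized_integrable[OF \<nu> gt \<psi>]]) auto
      also have "\<dots> \<le> ennreal ?N" by (intro ennreal_leI T_op_regularized_le[OF \<nu> gt \<psi>b \<psi>])
      finally show "(\<integral>\<^sup>+s. ennreal (?g (reg_seq \<nu> k) s) \<partial>lborel) \<le> ennreal ?N" .
    qed
  qed simp
  finally have bound: "(\<integral>\<^sup>+s. ennreal (?g \<nu> s) \<partial>lborel) \<le> ennreal ?N" .
  have int: "integrable lborel (?g \<nu>)"
    by (rule integrableI_bounded) (use bound in \<open>auto intro: le_less_trans\<close>)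
  thus "sq_int (gauss_measure \<nu>) (T_op \<nu> \<psi>)" by (simp add: sq_int_gauss_borel[OF Tb])
  have "ennreal ((l2norm (gauss_measure \<nu>) (T_op \<nu> \<psi>))\<^sup>2) \<le> ennreal ?N"
    unfolding l2norm_gauss_borel[OF Tb] using bound nn_integral_eq_integral[OF int] by simp
  thus "l2norm (gauss_measure \<nu>) (T_op \<nu> \<psi>) \<le> l2norm (gauss_measure \<nu>) \<psi>"
    using power2_le_imp_le by fastforce
qed

lemma
  assumes \<nu>: "0 < \<nu>" and \<psi>: "sq_int (gauss_measure \<nu>) \<psi>"
  shows sq_int_T_op: "sq_int (gauss_measure \<nu>) (T_op \<nu> \<psi>)"
    and T_op_contraction: "l2norm (gauss_measure \<nu>) (T_op \<nu> \<psi>) \<le> l2norm (gauss_measure \<nu>) \<psi>"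
proof -
  have m: "\<psi> \<in> borel_measurable lebesgue" by (rule sq_int_lebesgue_measurable[OF \<psi>])
  obtain g where g: "g \<in> borel_measurable borel" "AE x in lebesgue. \<psi> x = g x"
    using exists_borel_version[OF m] by blast
  have gl: "g \<in> borel_measurable lebesgue" using g(1) by (simp add: measurable_completion)
  have ae: "AE x in gauss_measure \<nu>. \<psi> x = g x" using g(2) by (simp add: AE_gauss_measure)
  have "sq_int (gauss_measure \<nu>) g"
    by (rule sq_int_cong_AE[OF \<psi> borel_imp_gauss_measurable[OF g(1)] ae])
  note * = T_op_contraction_borel[OF \<nu> g(1) this]
  have T: "T_op \<nu> \<psi> = T_op \<nu> g" by (rule T_op_cong_AE[OF m gl g(2)])
  have n: "l2norm (gauss_measure \<nu>) \<psi> = l2norm (gauss_measure \<nu>) g"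
    by (rule l2norm_cong_AE[OF sq_int_measurable[OF \<psi>] borel_imp_gauss_measurable[OF g(1)] ae])
  show "sq_int (gauss_measure \<nu>) (T_op \<nu> \<psi>)" "l2norm (gauss_measure \<nu>) (T_op \<nu> \<psi>) \<le> l2norm (gauss_measure \<nu>) \<psi>"
    using * unfolding T n by auto
qed

lemma integral_scale_complex:
  fixes g :: "complex \<Rightarrow> complex"
  assumes [measurable]: "g \<in> borel_measurable borel" and "r > 0"
  shows "(LINT y|lborel. g y) = of_real (r\<^sup>2) * (LINT u|lborel. g (x + of_real r * u))"
proof -
  have r: "r \<noteq> 0" using assms by simp
  have "(LINT y|lborel. g y) = (LINT y|density (distr lborel borel (\<lambda>u. x + r *\<^sub>R u)) (\<lambda>_. ennreal (\<bar>r\<bar> ^ DIM(complex))). g y)"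
    using lborel_affine[OF r, of x] by simp
  also have "\<dots> = (LINT u|lborel. \<bar>r\<bar> ^ 2 *\<^sub>R g (x + r *\<^sub>R u))"
    by (subst integral_density) (auto simp: integral_distr)
  also have "\<dots> = of_real (r\<^sup>2) * (LINT u|lborel. g (x + of_real r * u))"
    by (simp add: scaleR_conv_of_real)
  finally show ?thesis .
qed

section \<open>The isometry property\<close>

lemma gaussian_integral_complex:
  "integrable lborel (\<lambda>u::complex. exp (- (cmod u)\<^sup>2))" "(LINT u::complex|lborel. exp (- (cmod u)\<^sup>2)) = pi"
  using gaussian_shift_integral[of 1 0] by (simp_all add: has_bochner_integral_iff)

text \<open>The substitution \<open>y = x + r u\<close> with \<open>\<tau> r\<^sup>2 = 1\<close> turns the concentrating kernel into the fixed weight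
\<open>exp (- |u|\<^sup>2)\<close>. Continuity of \<open>\<psi>\<close> gives the pointwise limit as \<open>r\<close> tends to zero, and boundedness gives
an integrable majorant.\<close>

lemma T_op_isometry_bounded_continuous:
  assumes \<nu>: "0 < \<nu>" and cont: "continuous_on UNIV \<psi>" and M: "\<And>x. cmod (\<psi> x) \<le> M"
  shows "sq_int (gauss_measure \<nu>) \<psi>"
    and "l2norm (gauss_measure \<nu>) (T_op \<nu> \<psi>) = l2norm (gauss_measure \<nu>) \<psi>"
proof -
  have \<psi>b [measurable]: "\<psi> \<in> borel_measurable borel" by (rule borel_measurable_continuous_onI[OF cont])
  have M0: "M \<ge> 0" using M[of 0] norm_ge_zero order_trans by blast
  show \<psi>: "sq_int (gauss_measure \<nu>) \<psi>"
    unfolding sq_int_gauss_borel[OF \<psi>b]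
  proof (rule Bochner_Integration.integrable_bound[OF integrable_mult_right[OF integrable_gaussian_weight[OF \<nu>]]])
    show "AE x in lborel. norm (exp (- \<nu> * (norm x)\<^sup>2) * (cmod (\<psi> x))\<^sup>2) \<le> norm (M\<^sup>2 * exp (- \<nu> * (cmod x)\<^sup>2))"
      using M by (intro AE_I2) (simp add: abs_mult mult.commute mult_left_mono power_mono)
  qed measurable
  define f where "f = (\<lambda>x. of_real (exp (- (\<nu> / 2) * (cmod x)\<^sup>2)) * \<psi> x)"
  define \<mu> where "\<mu> = reg_seq \<nu>"
  define \<tau> where "\<tau> k = \<nu>\<^sup>2 * \<mu> k / ((\<mu> k)\<^sup>2 - \<nu>\<^sup>2)" for k
  define \<delta> where "\<delta> k = \<nu> * (\<mu> k - \<nu>) / (2 * (\<mu> k + \<nu>))" for k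
  define F where "F k = (\<lambda>p. (of_real (exp (- \<delta> k * (cmod (fst p))\<^sup>2)) * f (fst p)) *
      cnj (of_real (exp (- \<delta> k * (cmod (snd p))\<^sup>2)) * f (snd p)) * of_real (exp (- \<tau> k * (cmod (fst p - snd p))\<^sup>2)))" for k
  have \<mu>: "\<mu> k > \<nu>" for k unfolding \<mu>_def by (rule reg_seq_gt[OF \<nu>])
  have \<mu>lim: "\<mu> \<longlonglongrightarrow> \<nu>" unfolding \<mu>_def by (rule reg_seq_tendsto)
  note reg = T_op_regularized[OF \<nu> \<mu> \<psi>b \<psi> f_def \<tau>_def \<delta>_def F_def]
  have D: "(\<mu> k)\<^sup>2 - \<nu>\<^sup>2 > 0" for k using \<nu> \<mu>[of k] by (simp add: power_strict_mono)
  have \<mu>0: "\<mu> k > 0" for k using \<nu> \<mu>[of k] by simp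
  have \<tau>: "\<tau> k > 0" and \<delta>: "\<delta> k \<ge> 0" for k
    using \<nu> D[of k] \<mu>[of k] \<mu>0[of k] by (auto simp: \<tau>_def \<delta>_def)
  define r where "r k = sqrt (((\<mu> k)\<^sup>2 - \<nu>\<^sup>2) / (\<nu>\<^sup>2 * \<mu> k))" for k
  have r0: "r k > 0" for k using \<nu> D[of k] \<mu>0[of k] by (simp add: r_def)
  have \<tau>r: "\<tau> k * (r k)\<^sup>2 = 1" for k
  proof -
    have "(r k)\<^sup>2 = ((\<mu> k)\<^sup>2 - \<nu>\<^sup>2) / (\<nu>\<^sup>2 * \<mu> k)"
      unfolding r_def using D[of k] \<mu>0[of k] by (intro real_sqrt_pow2 divide_nonneg_nonneg) auto
    thus ?thesis using \<nu> D[of k] \<mu>0[of k] \<mu>[of k] by (simp add: \<tau>_def)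
  qed
  have rlim: "r \<longlonglongrightarrow> 0"
  proof -
    have "(\<lambda>k. sqrt (((\<mu> k)\<^sup>2 - \<nu>\<^sup>2) / (\<nu>\<^sup>2 * \<mu> k))) \<longlonglongrightarrow> sqrt ((\<nu>\<^sup>2 - \<nu>\<^sup>2) / (\<nu>\<^sup>2 * \<nu>))"
      using \<nu> by (intro tendsto_intros \<mu>lim) auto
    thus ?thesis by (simp add: r_def[abs_def])
  qed
  have \<delta>lim: "\<delta> \<longlonglongrightarrow> 0"
  proof -
    have "(\<lambda>k. \<nu> * (\<mu> k - \<nu>) / (2 * (\<mu> k + \<nu>))) \<longlonglongrightarrow> \<nu> * (\<nu> - \<nu>) / (2 * (\<nu> + \<nu>))"
      using \<nu> by (intro tendsto_intros \<mu>lim) auto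
    thus ?thesis by (simp add: \<delta>_def[abs_def])
  qed
  have fcont: "continuous_on UNIV f" unfolding f_def by (intro continuous_intros cont)
  have fb [measurable]: "f \<in> borel_measurable borel" by (rule borel_measurable_continuous_onI[OF fcont])
  have fM: "cmod (f x) \<le> M" for x
  proof -
    have "exp (- (\<nu> / 2) * (cmod x)\<^sup>2) * cmod (\<psi> x) \<le> 1 * M"
      using \<nu> M M0 by (intro mult_mono) auto
    thus ?thesis by (simp add: f_def norm_mult)
  qed
  have f_int: "integrable lborel (\<lambda>x. cmod (f x))"
  proof (rule Bochner_Integration.integrable_bound[OF integrable_mult_right[OF integrable_gaussian_weight[of "\<nu> / 2"]]])
    show "AE x in lborel. norm (cmod (f x)) \<le> norm (M * exp (- (\<nu> / 2) * (cmod x)\<^sup>2))"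
      using M M0 by (intro AE_I2) (simp add: f_def norm_mult abs_mult mult.commute mult_left_mono)
  qed (use \<nu> in auto)
  have f2: "integrable lborel (\<lambda>x. (cmod (f x))\<^sup>2)" "(LINT x|lborel. (cmod (f x))\<^sup>2) = (l2norm (gauss_measure \<nu>) \<psi>)\<^sup>2"
    using \<psi> by (simp_all only: sq_int_gauss_borel[OF \<psi>b] l2norm_gauss_borel[OF \<psi>b] f_def gaussian_half_sq)
  define h where "h k x = of_real (exp (- \<delta> k * (cmod x)\<^sup>2)) * f x" for k x
  have hb [measurable]: "h k \<in> borel_measurable borel" for k unfolding h_def[abs_def] by measurable
  have hf: "cmod (h k x) \<le> cmod (f x)" for k x
  proof -
    have "exp (- \<delta> k * (cmod x)\<^sup>2) * cmod (f x) \<le> 1 * cmod (f x)" using \<delta>[of k] by (intro mult_right_mono) auto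
    thus ?thesis by (simp add: h_def norm_mult)
  qed
  have hlim: "(\<lambda>k. h k (x + of_real (r k) * u)) \<longlonglongrightarrow> f x" for x u
  proof -
    have x: "(\<lambda>k. x + of_real (r k) * u) \<longlonglongrightarrow> x + of_real 0 * u" by (intro tendsto_intros rlim)
    have "(\<lambda>k. f (x + of_real (r k) * u)) \<longlonglongrightarrow> f (x + of_real 0 * u)"
      using continuous_on_tendsto_compose[OF fcont x] by simp
    hence "(\<lambda>k. of_real (exp (- \<delta> k * (cmod (x + of_real (r k) * u))\<^sup>2)) * f (x + of_real (r k) * u)) \<longlonglongrightarrow>
        of_real (exp (- 0 * (cmod (x + of_real 0 * u))\<^sup>2)) * f (x + of_real 0 * u)"
      by (intro tendsto_intros \<delta>lim rlim)
    thus ?thesis by (simp add: h_def)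
  qed
  have hlim0: "(\<lambda>k. h k x) \<longlonglongrightarrow> f x" for x using hlim[of x 0] by simp
  \<comment> \<open>The integrand after the substitution, with the Gaussian factor no longer depending on \<open>k\<close>.\<close>
  define J where "J k x u = h k x * cnj (h k (x + of_real (r k) * u)) * of_real (exp (- (cmod u)\<^sup>2))" for k x u
  have Jb [measurable]: "case_prod (J k) \<in> borel_measurable (lborel \<Otimes>\<^sub>M lborel)" for k
    unfolding J_def by measurable
  have Jx [measurable]: "J k x \<in> borel_measurable borel" for k x unfolding J_def[abs_def] by measurable
  have Jle: "cmod (J k x u) \<le> cmod (f x) * M * exp (- (cmod u)\<^sup>2)" for k x u
    unfolding J_def norm_mult complex_mod_cnj norm_of_real abs_exp_cancel
    using M0 hf fM by (intro mult_mono) (auto intro: order_trans)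
  have gM: "integrable lborel (\<lambda>u::complex. c * exp (- (cmod u)\<^sup>2))" for c :: real
    by (intro integrable_mult_right gaussian_integral_complex)
  have Flim: "(\<lambda>k. LINT x|lborel. LINT u|lborel. J k x u) \<longlonglongrightarrow> (LINT x|lborel. of_real ((cmod (f x))\<^sup>2 * pi))"
  proof (rule integral_dominated_convergence[where w = "\<lambda>x. cmod (f x) * (M * pi)"])
    show "AE x in lborel. (\<lambda>k. LINT u|lborel. J k x u) \<longlonglongrightarrow> of_real ((cmod (f x))\<^sup>2 * pi)"
    proof (intro AE_I2)
      fix x
      have "(\<lambda>k. LINT u|lborel. J k x u) \<longlonglongrightarrow> (LINT u|lborel. of_real ((cmod (f x))\<^sup>2) * of_real (exp (- (cmod (u::complex))\<^sup>2)))"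
      proof (rule integral_dominated_convergence[where w = "\<lambda>u. cmod (f x) * M * exp (- (cmod u)\<^sup>2)"])
        show "AE u in lborel. (\<lambda>k. J k x u) \<longlonglongrightarrow> of_real ((cmod (f x))\<^sup>2) * of_real (exp (- (cmod u)\<^sup>2))"
          unfolding complex_norm_square J_def
          by (intro AE_I2 tendsto_intros hlim0 hlim)
      qed (use Jle gM in auto)
      also have "(LINT u|lborel. complex_of_real ((cmod (f x))\<^sup>2) * of_real (exp (- (cmod (u::complex))\<^sup>2))) = of_real ((cmod (f x))\<^sup>2 * pi)"
        unfolding integral_mult_right_zero integral_complex_of_real gaussian_integral_complex by simp
      finally show "(\<lambda>k. LINT u|lborel. J k x u) \<longlonglongrightarrow> of_real ((cmod (f x))\<^sup>2 * pi)" .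
    qed
    show "integrable lborel (\<lambda>x. cmod (f x) * (M * pi))" by (intro integrable_mult_left f_int)
    fix k
    show "AE x in lborel. norm (LINT u|lborel. J k x u) \<le> cmod (f x) * (M * pi)"
    proof (intro AE_I2)
      fix x
      have "norm (LINT u|lborel. J k x u) \<le> (LINT u|lborel. cmod (J k x u))" by (rule integral_norm_bound)
      also have "\<dots> \<le> (LINT u::complex|lborel. cmod (f x) * M * exp (- (cmod u)\<^sup>2))"
        by (rule integral_mono_AE') (use Jle gM M0 in auto)
      also have "\<dots> = cmod (f x) * (M * pi)" unfolding integral_mult_right_zero gaussian_integral_complex by simp
      finally show "norm (LINT u|lborel. J k x u) \<le> cmod (f x) * (M * pi)" .
    qed
  qed measurable
  have FJ: "of_real (\<tau> k) * (LINT p|lborel. F k p) = (LINT x|lborel. LINT u|lborel. J k x u)" for k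
  proof -
    have "(LINT p|lborel. F k p) = (LINT x|lborel. LINT y|lborel. F k (x, y))"
      using lborel_pair.integral_fst'[of "F k"] reg(1)[of k] unfolding lborel_prod by simp
    also have "\<dots> = (LINT x|lborel. of_real ((r k)\<^sup>2) * (LINT u|lborel. J k x u))"
    proof (rule Bochner_Integration.integral_cong[OF refl])
      fix x
      have e: "exp (- \<tau> k * (cmod (x - (x + of_real (r k) * u)))\<^sup>2) = exp (- (cmod u)\<^sup>2)" for u
      proof -
        have "(cmod (x - (x + of_real (r k) * u)))\<^sup>2 = (r k)\<^sup>2 * (cmod u)\<^sup>2" using r0[of k] by (simp add: norm_mult power_mult_distrib)
        hence "\<tau> k * (cmod (x - (x + of_real (r k) * u)))\<^sup>2 = (cmod u)\<^sup>2" using \<tau>r[of k] by (simp add: mult.assoc[symmetric])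
        thus ?thesis by (simp only: mult_minus_left)
      qed
      have m: "(\<lambda>y. h k x * cnj (h k y) * of_real (exp (- \<tau> k * (cmod (x - y))\<^sup>2))) \<in> borel_measurable borel" by measurable
      have "(LINT y|lborel. F k (x, y)) = (LINT y|lborel. h k x * cnj (h k y) * of_real (exp (- \<tau> k * (cmod (x - y))\<^sup>2)))"
        by (simp only: F_def h_def fst_conv snd_conv)
      also have "\<dots> = of_real ((r k)\<^sup>2) * (LINT u|lborel. J k x u)"
        unfolding integral_scale_complex[OF m r0[of k], of x] e J_def ..
      finally show "(LINT y|lborel. F k (x, y)) = of_real ((r k)\<^sup>2) * (LINT u|lborel. J k x u)" .
    qed
    also have "\<dots> = of_real ((r k)\<^sup>2) * (LINT x|lborel. LINT u|lborel. J k x u)" by (rule integral_mult_right_zero)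
    finally have "of_real (\<tau> k) * (LINT p|lborel. F k p) = of_real (\<tau> k * (r k)\<^sup>2) * (LINT x|lborel. LINT u|lborel. J k x u)"
      by simp
    thus ?thesis unfolding \<tau>r by simp
  qed
  let ?g = "\<lambda>\<mu> s. exp (- \<mu> * (norm s)\<^sup>2) * (cmod (T_op \<nu> \<psi> s))\<^sup>2"
  note Tb [measurable] = holomorphic2_measurable[OF holomorphic2_T_op[OF \<nu> \<psi>]]
  have "(\<lambda>k. complex_of_real (\<nu> / \<mu> k / pi) * (LINT x|lborel. LINT u|lborel. J k x u))
      \<longlonglongrightarrow> of_real (\<nu> / \<nu> / pi) * (LINT x|lborel. of_real ((cmod (f x))\<^sup>2 * pi))"
    using \<nu> by (intro tendsto_intros Flim \<mu>lim) auto
  moreover have "complex_of_real (\<nu> / \<mu> k / pi) * (LINT x|lborel. LINT u|lborel. J k x u) = of_real (LINT s|lborel. ?g (\<mu> k) s)" for k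
    unfolding reg(2) FJ[symmetric] by simp
  moreover have "of_real (\<nu> / \<nu> / pi) * (LINT x|lborel. complex_of_real ((cmod (f x))\<^sup>2 * pi)) = of_real ((l2norm (gauss_measure \<nu>) \<psi>)\<^sup>2)"
    unfolding integral_complex_of_real integral_mult_left_zero f2(2) using \<nu> by simp
  ultimately have "(\<lambda>k. complex_of_real (LINT s|lborel. ?g (\<mu> k) s)) \<longlonglongrightarrow> of_real ((l2norm (gauss_measure \<nu>) \<psi>)\<^sup>2)" by simp
  hence 1: "(\<lambda>k. LINT s|lborel. ?g (\<mu> k) s) \<longlonglongrightarrow> (l2norm (gauss_measure \<nu>) \<psi>)\<^sup>2"
    by (simp only: tendsto_of_real_iff)
  have 2: "(\<lambda>k. LINT s|lborel. ?g (\<mu> k) s) \<longlonglongrightarrow> (LINT s|lborel. ?g \<nu> s)"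
  proof (rule integral_dominated_convergence[where w = "?g \<nu>"])
    show "integrable lborel (?g \<nu>)" using sq_int_T_op[OF \<nu> \<psi>] by (simp add: sq_int_gauss_borel[OF Tb])
    show "AE s in lborel. (\<lambda>k. ?g (\<mu> k) s) \<longlonglongrightarrow> ?g \<nu> s"
      by (intro AE_I2 tendsto_intros \<mu>lim)
    fix k
    show "AE s in lborel. norm (?g (\<mu> k) s) \<le> ?g \<nu> s"
      using \<mu>[of k] by (intro AE_I2) (auto intro!: mult_right_mono)
  qed measurable
  have "(l2norm (gauss_measure \<nu>) (T_op \<nu> \<psi>))\<^sup>2 = (l2norm (gauss_measure \<nu>) \<psi>)\<^sup>2"
    unfolding l2norm_gauss_borel[OF Tb] by (rule LIMSEQ_unique[OF 2 1])
  thus "l2norm (gauss_measure \<nu>) (T_op \<nu> \<psi>) = l2norm (gauss_measure \<nu>) \<psi>"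
    by simp
qed

lemma finite_gauss_measure_complex:
  assumes "\<nu> > 0" shows "finite_measure (gauss_measure \<nu> :: complex measure)"
proof (rule finite_measureI)
  have "emeasure (gauss_measure \<nu> :: complex measure) (space (gauss_measure \<nu>)) = (\<integral>\<^sup>+x. ennreal (exp (- \<nu> * (norm (x::complex))\<^sup>2)) \<partial>lebesgue)"
    unfolding gauss_measure_def
    by (subst emeasure_density) (use gaussian_weight_lebesgue_measurable in \<open>auto intro!: measurable_compose[OF _ measurable_ennreal]\<close>)
  also have "\<dots> = (\<integral>\<^sup>+x. ennreal (exp (- \<nu> * (norm (x::complex))\<^sup>2)) \<partial>lborel)" by (rule nn_integral_completion)
  also have "\<dots> < \<infinity>" using integrable_gaussian_weight[OF assms] by (auto simp: integrable_iff_bounded)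
  finally show "emeasure (gauss_measure \<nu> :: complex measure) (space (gauss_measure \<nu>)) \<noteq> \<infinity>" by simp
qed

lemma l2norm_dominated_tendsto:
  assumes w: "integrable M (\<lambda>x. (w x)\<^sup>2)" and "f \<in> borel_measurable M" and "\<And>n. F n \<in> borel_measurable M"
    and lim: "AE x in M. (\<lambda>n. F n x) \<longlonglongrightarrow> f x"
    and bound: "\<And>n. AE x in M. cmod (F n x - f x) \<le> w x"
  shows "(\<lambda>n. l2norm M (\<lambda>x. F n x - f x)) \<longlonglongrightarrow> 0"
proof -
  note [measurable] = assms(2,3)
  have "(\<lambda>n. LINT x|M. (cmod (F n x - f x))\<^sup>2) \<longlonglongrightarrow> (LINT x|M. 0)"
  proof (rule integral_dominated_convergence[OF _ _ w])
    show "AE x in M. (\<lambda>n. (cmod (F n x - f x))\<^sup>2) \<longlonglongrightarrow> 0"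
      using lim
    proof eventually_elim
      case (elim x)
      have "(\<lambda>n. (cmod (F n x - f x))\<^sup>2) \<longlonglongrightarrow> (cmod (f x - f x))\<^sup>2" by (intro tendsto_intros elim)
      thus ?case by simp
    qed
    fix n show "AE x in M. norm ((cmod (F n x - f x))\<^sup>2) \<le> (w x)\<^sup>2"
      using bound[of n] by eventually_elim (simp add: power_mono)
  qed measurable
  hence "(\<lambda>n. sqrt (LINT x|M. (cmod (F n x - f x))\<^sup>2)) \<longlonglongrightarrow> sqrt 0"
    by (intro tendsto_intros) simp
  thus ?thesis by (simp add: l2norm_def)
qed

text \<open>Cut off large values of \<open>\<psi>\<close> first. The bounded function obtained is almost everywhere a limit of
continuous functions, and projecting these to a disc that contains its values keeps the limit and
provides the bound for dominated convergence.\<close>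

lemma bounded_continuous_dense:
  assumes \<nu>: "0 < \<nu>" and \<psi>: "sq_int (gauss_measure \<nu>) (\<psi> :: complex \<Rightarrow> complex)" and e: "e > 0"
  shows "\<exists>g M. continuous_on UNIV g \<and> (\<forall>x. cmod (g x) \<le> M) \<and> l2norm (gauss_measure \<nu>) (\<lambda>x. g x - \<psi> x) < e"
proof -
  let ?G = "gauss_measure \<nu> :: complex measure"
  interpret finite_measure ?G by (rule finite_gauss_measure_complex[OF \<nu>])
  note \<psi>l [measurable] = sq_int_lebesgue_measurable[OF \<psi>]
  note \<psi>m [measurable] = sq_int_measurable[OF \<psi>]
  define F where "F n x = (if cmod (\<psi> x) \<le> real n then \<psi> x else 0)" for n x
  have Fm: "F n \<in> borel_measurable ?G" and Fl: "F n \<in> borel_measurable lebesgue" for n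
    unfolding F_def[abs_def] by measurable
  have "(\<lambda>n. l2norm ?G (\<lambda>x. F n x - \<psi> x)) \<longlonglongrightarrow> 0"
  proof (rule l2norm_dominated_tendsto[where w = "\<lambda>x. cmod (\<psi> x)"])
    show "AE x in ?G. (\<lambda>n. F n x) \<longlonglongrightarrow> \<psi> x"
    proof (intro AE_I2)
      fix x
      obtain N :: nat where "cmod (\<psi> x) \<le> real N" using real_arch_simple by blast
      hence "\<forall>\<^sub>F n in sequentially. F n x = \<psi> x"
        unfolding eventually_sequentially F_def by (intro exI[of _ N]) auto
      thus "(\<lambda>n. F n x) \<longlonglongrightarrow> \<psi> x" by (rule tendsto_eventually)
    qed
  qed (use \<psi>m Fm sq_int_integrable[OF \<psi>] in \<open>auto simp: F_def\<close>)
  hence "\<forall>\<^sub>F n in sequentially. l2norm ?G (\<lambda>x. F n x - \<psi> x) < e / 2"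
    using e by (intro order_tendstoD(2)) auto
  then obtain k where k: "l2norm ?G (\<lambda>x. F k x - \<psi> x) < e / 2"
    using eventually_happens' sequentially_bot by blast
  have "F k measurable_on UNIV"
    using Fl measurable_on_iff_borel_measurable[of UNIV "F k"] by simp
  then obtain N g where N: "negligible N" and g: "\<And>n. continuous_on UNIV (g n)"
    and glim: "\<And>x. x \<notin> N \<Longrightarrow> (\<lambda>n. g n x) \<longlonglongrightarrow> F k x"
    unfolding measurable_on_def by auto
  define h where "h n x = closest_point (cball 0 (real k)) (g n x)" for n x
  have ccont: "continuous_on UNIV (closest_point (cball (0::complex) (real k)))"
    by (intro continuous_on_closest_point) auto
  have hcont: "continuous_on UNIV (h n)" for n
    unfolding h_def using continuous_on_compose2[OF ccont g] by simp
  have hk: "cmod (h n x) \<le> real k" for n x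
    using closest_point_in_set[of "cball (0::complex) (real k)" "g n x"] by (auto simp: h_def)
  have Fk: "cmod (F k x) \<le> real k" for x by (simp add: F_def)
  have hm: "h n \<in> borel_measurable ?G" for n
    using borel_imp_gauss_measurable[OF borel_measurable_continuous_onI[OF hcont]] .
  have "(\<lambda>n. l2norm ?G (\<lambda>x. h n x - F k x)) \<longlonglongrightarrow> 0"
  proof (rule l2norm_dominated_tendsto[where w = "\<lambda>x. 2 * real k", OF _ Fm hm])
    show "integrable ?G (\<lambda>x. (2 * real k)\<^sup>2)" by simp
    have "AE x in lebesgue. x \<notin> N"
      using N by (simp add: negligible_iff_null_sets AE_not_in)
    thus "AE x in ?G. (\<lambda>n. h n x) \<longlonglongrightarrow> F k x"
      unfolding AE_gauss_measure
    proof eventually_elim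
      case (elim x)
      have "(\<lambda>n. h n x) \<longlonglongrightarrow> closest_point (cball 0 (real k)) (F k x)"
        unfolding h_def using continuous_on_tendsto_compose[OF ccont glim[OF elim]] by simp
      thus ?case using Fk[of x] by (simp add: closest_point_self)
    qed
    show "AE x in ?G. cmod (h n x - F k x) \<le> 2 * real k" for n
      using order_trans[OF norm_triangle_ineq4 add_mono[OF hk Fk]] by (intro AE_I2) simp
  qed
  hence "\<forall>\<^sub>F n in sequentially. l2norm ?G (\<lambda>x. h n x - F k x) < e / 2"
    using e by (intro order_tendstoD(2)) auto
  then obtain n where n: "l2norm ?G (\<lambda>x. h n x - F k x) < e / 2"
    using eventually_happens' sequentially_bot by blast
  have F2: "sq_int ?G (F k)" by (rule sq_int_bound[OF \<psi> Fm]) (simp add: F_def)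
  have h2: "sq_int ?G (h n)" by (rule T_op_isometry_bounded_continuous(1)[OF \<nu> hcont hk])
  have "l2norm ?G (\<lambda>x. h n x - \<psi> x) < e"
    using l2norm_diff_triangle[OF h2 F2 \<psi>] k n by linarith
  thus ?thesis using hcont hk by blast
qed

lemma T_op_isometry:
  assumes \<nu>: "0 < \<nu>" and \<psi>: "sq_int (gauss_measure \<nu>) \<psi>"
  shows "l2norm (gauss_measure \<nu>) (T_op \<nu> \<psi>) = l2norm (gauss_measure \<nu>) \<psi>"
proof (rule antisym[OF T_op_contraction[OF \<nu> \<psi>] field_le_epsilon])
  fix e :: real assume "e > 0"
  hence "e / 2 > 0" by simp
  from bounded_continuous_dense[OF \<nu> \<psi> this]
  obtain g M where g: "continuous_on UNIV g" "\<And>x. cmod (g x) \<le> M"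
    and ge: "l2norm (gauss_measure \<nu>) (\<lambda>x. g x - \<psi> x) < e / 2" by blast
  note iso = T_op_isometry_bounded_continuous[OF \<nu> g]
  have "l2norm (gauss_measure \<nu>) (\<lambda>s. T_op \<nu> g s - T_op \<nu> \<psi> s) \<le> l2norm (gauss_measure \<nu>) (\<lambda>x. g x - \<psi> x)"
    using T_op_contraction[OF \<nu> sq_int_diff[OF iso(1) \<psi>]] by (simp add: T_op_diff[OF \<nu> iso(1) \<psi>])
  moreover have "l2norm (gauss_measure \<nu>) (T_op \<nu> g) - l2norm (gauss_measure \<nu>) (T_op \<nu> \<psi>)
      \<le> l2norm (gauss_measure \<nu>) (\<lambda>s. T_op \<nu> g s - T_op \<nu> \<psi> s)"
    using l2norm_reverse_triangle[OF sq_int_T_op[OF \<nu> iso(1)] sq_int_T_op[OF \<nu> \<psi>]] by linarith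
  moreover have "l2norm (gauss_measure \<nu>) \<psi> - l2norm (gauss_measure \<nu>) g \<le> l2norm (gauss_measure \<nu>) (\<lambda>x. g x - \<psi> x)"
    using l2norm_reverse_triangle[OF iso(1) \<psi>] by linarith
  ultimately show "l2norm (gauss_measure \<nu>) \<psi> \<le> l2norm (gauss_measure \<nu>) (T_op \<nu> \<psi>) + e"
    using ge iso(2) by linarith
qed

section \<open>The reproducing property of the Fock space\<close>

lemma nn_integral_lborel_shift:
  fixes f :: "'a::euclidean_space \<Rightarrow> ennreal"
  assumes [measurable]: "f \<in> borel_measurable borel"
  shows "(\<integral>\<^sup>+x. f (x + a) \<partial>lborel) = (\<integral>\<^sup>+x. f x \<partial>lborel)"
proof -
  have "(\<integral>\<^sup>+x. f x \<partial>lborel) = (\<integral>\<^sup>+x. f x \<partial>distr lborel borel ((+) a))"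
    by (simp add: lborel_distr_plus)
  also have "\<dots> = (\<integral>\<^sup>+x. f (x + a) \<partial>lborel)"
    by (subst nn_integral_distr) (auto simp: add.commute)
  finally show ?thesis ..
qed

lemma has_bochner_integral_lborel_shift:
  fixes f :: "'a::euclidean_space \<Rightarrow> 'b::{banach, second_countable_topology}"
  assumes f: "has_bochner_integral lborel f I"
  shows "has_bochner_integral lborel (\<lambda>x. f (x + a)) I"
proof -
  have [measurable]: "f \<in> borel_measurable borel" using f by (auto simp: has_bochner_integral_iff)
  have "has_bochner_integral (distr lborel borel ((+) a)) f I"
    using f by (simp add: lborel_distr_plus)
  thus ?thesis by (simp add: has_bochner_integral_iff integrable_distr_eq integral_distr add.commute)
qed

text \<open>The argument behind the uniqueness of Haar measure: translation invariance and Tonelli's theorem move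
\<open>U\<close> from \<open>f\<close> to the indicator of the unit ball, which \<open>U\<close> leaves unchanged.\<close>

lemma nn_integral_isometry_times_ball:
  fixes f :: "'a::euclidean_space \<Rightarrow> ennreal" and U V :: "'a \<Rightarrow> 'a"
  assumes [measurable]: "f \<in> borel_measurable borel"
    and U: "linear U" "\<And>x. norm (U x) = norm x" "\<And>x. U (V x) = x"
  shows "(\<integral>\<^sup>+x. f (U x) \<partial>lborel) * emeasure lborel (ball (0::'a) 1)
       = emeasure lborel (ball (0::'a) 1) * (\<integral>\<^sup>+x. f (- x) \<partial>lborel)"
proof -
  define g where "g = (indicator (ball (0::'a) 1) :: 'a \<Rightarrow> ennreal)"
  have [measurable]: "g \<in> borel_measurable borel" by (simp add: g_def borel_measurable_indicator)
  have g_int: "(\<integral>\<^sup>+x. g x \<partial>lborel) = emeasure lborel (ball (0::'a) 1)" by (simp add: g_def)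
  have [measurable]: "U \<in> borel_measurable borel"
    by (rule borel_measurable_continuous_onI[OF linear_continuous_on[OF U(1)[unfolded linear_conv_bounded_linear]]])
  have "(\<integral>\<^sup>+x. f (U x) \<partial>lborel) * emeasure lborel (ball (0::'a) 1) = (\<integral>\<^sup>+x. f (U x) * emeasure lborel (ball (0::'a) 1) \<partial>lborel)"
    by (rule nn_integral_multc[symmetric]) measurable
  also have "\<dots> = (\<integral>\<^sup>+x. \<integral>\<^sup>+y. f (U x) * g y \<partial>lborel \<partial>lborel)"
    by (intro nn_integral_cong) (simp add: nn_integral_cmult g_int)
  also have "\<dots> = (\<integral>\<^sup>+x. \<integral>\<^sup>+y. f (U x) * g (y + U x) \<partial>lborel \<partial>lborel)"
  proof (rule nn_integral_cong)
    fix x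
    show "(\<integral>\<^sup>+y. f (U x) * g y \<partial>lborel) = (\<integral>\<^sup>+y. f (U x) * g (y + U x) \<partial>lborel)"
      by (rule nn_integral_lborel_shift[of "\<lambda>y. f (U x) * g y", symmetric]) measurable
  qed
  also have "\<dots> = (\<integral>\<^sup>+y. \<integral>\<^sup>+x. f (U x) * g (y + U x) \<partial>lborel \<partial>lborel)"
    by (rule lborel_pair.Fubini'[symmetric]) measurable
  also have "\<dots> = (\<integral>\<^sup>+y. \<integral>\<^sup>+x. f (U x - y) * g (U x) \<partial>lborel \<partial>lborel)"
  proof (rule nn_integral_cong)
    fix y
    have "(\<integral>\<^sup>+x. f (U x) * g (y + U x) \<partial>lborel) = (\<integral>\<^sup>+x. f (U (x + - V y)) * g (y + U (x + - V y)) \<partial>lborel)"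
      by (rule nn_integral_lborel_shift[symmetric]) measurable
    thus "(\<integral>\<^sup>+x. f (U x) * g (y + U x) \<partial>lborel) = (\<integral>\<^sup>+x. f (U x - y) * g (U x) \<partial>lborel)"
      by (simp add: linear_diff[OF U(1)] U(3))
  qed
  also have "\<dots> = (\<integral>\<^sup>+x. \<integral>\<^sup>+y. f (U x - y) * g (U x) \<partial>lborel \<partial>lborel)"
    by (rule lborel_pair.Fubini') measurable
  also have "\<dots> = (\<integral>\<^sup>+x. g x * (\<integral>\<^sup>+y. f (- y) \<partial>lborel) \<partial>lborel)"
  proof (rule nn_integral_cong)
    fix x
    have "(\<integral>\<^sup>+y. f (U x - y) \<partial>lborel) = (\<integral>\<^sup>+y. f (U x - (y + U x)) \<partial>lborel)"
      by (rule nn_integral_lborel_shift[symmetric]) measurable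
    moreover have "g (U x) = g x" using U(2)[of x] by (simp add: g_def indicator_def)
    ultimately show "(\<integral>\<^sup>+y. f (U x - y) * g (U x) \<partial>lborel) = g x * (\<integral>\<^sup>+y. f (- y) \<partial>lborel)"
      by (subst nn_integral_multc) (simp_all add: mult.commute)
  qed
  also have "\<dots> = emeasure lborel (ball (0::'a) 1) * (\<integral>\<^sup>+y. f (- y) \<partial>lborel)"
    by (simp add: nn_integral_multc g_int)
  finally show ?thesis .
qed

text \<open>The previous lemma for \<open>U\<close> and for the identity has the same right-hand side.\<close>

lemma nn_integral_lborel_isometry:
  fixes f :: "'a::euclidean_space \<Rightarrow> ennreal" and U V :: "'a \<Rightarrow> 'a"
  assumes f [measurable]: "f \<in> borel_measurable borel"
    and U: "linear U" "\<And>x. norm (U x) = norm x" "\<And>x. U (V x) = x"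
  shows "(\<integral>\<^sup>+x. f (U x) \<partial>lborel) = (\<integral>\<^sup>+x. f x \<partial>lborel)"
proof -
  let ?m = "emeasure lborel (ball (0::'a) 1)"
  have "?m \<noteq> 0"
  proof -
    have "\<not> negligible (ball (0::'a) 1)" by (rule open_not_negligible) auto
    thus ?thesis by (auto simp: negligible_iff_null_sets null_sets_def)
  qed
  moreover have "?m \<noteq> \<infinity>" using emeasure_bounded_finite[of "ball (0::'a) 1"] by simp
  moreover have "(\<integral>\<^sup>+x. f (U x) \<partial>lborel) * ?m = (\<integral>\<^sup>+x. f x \<partial>lborel) * ?m"
    using nn_integral_isometry_times_ball[OF f U] nn_integral_isometry_times_ball[OF f, of "\<lambda>x. x" "\<lambda>x. x"]
    by (simp add: linear_id[unfolded id_def])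
  ultimately show ?thesis by (metis ennreal_mult_divide_eq infinity_ennreal_def)
qed

lemma distr_lborel_isometry:
  fixes U :: "'a::euclidean_space \<Rightarrow> 'a"
  assumes U: "linear U" "\<And>x. norm (U x) = norm x" "\<And>x. U (V x) = x"
  shows "distr lborel borel U = lborel"
proof (rule measure_eqI)
  have m [measurable]: "U \<in> borel_measurable borel"
    by (rule borel_measurable_continuous_onI[OF linear_continuous_on[OF U(1)[unfolded linear_conv_bounded_linear]]])
  fix A assume "A \<in> sets (distr lborel borel U)"
  hence A [measurable]: "A \<in> sets borel" by simp
  have "emeasure (distr lborel borel U) A = (\<integral>\<^sup>+x. indicator A x \<partial>distr lborel borel U)" by simp
  also have "\<dots> = (\<integral>\<^sup>+x. indicator A (U x) \<partial>lborel)" by (rule nn_integral_distr) measurable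
  also have "\<dots> = (\<integral>\<^sup>+x. indicator A x \<partial>lborel)" by (rule nn_integral_lborel_isometry[OF _ U]) measurable
  finally show "emeasure (distr lborel borel U) A = emeasure lborel A" by simp
qed simp

lemma circle_mean_value:
  assumes g: "g holomorphic_on UNIV"
  shows "(LINT \<theta>:{0..1}|lborel. g (exp (2 * of_real pi * \<i> * of_real \<theta>))) = g 0"
proof -
  let ?e = "\<lambda>\<theta>::real. exp (2 * of_real pi * \<i> * of_real \<theta>)"
  have gc: "continuous_on UNIV g" by (rule holomorphic_on_imp_continuous_on[OF g])
  have "((\<lambda>u. g u / (u - 0)) has_contour_integral (2 * of_real pi * \<i> * g 0)) (circlepath 0 1)"
    by (rule Cauchy_integral_circlepath_simple) (auto intro: holomorphic_on_subset[OF g])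
  hence "((\<lambda>\<theta>. g (circlepath 0 1 \<theta>) / (circlepath 0 1 \<theta> - 0) * vector_derivative (circlepath 0 1) (at \<theta> within {0..1}))
     has_integral (2 * of_real pi * \<i> * g 0)) {0..1}"
    by (simp add: has_contour_integral_def)
  hence main: "((\<lambda>\<theta>. (2 * of_real pi * \<i>) * g (?e \<theta>)) has_integral (2 * of_real pi * \<i> * g 0)) {0..1}"
  proof (rule has_integral_eq[rotated])
    fix \<theta> :: real assume \<theta>: "\<theta> \<in> {0..1}"
    have 1: "vector_derivative (circlepath 0 1) (at \<theta> within {0..1}) = 2 * of_real pi * \<i> * ?e \<theta>"
      using \<theta> by (subst vector_derivative_circlepath01) auto
    have 2: "circlepath 0 1 \<theta> = ?e \<theta>" by (simp add: circlepath)
    show "g (circlepath 0 1 \<theta>) / (circlepath 0 1 \<theta> - 0) * vector_derivative (circlepath 0 1) (at \<theta> within {0..1})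
        = (2 * of_real pi * \<i>) * g (?e \<theta>)"
      unfolding 1 unfolding 2 by simp
  qed
  have two_pi_i_nz: "2 * of_real pi * \<i> \<noteq> (0::complex)" by simp
  from main have "((\<lambda>\<theta>. inverse (2 * of_real pi * \<i>) * ((2 * of_real pi * \<i>) * g (?e \<theta>))) has_integral
      inverse (2 * of_real pi * \<i>) * (2 * of_real pi * \<i> * g 0)) {0..1}"
    by (rule has_integral_mult_right)
  moreover have cancel: "inverse c * (c * X) = X" if "c \<noteq> 0" for c X :: complex
    using that by simp
  ultimately have h: "((\<lambda>\<theta>. g (?e \<theta>)) has_integral g 0) {0..1}"
    by (simp only: cancel[OF two_pi_i_nz])
  have "continuous_on {0..1} (\<lambda>\<theta>. g (?e \<theta>))"
    by (intro continuous_on_compose2[OF gc] continuous_intros) auto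
  hence "set_integrable lborel {0..1} (\<lambda>\<theta>. g (?e \<theta>))" by (rule borel_integrable_atLeastAtMost')
  thus ?thesis using set_borel_integral_eq_integral(2) integral_unique[OF h] by metis
qed

lemma holomorphic2_on_line:
  assumes "holomorphic2 F"
  shows "(\<lambda>\<zeta>. F (\<zeta> * fst s, \<zeta> * snd s)) holomorphic_on UNIV"
proof -
  have "\<exists>D. ((\<lambda>\<zeta>. F (\<zeta> * fst s, \<zeta> * snd s)) has_field_derivative D) (at \<zeta>)" for \<zeta>
  proof -
    obtain a b where ab: "(F has_derivative (\<lambda>h. a * fst h + b * snd h)) (at (\<zeta> * fst s, \<zeta> * snd s))"
      using assms unfolding holomorphic2_def by blast
    have "((\<lambda>\<zeta>. (\<zeta> * fst s, \<zeta> * snd s)) has_derivative (\<lambda>h. (h * fst s, h * snd s))) (at \<zeta>)"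
      by (intro has_derivative_Pair has_derivative_mult_left has_derivative_ident)
    from has_derivative_compose[OF this ab]
    have "((\<lambda>\<zeta>. F (\<zeta> * fst s, \<zeta> * snd s)) has_derivative (\<lambda>h. (a * fst s + b * snd s) * h)) (at \<zeta>)"
      by (rule has_derivative_eq_rhs) (simp add: fun_eq_iff algebra_simps)
    thus ?thesis unfolding has_field_derivative_def by blast
  qed
  thus ?thesis by (auto simp: holomorphic_on_def field_differentiable_def)
qed

lemma integral_gaussian_pair:
  assumes "\<nu> > 0"
  shows "integrable lborel (\<lambda>s::complex \<times> complex. exp (- \<nu> * (norm s)\<^sup>2))"
    and "(LINT s|lborel. exp (- \<nu> * (norm (s :: complex \<times> complex))\<^sup>2)) = (pi / \<nu>)\<^sup>2"
proof -
  have "has_bochner_integral lborel (\<lambda>z::complex. exp (- \<nu> * (cmod z)\<^sup>2)) (pi / \<nu>)"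
    using gaussian_shift_integral[OF assms, of 0] by simp
  from has_bochner_integral_prod_mult[OF _ _ this this]
  have "has_bochner_integral lborel (\<lambda>(z::complex, w::complex). exp (- \<nu> * (cmod z)\<^sup>2) * exp (- \<nu> * (cmod w)\<^sup>2)) (pi / \<nu> * (pi / \<nu>))"
    unfolding lborel_prod by (simp add: lborel.sigma_finite_measure_axioms)
  moreover have "(\<lambda>(z::complex, w::complex). exp (- \<nu> * (cmod z)\<^sup>2) * exp (- \<nu> * (cmod w)\<^sup>2)) = (\<lambda>s. exp (- \<nu> * (norm s)\<^sup>2))"
    unfolding norm_pair_sq by (auto simp: fun_eq_iff exp_add[symmetric] algebra_simps)
  ultimately show "integrable lborel (\<lambda>s::complex \<times> complex. exp (- \<nu> * (norm s)\<^sup>2))"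
    "(LINT s|lborel. exp (- \<nu> * (norm (s :: complex \<times> complex))\<^sup>2)) = (pi / \<nu>)\<^sup>2"
    by (simp_all add: has_bochner_integral_iff power2_eq_square)
qed

text \<open>The rotations \<open>(z, w) \<mapsto> (exp (2 pi \<i> \<theta>) z, exp (2 pi \<i> \<theta>) w)\<close> preserve measure and weight.
Averaging over \<open>\<theta>\<close> replaces \<open>F\<close> by its mean over a circle in a complex line through the origin, and
that mean is \<open>F 0\<close>.\<close>

lemma gaussian_mean_value:
  assumes \<nu>: "\<nu> > 0" and F: "holomorphic2 F"
    and int: "integrable lborel (\<lambda>s. exp (- \<nu> * (norm s)\<^sup>2) *\<^sub>R F s)"
  shows "(LINT s|lborel. exp (- \<nu> * (norm s)\<^sup>2) *\<^sub>R F s) = of_real ((pi / \<nu>)\<^sup>2) * F 0"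
proof -
  define I where "I = (LINT s|lborel. exp (- \<nu> * (norm s)\<^sup>2) *\<^sub>R F s)"
  have Fc: "continuous_on UNIV F" by (rule holomorphic2_continuous[OF F])
  have Fb [measurable]: "F \<in> borel_measurable borel" by (rule holomorphic2_measurable[OF F])
  define U where "U \<theta> s = (exp (2 * of_real pi * \<i> * of_real \<theta>) * fst s, exp (2 * of_real pi * \<i> * of_real \<theta>) * snd s)"
    for \<theta> :: real and s :: "complex \<times> complex"
  have nU: "norm (U \<theta> s) = norm s" for \<theta> s
    by (simp add: U_def norm_prod_def norm_mult)
  have lU: "linear (U \<theta>)" for \<theta>
    unfolding U_def by (auto intro!: linearI simp: distrib_left)
  have UV: "U \<theta> (U (- \<theta>) s) = s" for \<theta> s
    by (simp add: U_def mult.assoc[symmetric] exp_add[symmetric])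
  have Um [measurable]: "U \<theta> \<in> borel_measurable borel" for \<theta>
    by (rule borel_measurable_continuous_onI[OF linear_continuous_on[OF lU[unfolded linear_conv_bounded_linear]]])
  have dU: "distr lborel borel (U \<theta>) = lborel" for \<theta>
    by (rule distr_lborel_isometry[OF lU nU UV])
  have rot: "integrable lborel (\<lambda>s. exp (- \<nu> * (norm s)\<^sup>2) *\<^sub>R F (U \<theta> s))"
    "(LINT s|lborel. exp (- \<nu> * (norm s)\<^sup>2) *\<^sub>R F (U \<theta> s)) = I"
    "(LINT s|lborel. exp (- \<nu> * (norm s)\<^sup>2) * cmod (F (U \<theta> s))) = (LINT s|lborel. exp (- \<nu> * (norm s)\<^sup>2) * cmod (F s))" for \<theta>
  proof -
    have "integrable (distr lborel borel (U \<theta>)) (\<lambda>s. exp (- \<nu> * (norm s)\<^sup>2) *\<^sub>R F s)"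
      using int unfolding dU .
    thus "integrable lborel (\<lambda>s. exp (- \<nu> * (norm s)\<^sup>2) *\<^sub>R F (U \<theta> s))"
      by (subst (asm) integrable_distr_eq) (auto simp: nU)
    have "I = (LINT s|distr lborel borel (U \<theta>). exp (- \<nu> * (norm s)\<^sup>2) *\<^sub>R F s)" unfolding dU I_def ..
    thus "(LINT s|lborel. exp (- \<nu> * (norm s)\<^sup>2) *\<^sub>R F (U \<theta> s)) = I"
      by (subst (asm) integral_distr) (auto simp: nU)
    have "(LINT s|lborel. exp (- \<nu> * (norm s)\<^sup>2) * cmod (F s)) = (LINT s|distr lborel borel (U \<theta>). exp (- \<nu> * (norm s)\<^sup>2) * cmod (F s))" unfolding dU ..
    thus "(LINT s|lborel. exp (- \<nu> * (norm s)\<^sup>2) * cmod (F (U \<theta> s))) = (LINT s|lborel. exp (- \<nu> * (norm s)\<^sup>2) * cmod (F s))"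
      by (subst (asm) integral_distr) (auto simp: nU)
  qed
  define \<Psi> where "\<Psi> \<theta> s = indicator {0..1::real} \<theta> *\<^sub>R (exp (- \<nu> * (norm s)\<^sup>2) *\<^sub>R F (U \<theta> s))" for \<theta> s
  have [measurable]: "case_prod \<Psi> \<in> borel_measurable (lborel \<Otimes>\<^sub>M lborel)"
  proof -
    have FU: "(\<lambda>q. F (U (fst q) (snd q))) \<in> borel_measurable borel"
      unfolding U_def by (intro borel_measurable_continuous_onI continuous_on_compose2[OF Fc] continuous_intros) auto
    have ind: "(\<lambda>q. indicator {0..1::real} (fst q) :: real) \<in> borel_measurable (borel :: (real \<times> complex \<times> complex) measure)"
      by (rule measurable_compose[OF borel_measurable_continuous_onI[OF continuous_on_fst[OF continuous_on_id]]
            borel_measurable_indicator]) simp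
    have w: "(\<lambda>q. exp (- \<nu> * (norm (snd q))\<^sup>2)) \<in> borel_measurable (borel :: (real \<times> complex \<times> complex) measure)"
      by (intro borel_measurable_continuous_onI continuous_intros)
    have "case_prod \<Psi> = (\<lambda>q. indicator {0..1::real} (fst q) *\<^sub>R (exp (- \<nu> * (norm (snd q))\<^sup>2) *\<^sub>R F (U (fst q) (snd q))))"
      by (auto simp: \<Psi>_def)
    also have "\<dots> \<in> borel_measurable borel"
      by (rule borel_measurable_scaleR[OF ind borel_measurable_scaleR[OF w FU]])
    finally show ?thesis unfolding lborel_prod by simp
  qed
  have i01: "integrable lborel (\<lambda>\<theta>. indicator {0..1::real} \<theta> * c)" "(LINT \<theta>|lborel. indicator {0..1::real} \<theta> * c) = c" for c :: real
    by simp_all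
  have \<Psi>int: "integrable (lborel \<Otimes>\<^sub>M lborel) (case_prod \<Psi>)"
  proof (rule lborel_pair.Fubini_integrable)
    have "(LINT s|lborel. norm (\<Psi> \<theta> s)) = indicator {0..1::real} \<theta> * (LINT s|lborel. exp (- \<nu> * (norm s)\<^sup>2) * cmod (F s))" for \<theta>
      unfolding \<Psi>_def norm_scaleR abs_exp_cancel integral_mult_right_zero rot(3) by simp
    thus "integrable lborel (\<lambda>\<theta>. LINT s|lborel. norm (case (\<theta>, s) of (\<theta>, s) \<Rightarrow> \<Psi> \<theta> s))"
      using i01(1) by (simp only: prod.case)
    show "AE \<theta> in lborel. integrable lborel (\<lambda>s. case (\<theta>, s) of (\<theta>, s) \<Rightarrow> \<Psi> \<theta> s)"
      unfolding \<Psi>_def prod.case by (intro AE_I2 integrable_scaleR_right rot(1))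
  qed measurable
  have 1: "(LINT s|lborel. \<Psi> \<theta> s) = indicator {0..1} \<theta> *\<^sub>R I" for \<theta>
    unfolding \<Psi>_def integral_scaleR_right rot(2) ..
  have 2: "(LINT \<theta>|lborel. \<Psi> \<theta> s) = exp (- \<nu> * (norm s)\<^sup>2) *\<^sub>R F 0" for s
  proof -
    have "(LINT \<theta>|lborel. \<Psi> \<theta> s) = exp (- \<nu> * (norm s)\<^sup>2) *\<^sub>R (LINT \<theta>:{0..1}|lborel. F (U \<theta> s))"
      unfolding \<Psi>_def set_lebesgue_integral_def scaleR_left_commute[of "indicator _ _"] integral_scaleR_right ..
    also have "(LINT \<theta>:{0..1}|lborel. F (U \<theta> s)) = F 0"
      using circle_mean_value[OF holomorphic2_on_line[OF F, of s]] by (simp add: U_def zero_prod_def)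
    finally show ?thesis .
  qed
  have "I = (LINT \<theta>|lborel. LINT s|lborel. \<Psi> \<theta> s)"
    unfolding 1 by simp
  also have "\<dots> = (LINT s|lborel. LINT \<theta>|lborel. \<Psi> \<theta> s)"
    using lborel_pair.Fubini_integral[OF \<Psi>int] by simp
  also have "\<dots> = (LINT s|lborel. exp (- \<nu> * (norm (s :: complex \<times> complex))\<^sup>2)) *\<^sub>R F 0"
    unfolding 2 by (rule integral_scaleR_left) (use integral_gaussian_pair(1)[OF \<nu>] in simp)
  finally show ?thesis unfolding integral_gaussian_pair(2)[OF \<nu>] scaleR_conv_of_real I_def .
qed

text \<open>The Hermitian inner product on \<open>\<complex>\<^sup>2\<close>.\<close>

definition hprod :: "complex \<times> complex \<Rightarrow> complex \<times> complex \<Rightarrow> complex" where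
  "hprod s t = fst s * cnj (fst t) + snd s * cnj (snd t)"

lemma hprod_self: "hprod s s = of_real ((norm s)\<^sup>2)"
  unfolding norm_pair_sq of_real_add complex_norm_square hprod_def ..

lemma norm_hprod_le: "cmod (hprod s t) \<le> norm s * (cmod (fst t) + cmod (snd t))"
proof -
  have "cmod (hprod s t) \<le> cmod (fst s) * cmod (fst t) + cmod (snd s) * cmod (snd t)"
    unfolding hprod_def by (rule order_trans[OF norm_triangle_ineq]) (simp add: norm_mult)
  also have "\<dots> \<le> norm s * cmod (fst t) + norm s * cmod (snd t)"
    using norm_fst_le[of "fst s" "snd s"] norm_snd_le[of "snd s" "fst s"] by (intro add_mono mult_right_mono) auto
  finally show ?thesis by (simp add: distrib_left)
qed

lemma sq_int_exp_hprod:
  assumes "\<nu> > 0" shows "sq_int (gauss_measure \<nu>) (\<lambda>t. exp (of_real \<nu> * hprod s t))"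
proof -
  have m [measurable]: "(\<lambda>t. exp (of_real \<nu> * hprod s t)) \<in> borel_measurable borel"
    unfolding hprod_def by (intro borel_measurable_continuous_onI continuous_intros)
  show ?thesis unfolding sq_int_gauss_borel[OF m]
  proof (rule Bochner_Integration.integrable_bound[OF integrable_gaussian_pair[OF assms, of "2 * (\<nu> * norm s)"]])
    show "AE t in lborel. norm (exp (- \<nu> * (norm t)\<^sup>2) * (cmod (exp (of_real \<nu> * hprod s t)))\<^sup>2)
        \<le> norm (exp (2 * (\<nu> * norm s) * (cmod (fst t) + cmod (snd t))) * exp (- \<nu> * (norm t)\<^sup>2))"
    proof (intro AE_I2)
      fix t
      have "cmod (exp (of_real \<nu> * hprod s t)) \<le> exp (cmod (of_real \<nu> * hprod s t))" by (rule norm_exp)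
      also have "\<dots> \<le> exp (\<nu> * (norm s * (cmod (fst t) + cmod (snd t))))"
        using assms norm_hprod_le[of s t] by (simp add: norm_mult)
      finally have "(cmod (exp (of_real \<nu> * hprod s t)))\<^sup>2 \<le> (exp (\<nu> * (norm s * (cmod (fst t) + cmod (snd t)))))\<^sup>2"
        by (intro power_mono) auto
      also have "\<dots> = exp (2 * (\<nu> * norm s) * (cmod (fst t) + cmod (snd t)))"
        by (simp add: power2_eq_square exp_add[symmetric] algebra_simps)
      finally show "norm (exp (- \<nu> * (norm t)\<^sup>2) * (cmod (exp (of_real \<nu> * hprod s t)))\<^sup>2)
        \<le> norm (exp (2 * (\<nu> * norm s) * (cmod (fst t) + cmod (snd t))) * exp (- \<nu> * (norm t)\<^sup>2))"
        by (simp add: abs_mult mult.commute mult_left_mono del: norm_exp_eq_Re)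
    qed
  qed measurable
qed

text \<open>After the translation \<open>t \<mapsto> t + s\<close> the integrand becomes the Gaussian times the entire function
\<open>\<phi> (t + s) exp (- \<nu> \<langle>t, s\<rangle>)\<close>, whose value at the origin is \<open>\<phi> s\<close>.\<close>

lemma Fock_reproducing:
  assumes \<nu>: "\<nu> > 0" and \<phi>: "holomorphic2 \<phi>" "sq_int (gauss_measure \<nu>) \<phi>"
  shows "integrable (gauss_measure \<nu>) (\<lambda>t. exp (of_real \<nu> * hprod s t) * \<phi> t)"
    and "(LINT t|gauss_measure \<nu>. exp (of_real \<nu> * hprod s t) * \<phi> t) = of_real ((pi / \<nu>)\<^sup>2) * \<phi> s"
proof -
  note \<phi>b [measurable] = holomorphic2_measurable[OF \<phi>(1)]
  have "(\<lambda>t. exp (of_real \<nu> * hprod s t)) \<in> borel_measurable borel"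
    unfolding hprod_def by (intro borel_measurable_continuous_onI continuous_intros)
  hence m: "(\<lambda>t. exp (of_real \<nu> * hprod s t) * \<phi> t) \<in> borel_measurable borel"
    by (rule borel_measurable_times[OF _ \<phi>b])
  show int: "integrable (gauss_measure \<nu>) (\<lambda>t. exp (of_real \<nu> * hprod s t) * \<phi> t)"
    by (rule sq_int_mult[OF sq_int_exp_hprod[OF \<nu>] \<phi>(2)])
  define F where "F t = \<phi> (t + s) * exp (- of_real \<nu> * hprod t s)" for t
  have F: "holomorphic2 F"
    unfolding holomorphic2_def
  proof
    fix t
    obtain a b where ab: "(\<phi> has_derivative (\<lambda>h. a * fst h + b * snd h)) (at (t + s))"
      using \<phi>(1) unfolding holomorphic2_def by blast
    have "((\<lambda>t. t + s) has_derivative (\<lambda>h. h)) (at t)" by (auto intro!: derivative_eq_intros)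
    note 1 = has_derivative_compose[OF this ab]
    have "((\<lambda>t. - of_real \<nu> * hprod t s) has_derivative (\<lambda>h. - of_real \<nu> * (fst h * cnj (fst s) + snd h * cnj (snd s)))) (at t)"
      unfolding hprod_def
      by (intro has_derivative_mult_right has_derivative_add has_derivative_mult_left has_derivative_fst has_derivative_snd has_derivative_ident)
    note 2 = has_derivative_compose[OF this DERIV_exp[unfolded has_field_derivative_def]]
    let ?E = "exp (- of_real \<nu> * hprod t s)"
    have "(F has_derivative (\<lambda>h. (?E * a - \<phi> (t + s) * ?E * of_real \<nu> * cnj (fst s)) * fst h
        + (?E * b - \<phi> (t + s) * ?E * of_real \<nu> * cnj (snd s)) * snd h)) (at t)"
      unfolding F_def
      by (rule has_derivative_eq_rhs[OF has_derivative_mult[OF 1 2]]) (simp add: fun_eq_iff algebra_simps)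
    thus "\<exists>a b. (F has_derivative (\<lambda>h. a * fst h + b * snd h)) (at t)" by blast
  qed
  let ?H = "\<lambda>t. exp (- \<nu> * (norm t)\<^sup>2) *\<^sub>R (exp (of_real \<nu> * hprod s t) * \<phi> t)"
  have "has_bochner_integral lborel ?H (LINT t|gauss_measure \<nu>. exp (of_real \<nu> * hprod s t) * \<phi> t)"
    using int unfolding has_bochner_integral_iff integrable_gauss_measure[OF m] integral_gauss_measure[OF m] by simp
  hence "has_bochner_integral lborel (\<lambda>t. ?H (t + s)) (LINT t|gauss_measure \<nu>. exp (of_real \<nu> * hprod s t) * \<phi> t)"
    by (rule has_bochner_integral_lborel_shift)
  moreover have "?H (t + s) = exp (- \<nu> * (norm t)\<^sup>2) *\<^sub>R F t" for t
  proof -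
    have e: "complex_of_real (exp (- \<nu> * (norm u)\<^sup>2)) = exp (- of_real \<nu> * hprod u u)" for u
      unfolding hprod_self by (simp add: exp_of_real[symmetric] del: exp_of_real)
    have "- of_real \<nu> * hprod (t + s) (t + s) + of_real \<nu> * hprod s (t + s) = - of_real \<nu> * hprod t t + - of_real \<nu> * hprod t s"
      by (simp add: hprod_def algebra_simps)
    hence "exp (- of_real \<nu> * hprod (t + s) (t + s)) * exp (of_real \<nu> * hprod s (t + s))
       = exp (- of_real \<nu> * hprod t t) * exp (- of_real \<nu> * hprod t s)"
      by (simp only: exp_add[symmetric])
    moreover have "P * (Q * v) = R * (v * S)" if "P * Q = R * S" for P Q R S v :: complex
    proof -
      have "P * (Q * v) = (P * Q) * v" by (simp only: mult.assoc)
      thus ?thesis unfolding that by (simp only: mult_ac)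
    qed
    ultimately show ?thesis unfolding F_def scaleR_conv_of_real e by blast
  qed
  ultimately have "has_bochner_integral lborel (\<lambda>t. exp (- \<nu> * (norm t)\<^sup>2) *\<^sub>R F t)
      (LINT t|gauss_measure \<nu>. exp (of_real \<nu> * hprod s t) * \<phi> t)" by simp
  moreover from this have "(LINT t|lborel. exp (- \<nu> * (norm t)\<^sup>2) *\<^sub>R F t) = of_real ((pi / \<nu>)\<^sup>2) * F 0"
    by (intro gaussian_mean_value[OF \<nu> F]) (simp add: has_bochner_integral_iff)
  ultimately show "(LINT t|gauss_measure \<nu>. exp (of_real \<nu> * hprod s t) * \<phi> t) = of_real ((pi / \<nu>)\<^sup>2) * \<phi> s"
    by (simp add: has_bochner_integral_iff F_def hprod_def)
qed

section \<open>The adjoint\<close>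

text \<open>The inversion integral without truncation. For \<open>h\<close> supported in a ball it converges absolutely and is
the Hilbert space adjoint of \<open>T_op\<close>.\<close>

definition T_adj :: "real \<Rightarrow> (complex \<times> complex \<Rightarrow> complex) \<Rightarrow> complex \<Rightarrow> complex" where
  "T_adj \<nu> h x = of_real ((\<nu> / pi) powr (3/2)) * (LINT s|gauss_measure \<nu>. cnj (Fock_kernel \<nu> s x) * h s)"

lemma Tinv_integrand_eq:
  "Tinv_integrand \<nu> \<phi> x s = exp (- \<nu> * (norm s)\<^sup>2) *\<^sub>R (cnj (Fock_kernel \<nu> s x) * \<phi> s)"
proof -
  have "complex_of_real (exp (- \<nu> * (norm s)\<^sup>2)) = exp (- complex_of_real \<nu> * complex_of_real ((cmod (fst s))\<^sup>2 + (cmod (snd s))\<^sup>2))"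
    unfolding norm_pair_sq by (simp add: exp_of_real[symmetric] del: exp_of_real)
  moreover have "cnj (Fock_kernel \<nu> s x) = exp (complex_of_real \<nu> * (cnj (fst s) * x + cnj (snd s) * cnj x - cnj (fst s) * cnj (snd s)))"
    unfolding Fock_kernel_def exp_cnj by simp
  ultimately show ?thesis
    unfolding Tinv_integrand_def case_prod_beta scaleR_conv_of_real by (simp only: exp_add mult.assoc prod.collapse)
qed

lemma Tinv_on_eq_T_adj:
  assumes [measurable]: "\<phi> \<in> borel_measurable borel" "A \<in> sets borel"
  shows "Tinv_on \<nu> A \<phi> = T_adj \<nu> (\<lambda>s. indicator A s *\<^sub>R \<phi> s)"
proof
  fix x
  have [measurable]: "(\<lambda>s. indicator A s *\<^sub>R \<phi> s) \<in> borel_measurable borel"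
    by (intro borel_measurable_scaleR borel_measurable_indicator assms)
  have m: "(\<lambda>s. cnj (Fock_kernel \<nu> s x) * (indicator A s *\<^sub>R \<phi> s)) \<in> borel_measurable borel"
    by measurable
  have m': "(\<lambda>s. indicator A s *\<^sub>R Tinv_integrand \<nu> \<phi> x s) \<in> borel_measurable lborel"
  proof -
    have "(\<lambda>s. exp (- \<nu> * (norm s)\<^sup>2) *\<^sub>R (cnj (Fock_kernel \<nu> s x) * \<phi> s)) \<in> borel_measurable borel"
      by measurable
    hence "(\<lambda>s. indicator A s *\<^sub>R Tinv_integrand \<nu> \<phi> x s) \<in> borel_measurable borel"
      unfolding Tinv_integrand_eq by (rule borel_measurable_scaleR[OF borel_measurable_indicator[OF assms(2)]])
    thus ?thesis by simp
  qed
  have "(LINT s:A|lebesgue. Tinv_integrand \<nu> \<phi> x s) = (LINT s|lborel. indicator A s *\<^sub>R Tinv_integrand \<nu> \<phi> x s)"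
    unfolding set_lebesgue_integral_def by (rule integral_completion[OF m'])
  also have "\<dots> = (LINT s|lborel. exp (- \<nu> * (norm s)\<^sup>2) *\<^sub>R (cnj (Fock_kernel \<nu> s x) * (indicator A s *\<^sub>R \<phi> s)))"
    unfolding Tinv_integrand_eq by (intro Bochner_Integration.integral_cong refl) (simp add: mult.commute)
  finally show "Tinv_on \<nu> A \<phi> x = T_adj \<nu> (\<lambda>s. indicator A s *\<^sub>R \<phi> s) x"
    unfolding Tinv_on_def T_adj_def integral_gauss_measure[OF m] by simp
qed

lemma sq_int_const_pair:
  assumes "\<nu> > 0" shows "sq_int (gauss_measure \<nu>) (\<lambda>s::complex \<times> complex. 1)"
  using integral_gaussian_pair(1)[OF assms] by (subst sq_int_gauss_borel) auto

lemma sq_int_pair_integrable: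
  assumes "\<nu> > 0" "sq_int (gauss_measure \<nu>) (h :: complex \<times> complex \<Rightarrow> complex)"
  shows "integrable (gauss_measure \<nu>) h"
  using sq_int_mult[OF sq_int_const_pair[OF assms(1)] assms(2)] by simp

lemma norm_Fock_kernel_le_ball:
  assumes "\<nu> > 0" "norm s \<le> R"
  shows "cmod (Fock_kernel \<nu> s x) \<le> exp (2 * \<nu> * R * cmod x + \<nu> / 2 * R\<^sup>2)"
proof -
  have "cmod (fst s) + cmod (snd s) \<le> 2 * R"
    using norm_fst_le[of "fst s" "snd s"] norm_snd_le[of "snd s" "fst s"] assms(2) by simp
  hence "\<nu> * cmod x * (cmod (fst s) + cmod (snd s)) \<le> \<nu> * cmod x * (2 * R)"
    using assms by (intro mult_left_mono) auto
  moreover have "\<nu> / 2 * (norm s)\<^sup>2 \<le> \<nu> / 2 * R\<^sup>2"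
    using assms by (intro mult_left_mono power_mono) auto
  ultimately have "\<nu> * cmod x * (cmod (fst s) + cmod (snd s)) + \<nu> / 2 * (norm s)\<^sup>2 \<le> 2 * \<nu> * R * cmod x + \<nu> / 2 * R\<^sup>2"
    by (simp add: mult_ac)
  thus ?thesis using norm_Fock_kernel_le[OF assms(1), of s x] order_trans exp_le_cancel_iff by blast
qed

lemma Fock_kernel_pair_measurable:
  fixes h :: "complex \<times> complex \<Rightarrow> complex" and g :: "complex \<Rightarrow> complex"
  assumes [measurable]: "h \<in> borel_measurable borel" "g \<in> borel_measurable borel"
  shows "(\<lambda>(s, x). (exp (- \<nu> * (norm s)\<^sup>2) * exp (- \<mu> * (norm x)\<^sup>2)) *\<^sub>R (cnj (Fock_kernel \<nu> s x) * h s * cnj (g x)))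
     \<in> borel_measurable (lborel \<Otimes>\<^sub>M lborel)"
proof -
  define S X where "S q = fst q" and "X q = snd q" for q :: "(complex \<times> complex) \<times> complex"
  have [measurable]: "S \<in> borel_measurable borel" "X \<in> borel_measurable borel"
    unfolding S_def[abs_def] X_def[abs_def] by (intro borel_measurable_continuous_onI continuous_intros)+
  have "(\<lambda>(s, x). (exp (- \<nu> * (norm s)\<^sup>2) * exp (- \<mu> * (norm x)\<^sup>2)) *\<^sub>R (cnj (Fock_kernel \<nu> s x) * h s * cnj (g x)))
    = (\<lambda>q. (exp (- \<nu> * (norm (S q))\<^sup>2) * exp (- \<mu> * (norm (X q))\<^sup>2)) *\<^sub>R (cnj (Fock_kernel \<nu> (S q) (X q)) * h (S q) * cnj (g (X q))))"
    by (auto simp: S_def X_def)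
  also have "\<dots> \<in> borel_measurable borel" by measurable
  finally show ?thesis unfolding lborel_prod by simp
qed

context
  fixes \<nu> R :: real and h :: "complex \<times> complex \<Rightarrow> complex"
  assumes \<nu>: "0 < \<nu>" and hb [measurable]: "h \<in> borel_measurable borel"
    and h: "sq_int (gauss_measure \<nu>) h" and supp: "\<And>s. norm s > R \<Longrightarrow> h s = 0"
begin

lemma T_adj_measurable: "T_adj \<nu> h \<in> borel_measurable borel"
proof -
  have m: "(\<lambda>s. cnj (Fock_kernel \<nu> s x) * h s) \<in> borel_measurable borel" for x by measurable
  define \<Phi> where "\<Phi> s x = (exp (- \<nu> * (norm s)\<^sup>2) * exp (- 0 * (norm x)\<^sup>2)) *\<^sub>R (cnj (Fock_kernel \<nu> s x) * h s * cnj 1)" for s and x :: complex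
  have \<Phi>m: "(\<lambda>(s, x). \<Phi> s x) \<in> borel_measurable (lborel \<Otimes>\<^sub>M lborel)"
    unfolding \<Phi>_def by (rule Fock_kernel_pair_measurable) auto
  have [measurable]: "(\<lambda>(x, s). \<Phi> s x) \<in> borel_measurable (lborel \<Otimes>\<^sub>M lborel)"
    using measurable_compose[OF measurable_pair_swap' \<Phi>m] by (simp add: case_prod_beta')
  have "T_adj \<nu> h = (\<lambda>x. of_real ((\<nu> / pi) powr (3/2)) * (LINT s|lborel. \<Phi> s x))"
    by (simp add: fun_eq_iff T_adj_def integral_gauss_measure[OF m] \<Phi>_def)
  also have "\<dots> \<in> borel_measurable lborel"
    by (intro borel_measurable_times borel_measurable_const lborel.borel_measurable_lebesgue_integral) measurable
  finally show ?thesis by simp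
qed

lemma norm_T_adj_integrand_le:
  "cmod (cnj (Fock_kernel \<nu> s x) * h s) \<le> exp (2 * \<nu> * R * cmod x + \<nu> / 2 * R\<^sup>2) * cmod (h s)"
proof (cases "norm s \<le> R")
  case True thus ?thesis unfolding norm_mult complex_mod_cnj
    by (intro mult_right_mono norm_Fock_kernel_le_ball \<nu>) auto
next
  case False thus ?thesis using supp[of s] by simp
qed

lemma T_adj_integrand_integrable: "integrable (gauss_measure \<nu>) (\<lambda>s. cnj (Fock_kernel \<nu> s x) * h s)"
proof (rule Bochner_Integration.integrable_bound)
  show "integrable (gauss_measure \<nu>) (\<lambda>s. exp (2 * \<nu> * R * cmod x + \<nu> / 2 * R\<^sup>2) * cmod (h s))"
    using sq_int_pair_integrable[OF \<nu> h] by simp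
  have "(\<lambda>s. cnj (Fock_kernel \<nu> s x) * h s) \<in> borel_measurable borel" by measurable
  thus "(\<lambda>s. cnj (Fock_kernel \<nu> s x) * h s) \<in> borel_measurable (gauss_measure \<nu>)"
    by (rule borel_imp_gauss_measurable)
  show "AE s in gauss_measure \<nu>. norm (cnj (Fock_kernel \<nu> s x) * h s)
      \<le> norm (exp (2 * \<nu> * R * cmod x + \<nu> / 2 * R\<^sup>2) * cmod (h s))"
    using norm_T_adj_integrand_le by (intro AE_I2 order_trans[OF norm_T_adj_integrand_le]) simp
qed

lemma sq_int_T_adj: "sq_int (gauss_measure \<nu>) (T_adj \<nu> h)"
  unfolding sq_int_gauss_borel[OF T_adj_measurable]
proof -
  let ?c = "(\<nu> / pi) powr (3/2)"
  define H where "H = (LINT s|gauss_measure \<nu>. cmod (h s))"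
  have bound: "cmod (T_adj \<nu> h x) \<le> ?c * H * exp (2 * \<nu> * R * cmod x + \<nu> / 2 * R\<^sup>2)" for x
  proof -
    have "cmod (T_adj \<nu> h x) = ?c * cmod (LINT s|gauss_measure \<nu>. cnj (Fock_kernel \<nu> s x) * h s)"
      by (simp add: T_adj_def norm_mult)
    also have "\<dots> \<le> ?c * (LINT s|gauss_measure \<nu>. cmod (cnj (Fock_kernel \<nu> s x) * h s))"
      by (intro mult_left_mono integral_norm_bound) auto
    also have "\<dots> \<le> ?c * (LINT s|gauss_measure \<nu>. exp (2 * \<nu> * R * cmod x + \<nu> / 2 * R\<^sup>2) * cmod (h s))"
    proof (intro mult_left_mono integral_mono_AE' AE_I2)
      show "integrable (gauss_measure \<nu>) (\<lambda>s. exp (2 * \<nu> * R * cmod x + \<nu> / 2 * R\<^sup>2) * cmod (h s))"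
        using sq_int_pair_integrable[OF \<nu> h] by simp
      fix s
      show "cmod (cnj (Fock_kernel \<nu> s x) * h s) \<le> exp (2 * \<nu> * R * cmod x + \<nu> / 2 * R\<^sup>2) * cmod (h s)"
        by (rule norm_T_adj_integrand_le)
    qed auto
    finally show ?thesis by (simp add: H_def mult_ac)
  qed
  have "integrable lborel (\<lambda>x::complex. (?c * H * exp (\<nu> / 2 * R\<^sup>2))\<^sup>2 * (exp (4 * \<nu> * R * cmod x) * exp (- \<nu> * (cmod x)\<^sup>2)))"
    by (intro integrable_mult_right integrable_exp_gaussian_weight \<nu>)
  thus "integrable lborel (\<lambda>x. exp (- \<nu> * (norm x)\<^sup>2) * (cmod (T_adj \<nu> h x))\<^sup>2)"
  proof (rule Bochner_Integration.integrable_bound)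
    note [measurable] = T_adj_measurable
    show "(\<lambda>x. exp (- \<nu> * (norm x)\<^sup>2) * (cmod (T_adj \<nu> h x))\<^sup>2) \<in> borel_measurable lborel" by measurable
    show "AE x in lborel. norm (exp (- \<nu> * (norm x)\<^sup>2) * (cmod (T_adj \<nu> h x))\<^sup>2)
        \<le> norm ((?c * H * exp (\<nu> / 2 * R\<^sup>2))\<^sup>2 * (exp (4 * \<nu> * R * cmod x) * exp (- \<nu> * (cmod x)\<^sup>2)))"
    proof (intro AE_I2)
      fix x
      have "(cmod (T_adj \<nu> h x))\<^sup>2 \<le> (?c * H * exp (2 * \<nu> * R * cmod x + \<nu> / 2 * R\<^sup>2))\<^sup>2"
        by (intro power_mono bound) auto
      also have "\<dots> = (?c * H * exp (\<nu> / 2 * R\<^sup>2))\<^sup>2 * exp (4 * \<nu> * R * cmod x)"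
      proof -
        have "(exp (2 * \<nu> * R * cmod x + \<nu> / 2 * R\<^sup>2))\<^sup>2 = (exp (\<nu> / 2 * R\<^sup>2))\<^sup>2 * exp (4 * \<nu> * R * cmod x)"
          by (simp add: power2_eq_square[of "exp _"] exp_add[symmetric])
        thus ?thesis by (simp add: power_mult_distrib)
      qed
      finally have "exp (- \<nu> * (norm x)\<^sup>2) * (cmod (T_adj \<nu> h x))\<^sup>2
          \<le> exp (- \<nu> * (norm x)\<^sup>2) * ((?c * H * exp (\<nu> / 2 * R\<^sup>2))\<^sup>2 * exp (4 * \<nu> * R * cmod x))"
        by (rule mult_left_mono) simp
      thus "norm (exp (- \<nu> * (norm x)\<^sup>2) * (cmod (T_adj \<nu> h x))\<^sup>2)
        \<le> norm ((?c * H * exp (\<nu> / 2 * R\<^sup>2))\<^sup>2 * (exp (4 * \<nu> * R * cmod x) * exp (- \<nu> * (cmod x)\<^sup>2)))"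
        by (simp add: abs_mult mult_ac)
    qed
  qed
qed

text \<open>Fubini's theorem. On the support of \<open>h\<close> the norm of \<open>Fock_kernel \<nu> s\<close> is bounded, which makes the double
integral absolutely convergent.\<close>

lemma T_adj_adjoint:
  assumes gb [measurable]: "g \<in> borel_measurable borel" and g: "sq_int (gauss_measure \<nu>) g"
  shows "(LINT x|gauss_measure \<nu>. T_adj \<nu> h x * cnj (g x)) = (LINT s|gauss_measure \<nu>. h s * cnj (T_op \<nu> g s))"
proof -
  let ?k = "Fock_kernel \<nu>" and ?G = "gauss_measure \<nu> :: complex measure"
  define c where "c = (\<nu> / pi) powr (3/2)"
  note [measurable] = T_adj_measurable holomorphic2_measurable[OF holomorphic2_T_op[OF \<nu> g]]
  define \<Phi> where "\<Phi> s x = (exp (- \<nu> * (norm s)\<^sup>2) * exp (- \<nu> * (norm x)\<^sup>2)) *\<^sub>R (cnj (?k s x) * h s * cnj (g x))" for s x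
  have \<Phi>m [measurable]: "case_prod \<Phi> \<in> borel_measurable (lborel \<Otimes>\<^sub>M lborel)"
    unfolding \<Phi>_def by (rule Fock_kernel_pair_measurable) measurable
  have kg: "integrable ?G (\<lambda>x. ?k s x * g x)" for s by (rule sq_int_mult[OF sq_int_Fock_kernel[OF \<nu>] g])
  have kgm: "(\<lambda>x. ?k s x * g x) \<in> borel_measurable borel" for s by measurable
  have \<Phi>eq: "\<Phi> s x = (of_real (exp (- \<nu> * (norm s)\<^sup>2)) * h s) * cnj (exp (- \<nu> * (norm x)\<^sup>2) *\<^sub>R (?k s x * g x))" for s x
    by (simp add: \<Phi>_def scaleR_conv_of_real mult_ac)
  have kgi: "integrable lborel (\<lambda>x. exp (- \<nu> * (norm x)\<^sup>2) *\<^sub>R (?k s x * g x))" for s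
    using kg[of s] unfolding integrable_gauss_measure[OF kgm] .
  have \<Phi>int: "integrable (lborel \<Otimes>\<^sub>M lborel) (case_prod \<Phi>)"
  proof (rule lborel_pair.Fubini_integrable)
    let ?C = "sqrt (pi / \<nu> * exp (\<nu> * R\<^sup>2)) * l2norm ?G g"
    have "integrable lborel (\<lambda>s. ?C * norm (exp (- \<nu> * (norm s)\<^sup>2) *\<^sub>R h s))"
      using sq_int_pair_integrable[OF \<nu> h] unfolding integrable_gauss_measure[OF hb] by (intro integrable_mult_right integrable_norm)
    thus "integrable lborel (\<lambda>s. LINT x|lborel. norm (case (s, x) of (s, x) \<Rightarrow> \<Phi> s x))"
    proof (rule Bochner_Integration.integrable_bound)
      show "AE s in lborel. norm (LINT x|lborel. norm (case (s, x) of (s, x) \<Rightarrow> \<Phi> s x)) \<le> norm (?C * norm (exp (- \<nu> * (norm s)\<^sup>2) *\<^sub>R h s))"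
      proof (intro AE_I2)
        fix s
        have C0: "?C \<ge> 0" using \<nu> by simp
        have m': "(\<lambda>x. cmod (?k s x) * cmod (g x)) \<in> borel_measurable borel" by measurable
        have "(LINT x|lborel. norm (\<Phi> s x)) = norm (exp (- \<nu> * (norm s)\<^sup>2) *\<^sub>R h s) * (LINT x|?G. cmod (?k s x) * cmod (g x))"
          unfolding \<Phi>eq norm_mult complex_mod_cnj norm_scaleR norm_of_real abs_exp_cancel integral_mult_right_zero
            integral_gauss_measure[OF m'] real_scaleR_def ..
        also have "\<dots> \<le> norm (exp (- \<nu> * (norm s)\<^sup>2) *\<^sub>R h s) * ?C"
        proof (cases "norm s \<le> R")
          case True
          have "(LINT x|?G. cmod (?k s x) * cmod (g x)) \<le> l2norm ?G (?k s) * l2norm ?G g"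
            by (rule Cauchy_Schwarz_l2norm_abs[OF sq_int_Fock_kernel[OF \<nu>] g])
          also have "l2norm ?G (?k s) \<le> sqrt (pi / \<nu> * exp (\<nu> * R\<^sup>2))"
          proof (rule real_le_rsqrt)
            show "(l2norm ?G (?k s))\<^sup>2 \<le> pi / \<nu> * exp (\<nu> * R\<^sup>2)"
              unfolding l2norm_Fock_kernel[OF \<nu>] using \<nu> True by (intro mult_left_mono) (auto intro: power_mono)
          qed
          hence "l2norm ?G (?k s) * l2norm ?G g \<le> ?C" by (rule mult_right_mono) simp
          finally show ?thesis by (rule mult_left_mono) simp
        next
          case False thus ?thesis using supp[of s] by simp
        qed
        finally have "(LINT x|lborel. norm (\<Phi> s x)) \<le> norm (exp (- \<nu> * (norm s)\<^sup>2) *\<^sub>R h s) * ?C" .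
        moreover have "(LINT x|lborel. norm (\<Phi> s x)) \<ge> 0" by (rule integral_nonneg_AE) auto
        moreover have "norm (?C * norm (exp (- \<nu> * (norm s)\<^sup>2) *\<^sub>R h s)) = norm (exp (- \<nu> * (norm s)\<^sup>2) *\<^sub>R h s) * ?C"
        proof -
          have "norm (a * b) = b * a" if "0 \<le> a" "0 \<le> b" for a b :: real using that by simp
          thus ?thesis using C0 norm_ge_zero by blast
        qed
        ultimately show "norm (LINT x|lborel. norm (case (s, x) of (s, x) \<Rightarrow> \<Phi> s x)) \<le> norm (?C * norm (exp (- \<nu> * (norm s)\<^sup>2) *\<^sub>R h s))"
          by (simp only: prod.case real_norm_def abs_of_nonneg)
      qed
    qed measurable
    show "AE s in lborel. integrable lborel (\<lambda>x. case (s, x) of (s, x) \<Rightarrow> \<Phi> s x)"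
      unfolding prod.case \<Phi>eq by (intro AE_I2 integrable_mult_right integrable_cnj kgi)
  qed measurable
  have 1: "of_real c * (LINT x|lborel. \<Phi> s x) = exp (- \<nu> * (norm s)\<^sup>2) *\<^sub>R (h s * cnj (T_op \<nu> g s))" for s
  proof -
    have "(LINT x|lborel. \<Phi> s x) = (of_real (exp (- \<nu> * (norm s)\<^sup>2)) * h s) * cnj (LINT x|?G. ?k s x * g x)"
      unfolding \<Phi>eq integral_mult_right_zero Bochner_Integration.integral_cnj integral_gauss_measure[OF kgm] ..
    moreover have "T_op \<nu> g s = of_real c * (LINT x|?G. ?k s x * g x)"
      using T_op_eq[OF sq_int_lebesgue_measurable[OF g]] by (simp add: c_def)
    ultimately show ?thesis by (simp add: scaleR_conv_of_real mult_ac)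
  qed
  have m: "(\<lambda>s. cnj (?k s x) * h s) \<in> borel_measurable borel" for x by measurable
  have 2: "of_real c * (LINT s|lborel. \<Phi> s x) = exp (- \<nu> * (norm x)\<^sup>2) *\<^sub>R (T_adj \<nu> h x * cnj (g x))" for x
  proof -
    have e: "\<Phi> s x = (of_real (exp (- \<nu> * (norm x)\<^sup>2)) * cnj (g x)) * (exp (- \<nu> * (norm s)\<^sup>2) *\<^sub>R (cnj (?k s x) * h s))" for s
      by (simp add: \<Phi>_def scaleR_conv_of_real mult_ac)
    have "(LINT s|lborel. \<Phi> s x) = (of_real (exp (- \<nu> * (norm x)\<^sup>2)) * cnj (g x)) * (LINT s|gauss_measure \<nu>. cnj (?k s x) * h s)"
      unfolding e integral_mult_right_zero integral_gauss_measure[OF m] ..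
    thus ?thesis by (simp add: T_adj_def c_def scaleR_conv_of_real mult_ac)
  qed
  have ma: "(\<lambda>x. T_adj \<nu> h x * cnj (g x)) \<in> borel_measurable borel" by measurable
  have mb: "(\<lambda>s. h s * cnj (T_op \<nu> g s)) \<in> borel_measurable borel" by measurable
  have "(LINT x|?G. T_adj \<nu> h x * cnj (g x)) = of_real c * (LINT x|lborel. LINT s|lborel. \<Phi> s x)"
    unfolding integral_gauss_measure[OF ma] 2[symmetric] by (rule integral_mult_right_zero)
  also have "(LINT x|lborel. LINT s|lborel. \<Phi> s x) = (LINT s|lborel. LINT x|lborel. \<Phi> s x)"
    by (rule lborel_pair.Fubini_integral[OF \<Phi>int])
  also have "of_real c * \<dots> = (LINT s|gauss_measure \<nu>. h s * cnj (T_op \<nu> g s))"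
    unfolding integral_gauss_measure[OF mb] 1[symmetric] by (rule integral_mult_right_zero[symmetric])
  finally show ?thesis .
qed

text \<open>\<open>T_op\<close> at \<open>t\<close> is an inner product with \<open>cnj k\<^sub>t\<close>, so adjointness moves \<open>T_adj\<close> onto \<open>cnj k\<^sub>t\<close>, whose image is
the reproducing kernel by \<open>Fock_kernel_inner\<close>.\<close>

lemma T_op_T_adj:
  "T_op \<nu> (T_adj \<nu> h) t = of_real ((\<nu> / pi)\<^sup>2) * (LINT s|gauss_measure \<nu>. exp (of_real \<nu> * hprod t s) * h s)"
proof -
  let ?k = "Fock_kernel \<nu>" and ?G = "gauss_measure \<nu> :: complex measure"
  define c where "c = (\<nu> / pi) powr (3/2)"
  have m: "(\<lambda>x. cnj (?k t x)) \<in> borel_measurable borel" by measurable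
  have s: "sq_int ?G (\<lambda>x. cnj (?k t x))"
    using sq_int_Fock_kernel[OF \<nu>, of t] borel_imp_gauss_measurable[OF m] by (simp add: sq_int_def)
  have T: "T_op \<nu> (\<lambda>x. cnj (?k t x)) s = of_real (c * (pi / \<nu>)) * exp (of_real \<nu> * hprod s t)" for s
  proof -
    have m2: "(\<lambda>x. ?k s x * cnj (?k t x)) \<in> borel_measurable borel" by measurable
    have "(LINT x|?G. ?k s x * cnj (?k t x)) = of_real (pi / \<nu>) * exp (of_real \<nu> * hprod s t)"
      unfolding integral_gauss_measure[OF m2] hprod_def
      by (rule has_bochner_integral_integral_eq[OF Fock_kernel_inner[OF \<nu>]])
    thus ?thesis unfolding T_op_eq[OF sq_int_lebesgue_measurable[OF \<open>sq_int ?G (\<lambda>x. cnj (?k t x))\<close>]] c_def by simp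
  qed
  have "T_op \<nu> (T_adj \<nu> h) t = of_real c * (LINT x|?G. T_adj \<nu> h x * cnj (cnj (?k t x)))"
    unfolding T_op_eq[OF sq_int_lebesgue_measurable[OF sq_int_T_adj]] c_def by (simp add: mult.commute)
  also have "\<dots> = of_real c * (LINT s|gauss_measure \<nu>. h s * cnj (T_op \<nu> (\<lambda>x. cnj (?k t x)) s))"
    unfolding T_adj_adjoint[OF m s] ..
  also have "\<dots> = of_real c * (LINT s|gauss_measure \<nu>. of_real (c * (pi / \<nu>)) * (exp (of_real \<nu> * hprod t s) * h s))"
    unfolding T complex_cnj_mult exp_cnj[symmetric] by (simp add: hprod_def mult_ac exp_cnj)
  also have "\<dots> = of_real (c * (c * (pi / \<nu>))) * (LINT s|gauss_measure \<nu>. exp (of_real \<nu> * hprod t s) * h s)"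
    unfolding integral_mult_right_zero by simp
  also have "c * (c * (pi / \<nu>)) = (\<nu> / pi)\<^sup>2"
  proof -
    have "c\<^sup>2 = (\<nu> / pi) ^ 3" using \<nu> unfolding c_def by (simp add: powr_powr flip: powr_numeral)
    hence "c * (c * (pi / \<nu>)) = (\<nu> / pi) ^ 3 * (pi / \<nu>)" by (simp add: power2_eq_square)
    thus ?thesis using \<nu> by (simp add: power2_eq_square power3_eq_cube)
  qed
  finally show ?thesis .
qed

text \<open>\<open>\<parallel>T_adj h\<parallel>\<^sup>2 = \<langle>h, T_op (T_adj h)\<rangle> \<le> \<parallel>h\<parallel> \<parallel>T_adj h\<parallel>\<close>, by adjointness and isometry.\<close>

lemma l2norm_T_adj_le: "l2norm (gauss_measure \<nu>) (T_adj \<nu> h) \<le> l2norm (gauss_measure \<nu>) h"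
proof -
  let ?a = "l2norm (gauss_measure \<nu>) (T_adj \<nu> h)"
  note T = sq_int_T_op[OF \<nu> sq_int_T_adj]
  have Tc: "sq_int (gauss_measure \<nu>) (\<lambda>s. cnj (T_op \<nu> (T_adj \<nu> h) s))" "l2norm (gauss_measure \<nu>) (\<lambda>s. cnj (T_op \<nu> (T_adj \<nu> h) s)) = ?a"
    using T T_op_isometry[OF \<nu> sq_int_T_adj] by (auto simp: sq_int_def l2norm_def)
  have "complex_of_real (?a\<^sup>2) = (LINT x|gauss_measure \<nu>. T_adj \<nu> h x * cnj (T_adj \<nu> h x))"
    unfolding l2norm_sq integral_complex_of_real[symmetric] complex_norm_square ..
  also have "\<dots> = (LINT s|gauss_measure \<nu>. h s * cnj (T_op \<nu> (T_adj \<nu> h) s))"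
    by (rule T_adj_adjoint[OF T_adj_measurable sq_int_T_adj])
  finally have "?a\<^sup>2 = cmod (LINT s|gauss_measure \<nu>. h s * cnj (T_op \<nu> (T_adj \<nu> h) s))"
    by (metis norm_of_real abs_power2)
  also have "\<dots> \<le> l2norm (gauss_measure \<nu>) h * ?a"
    using Cauchy_Schwarz_l2norm[OF h Tc(1)] unfolding Tc(2) .
  finally have "?a * ?a \<le> l2norm (gauss_measure \<nu>) h * ?a" by (simp add: power2_eq_square)
  thus ?thesis using l2norm_nonneg[of "gauss_measure \<nu>" "T_adj \<nu> h"] l2norm_nonneg[of "gauss_measure \<nu>" h]
    by (metis mult_right_le_imp_le less_eq_real_def)
qed

end

lemma l2norm_add_sq:
  assumes "sq_int M f" "sq_int M g"
  shows "(l2norm M (\<lambda>x. f x + g x))\<^sup>2 = (l2norm M f)\<^sup>2 + (l2norm M g)\<^sup>2 + 2 * Re (LINT x|M. f x * cnj (g x))"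
proof -
  have gc: "sq_int M (\<lambda>x. cnj (g x))" using assms(2) by (auto simp: sq_int_def)
  have i: "integrable M (\<lambda>x. f x * cnj (g x))" by (rule sq_int_mult[OF assms(1) gc])
  have "(cmod (f x + g x))\<^sup>2 = (cmod (f x))\<^sup>2 + (cmod (g x))\<^sup>2 + 2 * Re (f x * cnj (g x))" for x
    unfolding cmod_power2 by (simp add: power2_eq_square algebra_simps)
  hence "(l2norm M (\<lambda>x. f x + g x))\<^sup>2 = (LINT x|M. (cmod (f x))\<^sup>2 + (cmod (g x))\<^sup>2 + 2 * Re (f x * cnj (g x)))"
    unfolding l2norm_sq by simp
  also have "\<dots> = (l2norm M f)\<^sup>2 + (l2norm M g)\<^sup>2 + 2 * (LINT x|M. Re (f x * cnj (g x)))"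
    unfolding l2norm_sq using assms i by (simp add: sq_int_def del: complex_cnj_cancel_iff mult_minus_left times_complex.sel)
  finally show ?thesis unfolding integral_Re[OF i] .
qed

text \<open>Polarization: an isometry determines the real part of the inner product, and replacing \<open>f\<close> by \<open>\<i> f\<close>
gives the imaginary part.\<close>

lemma T_op_inner:
  assumes \<nu>: "\<nu> > 0" and f: "sq_int (gauss_measure \<nu>) f" and g: "sq_int (gauss_measure \<nu>) g"
  shows "(LINT s|gauss_measure \<nu>. T_op \<nu> f s * cnj (T_op \<nu> g s)) = (LINT x|gauss_measure \<nu>. f x * cnj (g x))"
proof -
  have re: "Re (LINT s|gauss_measure \<nu>. T_op \<nu> f s * cnj (T_op \<nu> g s)) = Re (LINT x|gauss_measure \<nu>. f x * cnj (g x))"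
    if f: "sq_int (gauss_measure \<nu>) f" for f
  proof -
    have "T_op \<nu> (\<lambda>x. f x + g x) = (\<lambda>s. T_op \<nu> f s + T_op \<nu> g s)"
      using T_op_linear[OF \<nu> f g, of 1 1] by simp
    hence "(l2norm (gauss_measure \<nu>) (\<lambda>s. T_op \<nu> f s + T_op \<nu> g s))\<^sup>2 = (l2norm (gauss_measure \<nu>) (\<lambda>x. f x + g x))\<^sup>2"
      using T_op_isometry[OF \<nu> sq_int_add[OF f g]] by simp
    thus ?thesis
      unfolding l2norm_add_sq[OF f g] l2norm_add_sq[OF sq_int_T_op[OF \<nu> f] sq_int_T_op[OF \<nu> g]]
        T_op_isometry[OF \<nu> f] T_op_isometry[OF \<nu> g] by simp
  qed
  have "T_op \<nu> (\<lambda>x. \<i> * f x) = (\<lambda>s. \<i> * T_op \<nu> f s)"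
    using T_op_linear[OF \<nu> f f, of \<i> 0] by simp
  with re[OF sq_int_cmult[OF f, of \<i>]]
  have "Re (LINT s|gauss_measure \<nu>. \<i> * (T_op \<nu> f s * cnj (T_op \<nu> g s))) = Re (LINT x|gauss_measure \<nu>. \<i> * (f x * cnj (g x)))"
    by (simp only: mult.assoc)
  hence "Im (LINT s|gauss_measure \<nu>. T_op \<nu> f s * cnj (T_op \<nu> g s)) = Im (LINT x|gauss_measure \<nu>. f x * cnj (g x))"
    unfolding integral_mult_right_zero by simp
  with re[OF f] show ?thesis by (simp add: complex_eq_iff)
qed

lemma truncation:
  assumes \<phi>b: "\<phi> \<in> borel_measurable borel" and \<phi>: "sq_int (gauss_measure \<nu>) (\<phi> :: complex \<times> complex \<Rightarrow> complex)"
  shows "(\<lambda>s. indicator (cball 0 R) s *\<^sub>R \<phi> s) \<in> borel_measurable borel"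
    and "sq_int (gauss_measure \<nu>) (\<lambda>s. indicator (cball 0 R) s *\<^sub>R \<phi> s)"
proof -
  show m: "(\<lambda>s. indicator (cball 0 R) s *\<^sub>R \<phi> s) \<in> borel_measurable borel"
    by (intro borel_measurable_scaleR borel_measurable_indicator \<phi>b) simp
  show "sq_int (gauss_measure \<nu>) (\<lambda>s. indicator (cball 0 R) s *\<^sub>R \<phi> s)"
    by (rule sq_int_bound[OF \<phi> borel_imp_gauss_measurable[OF m]]) (auto simp: indicator_def)
qed

lemma truncation_tendsto:
  assumes \<phi>b: "\<phi> \<in> borel_measurable borel" and \<phi>: "sq_int (gauss_measure \<nu>) (\<phi> :: complex \<times> complex \<Rightarrow> complex)"
  shows "((\<lambda>R. l2norm (gauss_measure \<nu>) (\<lambda>s. indicator (cball 0 R) s *\<^sub>R \<phi> s - \<phi> s)) \<longlongrightarrow> 0) at_top"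
proof -
  let ?G = "gauss_measure \<nu> :: (complex \<times> complex) measure"
  let ?F = "\<lambda>R s. indicator (cball 0 R) s *\<^sub>R \<phi> s - \<phi> s"
  have m: "?F R \<in> borel_measurable ?G" for R
    using truncation(1)[OF \<phi>b \<phi>] \<phi>b by (intro borel_imp_gauss_measurable borel_measurable_diff)
  have "((\<lambda>R. LINT s|?G. (cmod (?F R s))\<^sup>2) \<longlongrightarrow> (LINT s|?G. 0)) at_top"
  proof (rule integral_dominated_convergence_at_top[where w = "\<lambda>s. (cmod (\<phi> s))\<^sup>2"])
    show "(\<lambda>s. (cmod (?F R s))\<^sup>2) \<in> borel_measurable ?G" for R using m[of R] by measurable
    show "integrable ?G (\<lambda>s. (cmod (\<phi> s))\<^sup>2)" by (rule sq_int_integrable[OF \<phi>])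
    show "\<forall>\<^sub>F R in at_top. AE s in ?G. norm ((cmod (?F R s))\<^sup>2) \<le> (cmod (\<phi> s))\<^sup>2"
      by (intro always_eventually allI AE_I2) (auto simp: indicator_def)
    show "AE s in ?G. ((\<lambda>R. (cmod (?F R s))\<^sup>2) \<longlongrightarrow> 0) at_top"
    proof (intro AE_I2 tendsto_eventually)
      fix s :: "complex \<times> complex"
      have "\<forall>\<^sub>F R in at_top. R \<ge> norm s" by (rule eventually_ge_at_top)
      thus "\<forall>\<^sub>F R in at_top. (cmod (?F R s))\<^sup>2 = 0" by eventually_elim (simp add: indicator_def)
    qed
  qed simp
  hence "((\<lambda>R. sqrt (LINT s|?G. (cmod (?F R s))\<^sup>2)) \<longlongrightarrow> sqrt 0) at_top" by (intro tendsto_intros) simp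
  thus ?thesis by (simp add: l2norm_def)
qed

section \<open>Surjectivity and inversion\<close>

text \<open>The preimage is the limit of the adjoint images of the truncations \<open>t n\<close> of \<open>\<phi>\<close>. Evaluation of
\<open>T_op\<close> at a point is continuous for the norm, so the value of the limit is found from
\<open>T_op_T_adj\<close> and the reproducing property.\<close>

lemma T_op_surjective:
  assumes \<nu>: "\<nu> > 0" and hol: "holomorphic2 \<phi>" and \<phi>: "sq_int (gauss_measure \<nu>) \<phi>"
  shows "\<exists>\<psi>. sq_int (gauss_measure \<nu>) \<psi> \<and> T_op \<nu> \<psi> = \<phi>"
proof -
  let ?G = "gauss_measure \<nu> :: (complex \<times> complex) measure"
  note \<phi>b = holomorphic2_measurable[OF hol]
  define t where "t n s = indicator (cball 0 (real n)) s *\<^sub>R \<phi> s" for n s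
  have tb: "t n \<in> borel_measurable borel" and t2: "sq_int ?G (t n)" for n
    unfolding t_def using truncation[OF \<phi>b \<phi>] by auto
  have supp: "norm s > real n \<Longrightarrow> t n s = 0" for n s by (simp add: t_def)
  define F where "F n = T_adj \<nu> (t n)" for n
  define e where "e n = l2norm ?G (\<lambda>s. t n s - \<phi> s)" for n
  have e: "e \<longlonglongrightarrow> 0"
    unfolding e_def t_def
    using filterlim_compose[OF truncation_tendsto[OF \<phi>b \<phi>] filterlim_real_sequentially] .
  have F2: "sq_int (gauss_measure \<nu>) (F n)" for n
    unfolding F_def by (rule sq_int_T_adj[OF \<nu> tb t2 supp])
  have "l2norm (gauss_measure \<nu>) (\<lambda>x. F n x - F m x) \<le> e m" if mn: "m \<le> n" for m n
  proof -
    have d2: "sq_int ?G (\<lambda>s. t n s - t m s)" by (rule sq_int_diff[OF t2 t2])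
    have db: "(\<lambda>s. t n s - t m s) \<in> borel_measurable borel" by (intro borel_measurable_diff tb)
    have ds: "norm s > real n \<Longrightarrow> t n s - t m s = 0" for s using mn supp[of n s] supp[of m s] by simp
    have int: "integrable ?G (\<lambda>s. cnj (Fock_kernel \<nu> s x) * t k s)" for k x
      by (rule T_adj_integrand_integrable[OF \<nu> tb t2 supp])
    have eq: "(\<lambda>x. F n x - F m x) = T_adj \<nu> (\<lambda>s. t n s - t m s)"
      by (simp add: fun_eq_iff F_def T_adj_def right_diff_distrib Bochner_Integration.integral_diff[OF int int])
    have "l2norm (gauss_measure \<nu>) (\<lambda>x. F n x - F m x) \<le> l2norm ?G (\<lambda>s. t n s - t m s)"
      unfolding eq by (rule l2norm_T_adj_le[OF \<nu> db d2 ds])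
    also have "\<dots> \<le> e m"
      unfolding e_def
    proof (rule l2norm_mono[OF sq_int_diff[OF t2 \<phi>] sq_int_measurable[OF d2]])
      show "AE s in ?G. cmod (t n s - t m s) \<le> cmod (t m s - \<phi> s)"
        using mn by (intro AE_I2) (auto simp: t_def indicator_def)
    qed
    finally show ?thesis .
  qed
  from l2_complete[OF F2 this e]
  obtain \<psi> where \<psi>: "sq_int (gauss_measure \<nu>) \<psi>" and lim: "(\<lambda>n. l2norm (gauss_measure \<nu>) (\<lambda>x. F n x - \<psi> x)) \<longlonglongrightarrow> 0"
    by blast
  have "T_op \<nu> \<psi> s = \<phi> s" for s
  proof -
    have "(\<lambda>n. T_op \<nu> (F n) s - T_op \<nu> \<psi> s) \<longlonglongrightarrow> 0"
    proof (rule Lim_null_comparison)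
      have "cmod (T_op \<nu> (F n) s - T_op \<nu> \<psi> s) \<le> (\<nu> / pi) powr (3/2) *
         (l2norm (gauss_measure \<nu>) (Fock_kernel \<nu> s) * l2norm (gauss_measure \<nu>) (\<lambda>x. F n x - \<psi> x))" for n
        using T_op_bound[OF \<nu> sq_int_diff[OF F2 \<psi>], of n s] by (simp add: T_op_diff[OF \<nu> F2 \<psi>])
      thus "\<forall>\<^sub>F n in sequentially. norm (T_op \<nu> (F n) s - T_op \<nu> \<psi> s) \<le> (\<nu> / pi) powr (3/2) *
         (l2norm (gauss_measure \<nu>) (Fock_kernel \<nu> s) * l2norm (gauss_measure \<nu>) (\<lambda>x. F n x - \<psi> x))" by simp
      have "(\<lambda>n. (\<nu> / pi) powr (3/2) *
         (l2norm (gauss_measure \<nu>) (Fock_kernel \<nu> s) * l2norm (gauss_measure \<nu>) (\<lambda>x. F n x - \<psi> x)))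
         \<longlonglongrightarrow> (\<nu> / pi) powr (3/2) * (l2norm (gauss_measure \<nu>) (Fock_kernel \<nu> s) * 0)"
        by (intro tendsto_mult tendsto_const lim)
      thus "(\<lambda>n. (\<nu> / pi) powr (3/2) *
         (l2norm (gauss_measure \<nu>) (Fock_kernel \<nu> s) * l2norm (gauss_measure \<nu>) (\<lambda>x. F n x - \<psi> x))) \<longlonglongrightarrow> 0" by simp
    qed
    hence 1: "(\<lambda>n. T_op \<nu> (F n) s) \<longlonglongrightarrow> T_op \<nu> \<psi> s" by (simp add: LIM_zero_iff)
    let ?E = "\<lambda>u. exp (of_real \<nu> * hprod s u)"
    note rep = Fock_reproducing[OF \<nu> hol \<phi>, of s]
    have TF: "T_op \<nu> (F n) s = of_real ((\<nu> / pi)\<^sup>2) * (LINT u|?G. ?E u * t n u)" for n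
      unfolding F_def by (rule T_op_T_adj[OF \<nu> tb t2 supp])
    have "(\<lambda>n. LINT u|?G. ?E u * t n u) \<longlonglongrightarrow> (LINT u|?G. ?E u * \<phi> u)"
    proof (rule integral_dominated_convergence[where w = "\<lambda>u. cmod (?E u * \<phi> u)"])
      show "(\<lambda>u. ?E u * \<phi> u) \<in> borel_measurable ?G" by (rule borel_measurable_integrable[OF rep(1)])
      show "integrable ?G (\<lambda>u. cmod (?E u * \<phi> u))" using rep(1) by (rule integrable_norm)
      show "(\<lambda>u. ?E u * t n u) \<in> borel_measurable ?G" for n
        by (intro borel_measurable_times sq_int_measurable[OF sq_int_exp_hprod[OF \<nu>]] sq_int_measurable[OF t2])
      show "AE u in ?G. norm (?E u * t n u) \<le> cmod (?E u * \<phi> u)" for n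
        unfolding norm_mult t_def by (intro AE_I2 mult_left_mono) (auto simp: indicator_def)
      show "AE u in ?G. (\<lambda>n. ?E u * t n u) \<longlonglongrightarrow> ?E u * \<phi> u"
      proof (intro AE_I2 tendsto_eventually)
        fix u :: "complex \<times> complex"
        obtain N :: nat where "norm u \<le> real N" using real_arch_simple by blast
        thus "\<forall>\<^sub>F n in sequentially. ?E u * t n u = ?E u * \<phi> u"
          unfolding eventually_sequentially t_def by (intro exI[of _ N]) (auto simp: indicator_def)
      qed
    qed
    hence "(\<lambda>n. T_op \<nu> (F n) s) \<longlonglongrightarrow> of_real ((\<nu> / pi)\<^sup>2) * (LINT u|?G. ?E u * \<phi> u)"
      unfolding TF by (intro tendsto_mult tendsto_const)
    also have "of_real ((\<nu> / pi)\<^sup>2) * (LINT u|?G. ?E u * \<phi> u) = of_real ((\<nu> / pi)\<^sup>2 * (pi / \<nu>)\<^sup>2) * \<phi> s"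
      unfolding rep(2) by simp
    also have "(\<nu> / pi)\<^sup>2 * (pi / \<nu>)\<^sup>2 = 1" using \<nu> by (simp add: power2_eq_square)
    finally show ?thesis using LIMSEQ_unique[OF 1] by simp
  qed
  thus ?thesis using \<psi> by blast
qed

text \<open>Let \<open>D\<close> be the error and \<open>h\<close> the truncated transform. Adjointness rewrites the inner product of
\<open>T_adj h\<close> with \<open>D\<close>, preservation of inner products that of \<open>\<psi>\<close> with \<open>D\<close>, and together
\<open>\<parallel>D\<parallel>\<^sup>2 = \<langle>h - T_op \<psi>, T_op D\<rangle>\<close>. The Cauchy-Schwarz inequality and the isometry give the bound.\<close>

lemma
  assumes \<nu>: "\<nu> > 0" and \<psi>: "sq_int (gauss_measure \<nu>) \<psi>"
  shows sq_int_Tinv_on_cball: "sq_int (gauss_measure \<nu>) (Tinv_on \<nu> (cball 0 R) (T_op \<nu> \<psi>))"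
    and Tinv_on_cball_bound: "l2norm (gauss_measure \<nu>) (\<lambda>x. Tinv_on \<nu> (cball 0 R) (T_op \<nu> \<psi>) x - \<psi> x)
      \<le> l2norm (gauss_measure \<nu>) (\<lambda>s. indicator (cball 0 R) s *\<^sub>R T_op \<nu> \<psi> s - T_op \<nu> \<psi> s)"
proof -
  let ?\<phi> = "T_op \<nu> \<psi>" and ?G = "gauss_measure \<nu> :: complex measure"
  define h where "h s = indicator (cball 0 R) s *\<^sub>R ?\<phi> s" for s
  note \<phi>b = holomorphic2_measurable[OF holomorphic2_T_op[OF \<nu> \<psi>]]
  note \<phi>2 = sq_int_T_op[OF \<nu> \<psi>]
  have hb: "h \<in> borel_measurable borel" and h2: "sq_int (gauss_measure \<nu>) h"
    unfolding h_def using truncation[OF \<phi>b \<phi>2] by auto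
  have supp: "norm s > R \<Longrightarrow> h s = 0" for s by (simp add: h_def)
  have T: "Tinv_on \<nu> (cball 0 R) ?\<phi> = T_adj \<nu> h"
    unfolding h_def by (rule Tinv_on_eq_T_adj[OF \<phi>b]) simp
  note adj2 = sq_int_T_adj[OF \<nu> hb h2 supp] and adjb = T_adj_measurable[OF \<nu> hb h2 supp]
  show "sq_int ?G (Tinv_on \<nu> (cball 0 R) ?\<phi>)" unfolding T by (rule adj2)
  have m: "\<psi> \<in> borel_measurable lebesgue" by (rule sq_int_lebesgue_measurable[OF \<psi>])
  obtain g where g: "g \<in> borel_measurable borel" "AE x in lebesgue. \<psi> x = g x"
    using exists_borel_version[OF m] by blast
  have ae: "AE x in ?G. \<psi> x = g x" using g(2) by (simp add: AE_gauss_measure)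
  have g2: "sq_int ?G g" by (rule sq_int_cong_AE[OF \<psi> borel_imp_gauss_measurable[OF g(1)] ae])
  have Tg: "T_op \<nu> g = ?\<phi>"
    using T_op_cong_AE[OF m _ g(2)] g(1) by (simp add: measurable_completion)
  define D where "D x = T_adj \<nu> h x - g x" for x
  have D2: "sq_int ?G D" and Db: "D \<in> borel_measurable borel"
    unfolding D_def[abs_def] using sq_int_diff[OF adj2 g2] adjb g(1) by auto
  note TD = sq_int_T_op[OF \<nu> D2]
  have cnj: "sq_int M (\<lambda>x. cnj (f x))" "l2norm M (\<lambda>x. cnj (f x)) = l2norm M f" if "sq_int M f" for M and f :: "'b \<Rightarrow> complex"
    using that by (auto simp: sq_int_def l2norm_def)
  have "complex_of_real ((l2norm ?G D)\<^sup>2) = (LINT x|?G. D x * cnj (D x))"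
    unfolding l2norm_sq integral_complex_of_real[symmetric] complex_norm_square ..
  also have "\<dots> = (LINT x|?G. T_adj \<nu> h x * cnj (D x)) - (LINT x|?G. g x * cnj (D x))"
    unfolding D_def[of x for x] left_diff_distrib
    by (intro Bochner_Integration.integral_diff sq_int_mult adj2 g2 cnj(1) D2[unfolded D_def[abs_def]])
  also have "\<dots> = (LINT s|gauss_measure \<nu>. h s * cnj (T_op \<nu> D s)) - (LINT s|gauss_measure \<nu>. ?\<phi> s * cnj (T_op \<nu> D s))"
    using T_adj_adjoint[OF \<nu> hb h2 supp Db D2] T_op_inner[OF \<nu> g2 D2] unfolding Tg by simp
  also have "\<dots> = (LINT s|gauss_measure \<nu>. (h s - ?\<phi> s) * cnj (T_op \<nu> D s))"
    unfolding left_diff_distrib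
    by (intro Bochner_Integration.integral_diff[symmetric] sq_int_mult h2 \<phi>2 cnj(1) TD)
  finally have "(l2norm ?G D)\<^sup>2 = cmod (LINT s|gauss_measure \<nu>. (h s - ?\<phi> s) * cnj (T_op \<nu> D s))"
    by (metis norm_of_real abs_power2)
  also have "\<dots> \<le> l2norm (gauss_measure \<nu>) (\<lambda>s. h s - ?\<phi> s) * l2norm ?G D"
    using Cauchy_Schwarz_l2norm[OF sq_int_diff[OF h2 \<phi>2] cnj(1)[OF TD]]
    unfolding cnj(2)[OF TD] T_op_isometry[OF \<nu> D2] .
  finally have le: "l2norm ?G D * l2norm ?G D \<le> l2norm (gauss_measure \<nu>) (\<lambda>s. h s - ?\<phi> s) * l2norm ?G D"
    by (simp add: power2_eq_square)
  have "l2norm ?G D \<le> l2norm (gauss_measure \<nu>) (\<lambda>s. h s - ?\<phi> s)"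
  proof (cases "l2norm ?G D = 0")
    case False
    hence "l2norm ?G D > 0" using l2norm_nonneg[of ?G D] by linarith
    thus ?thesis using le by (rule mult_right_le_imp_le[rotated])
  qed simp
  moreover have "l2norm ?G (\<lambda>x. T_adj \<nu> h x - \<psi> x) = l2norm ?G D"
  proof (rule l2norm_cong_AE[OF sq_int_measurable[OF sq_int_diff[OF adj2 \<psi>]] sq_int_measurable[OF D2]])
    show "AE x in ?G. T_adj \<nu> h x - \<psi> x = D x" using ae by eventually_elim (simp add: D_def)
  qed
  ultimately show "l2norm ?G (\<lambda>x. Tinv_on \<nu> (cball 0 R) ?\<phi> x - \<psi> x)
      \<le> l2norm (gauss_measure \<nu>) (\<lambda>s. indicator (cball 0 R) s *\<^sub>R ?\<phi> s - ?\<phi> s)"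
    unfolding T h_def by simp
qed

lemma tendsto_Tinv_on_cball:
  assumes \<nu>: "\<nu> > 0" and \<psi>: "sq_int (gauss_measure \<nu>) \<psi>"
  shows "((\<lambda>R. l2norm (gauss_measure \<nu>) (\<lambda>x. Tinv_on \<nu> (cball 0 R) (T_op \<nu> \<psi>) x - \<psi> x)) \<longlongrightarrow> 0) at_top"
proof (rule Lim_null_comparison[OF _ truncation_tendsto[OF holomorphic2_measurable[OF holomorphic2_T_op[OF \<nu> \<psi>]] sq_int_T_op[OF \<nu> \<psi>]]])
  show "\<forall>\<^sub>F R in at_top. norm (l2norm (gauss_measure \<nu>) (\<lambda>x. Tinv_on \<nu> (cball 0 R) (T_op \<nu> \<psi>) x - \<psi> x))
     \<le> l2norm (gauss_measure \<nu>) (\<lambda>s. indicator (cball 0 R) s *\<^sub>R T_op \<nu> \<psi> s - T_op \<nu> \<psi> s)"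
    using Tinv_on_cball_bound[OF \<nu> \<psi>] by simp
qed

lemma Tinv_on_cball_tendsto_UNIV:
  assumes "integrable lebesgue (Tinv_integrand \<nu> \<phi> x)"
  shows "((\<lambda>R. Tinv_on \<nu> (cball 0 R) \<phi> x) \<longlongrightarrow> Tinv_on \<nu> UNIV \<phi> x) at_top"
  unfolding Tinv_on_def set_lebesgue_integral_def
proof (intro tendsto_mult tendsto_const integral_dominated_convergence_at_top[where w = "\<lambda>s. norm (Tinv_integrand \<nu> \<phi> x s)"])
  have [measurable]: "Tinv_integrand \<nu> \<phi> x \<in> borel_measurable lebesgue"
    by (rule borel_measurable_integrable[OF assms])
  show "(\<lambda>s. indicator UNIV s *\<^sub>R Tinv_integrand \<nu> \<phi> x s) \<in> borel_measurable lebesgue" by simp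
  show "(\<lambda>s. indicator (cball 0 R) s *\<^sub>R Tinv_integrand \<nu> \<phi> x s) \<in> borel_measurable lebesgue" for R
    by (intro borel_measurable_scaleR borel_measurable_indicator) simp_all
  show "integrable lebesgue (\<lambda>s. norm (Tinv_integrand \<nu> \<phi> x s))" using assms by (rule integrable_norm)
  show "\<forall>\<^sub>F R in at_top. AE s in lebesgue. norm (indicator (cball 0 R) s *\<^sub>R Tinv_integrand \<nu> \<phi> x s) \<le> norm (Tinv_integrand \<nu> \<phi> x s)"
    by (intro always_eventually allI AE_I2) (auto simp: indicator_def)
  show "AE s in lebesgue. ((\<lambda>R. indicator (cball 0 R) s *\<^sub>R Tinv_integrand \<nu> \<phi> x s) \<longlongrightarrow> indicator UNIV s *\<^sub>R Tinv_integrand \<nu> \<phi> x s) at_top"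
  proof (intro AE_I2 tendsto_eventually)
    fix s :: "complex \<times> complex"
    have "\<forall>\<^sub>F R in at_top. R \<ge> norm s" by (rule eventually_ge_at_top)
    thus "\<forall>\<^sub>F R in at_top. indicator (cball 0 R) s *\<^sub>R Tinv_integrand \<nu> \<phi> x s = indicator UNIV s *\<^sub>R Tinv_integrand \<nu> \<phi> x s"
      by eventually_elim (simp add: indicator_def)
  qed
qed

lemma Tinv_on_UNIV_AE:
  assumes \<nu>: "\<nu> > 0" and \<psi>: "sq_int (gauss_measure \<nu>) \<psi>"
  shows "AE x in lebesgue. integrable lebesgue (Tinv_integrand \<nu> (T_op \<nu> \<psi>) x) \<longrightarrow> \<psi> x = Tinv_on \<nu> UNIV (T_op \<nu> \<psi>) x"
proof -
  let ?F = "\<lambda>R. Tinv_on \<nu> (cball 0 R) (T_op \<nu> \<psi>)"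
  have "(\<lambda>n. l2norm (gauss_measure \<nu>) (\<lambda>x. ?F (real n) x - \<psi> x)) \<longlonglongrightarrow> 0"
    by (rule filterlim_compose[OF tendsto_Tinv_on_cball[OF \<nu> \<psi>] filterlim_real_sequentially])
  from l2norm_tendsto_AE_subseq[OF sq_int_Tinv_on_cball[OF \<nu> \<psi>] \<psi> this]
  obtain r :: "nat \<Rightarrow> nat" where r: "strict_mono r" and lim: "AE x in gauss_measure \<nu>. (\<lambda>n. ?F (real (r n)) x) \<longlonglongrightarrow> \<psi> x"
    by blast
  from lim show ?thesis
    unfolding AE_gauss_measure
  proof eventually_elim
    case (elim x)
    show ?case
    proof
      assume "integrable lebesgue (Tinv_integrand \<nu> (T_op \<nu> \<psi>) x)"
      from filterlim_compose[OF Tinv_on_cball_tendsto_UNIV[OF this]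
          filterlim_compose[OF filterlim_real_sequentially filterlim_subseq[OF r]]]
      show "\<psi> x = Tinv_on \<nu> UNIV (T_op \<nu> \<psi>) x"
        by (rule LIMSEQ_unique[OF elim])
    qed
  qed
qed

lemma T_op_eq_iff_AE:
  assumes \<nu>: "\<nu> > 0" and f: "sq_int (gauss_measure \<nu>) f" and g: "sq_int (gauss_measure \<nu>) g"
  shows "T_op \<nu> f = T_op \<nu> g \<longleftrightarrow> (AE x in lebesgue. f x = g x)"
proof
  assume "T_op \<nu> f = T_op \<nu> g"
  hence "l2norm (gauss_measure \<nu>) (\<lambda>x. f x - g x) = 0"
    using T_op_isometry[OF \<nu> sq_int_diff[OF f g]] by (simp add: T_op_diff[OF \<nu> f g] l2norm_def)
  thus "AE x in lebesgue. f x = g x"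
    by (simp add: l2norm_eq_0_iff[OF sq_int_diff[OF f g]] AE_gauss_measure)
qed (rule T_op_cong_AE[OF sq_int_lebesgue_measurable[OF f] sq_int_lebesgue_measurable[OF g]])

lemma isometric_isomorphism_T_op:
  assumes \<nu>: "\<nu> > 0"
  shows "isometric_isomorphism_L2 \<nu> (T_op \<nu>) (L2_gauss \<nu>) (Fock2 \<nu>)"
  unfolding isometric_isomorphism_L2_def Fock2_def norm_gauss_eq
proof (intro conjI ballI allI)
  fix f g :: "complex \<Rightarrow> complex" and a b :: complex
  assume f: "f \<in> L2_gauss \<nu>"
  note f' = f[unfolded L2_gauss_iff]
  show "T_op \<nu> f \<in> {f. holomorphic2 f} \<inter> L2_gauss \<nu>"
    using holomorphic2_T_op[OF \<nu> f'] sq_int_T_op[OF \<nu> f'] by (simp add: L2_gauss_iff)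
  show "l2norm (gauss_measure \<nu>) (T_op \<nu> f) = l2norm (gauss_measure \<nu>) f"
    by (rule T_op_isometry[OF \<nu> f'])
  assume g: "g \<in> L2_gauss \<nu>"
  note g' = g[unfolded L2_gauss_iff]
  show "T_op \<nu> f = T_op \<nu> g \<longleftrightarrow> (AE x in lebesgue. f x = g x)"
    by (rule T_op_eq_iff_AE[OF \<nu> f' g'])
  show "T_op \<nu> (\<lambda>x. a * f x + b * g x) = (\<lambda>y. a * T_op \<nu> f y + b * T_op \<nu> g y)"
    by (rule T_op_linear[OF \<nu> f' g'])
next
  fix h :: "complex \<times> complex \<Rightarrow> complex"
  assume "h \<in> {f. holomorphic2 f} \<inter> L2_gauss \<nu>"
  thus "\<exists>f\<in>L2_gauss \<nu>. T_op \<nu> f = h"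
    using T_op_surjective[OF \<nu>] unfolding L2_gauss_iff Int_iff mem_Collect_eq Bex_def by blast
qed

theorem theorem3p1:
  fixes \<nu> :: real
  assumes "\<nu> > 0"
  shows "(\<forall>\<psi>\<in>L2_gauss \<nu>. \<forall>z w. integrable lebesgue (\<lambda>\<xi>. T_kernel \<nu> z w \<xi> * \<psi> \<xi>))
    \<and> isometric_isomorphism_L2 \<nu> (T_op \<nu>) (L2_gauss \<nu>) (Fock2 \<nu>)
    \<and> (\<forall>\<phi>\<in>Fock2 \<nu>. \<forall>\<psi>\<in>L2_gauss \<nu>. T_op \<nu> \<psi> = \<phi> \<longrightarrow>
          tendsto_L2_gauss \<nu> (\<lambda>R. Tinv_on \<nu> (cball 0 R) \<phi>) \<psi> \<and>
          (AE \<xi> in lebesgue. integrable lebesgue (Tinv_integrand \<nu> \<phi> \<xi>)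
              \<longrightarrow> \<psi> \<xi> = Tinv_on \<nu> UNIV \<phi> \<xi>))
    \<and> (\<forall>m n z w. has_bochner_integral lebesgue
          (\<lambda>\<xi>. T_kernel \<nu> z w \<xi> * complex_hermite \<nu> m n \<xi>)
          (complex_of_real (pi / \<nu>) * complex_of_real \<nu> ^ (m + n) * z ^ m * w ^ n))"
proof (intro conjI ballI allI impI)
  show "isometric_isomorphism_L2 \<nu> (T_op \<nu>) (L2_gauss \<nu>) (Fock2 \<nu>)"
    by (rule isometric_isomorphism_T_op[OF assms])
next
  fix \<psi> :: "complex \<Rightarrow> complex" and z w
  assume "\<psi> \<in> L2_gauss \<nu>"
  thus "integrable lebesgue (\<lambda>\<xi>. T_kernel \<nu> z w \<xi> * \<psi> \<xi>)"
    unfolding L2_gauss_iff by (rule T_integrable[OF assms])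
next
  fix \<phi> and \<psi> :: "complex \<Rightarrow> complex"
  assume "\<psi> \<in> L2_gauss \<nu>" and \<phi>: "T_op \<nu> \<psi> = \<phi>"
  hence \<psi>: "sq_int (gauss_measure \<nu>) \<psi>" by (simp add: L2_gauss_iff)
  show "tendsto_L2_gauss \<nu> (\<lambda>R. Tinv_on \<nu> (cball 0 R) \<phi>) \<psi>"
    unfolding tendsto_L2_gauss_def L2_gauss_iff norm_gauss_eq \<phi>[symmetric]
    using sq_int_Tinv_on_cball[OF assms \<psi>] \<psi> tendsto_Tinv_on_cball[OF assms \<psi>] by blast
  show "AE \<xi> in lebesgue. integrable lebesgue (Tinv_integrand \<nu> \<phi> \<xi>) \<longrightarrow> \<psi> \<xi> = Tinv_on \<nu> UNIV \<phi> \<xi>"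
    unfolding \<phi>[symmetric] by (rule Tinv_on_UNIV_AE[OF assms \<psi>])
next
  fix m n z w
  show "has_bochner_integral lebesgue (\<lambda>\<xi>. T_kernel \<nu> z w \<xi> * complex_hermite \<nu> m n \<xi>)
      (complex_of_real (pi / \<nu>) * complex_of_real \<nu> ^ (m + n) * z ^ m * w ^ n)"
    by (rule T_kernel_complex_hermite[OF assms])
qed

end
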